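(* Let $G$ be a nonsingular even integral symmetric $n\times n$ matrix ($n\ge1$), $D=\det G$, $N$ its level, $G^\perp=NG^{-1}$. Let $c\ge1$ and $a\neq0$ be integers with $\gcd(c,a)=\gcd(c,N)=1$, let $\mathbf{w}\in G^{-1}\mathbb{Z}^n$, $\mathbf{h}=(h_1,\dots,h_n)\in\mathbb{Z}^n$, and $u=c/\gcd(c,h_1,\dots,h_n)$. Then $$\sum_{\substack{\mathbf{v}\in\mathbb{Z}^n/c\mathbb{Z}^n\\ \mathbf{v}^T\mathbf{h}\equiv0\ (\mathrm{mod}\ c)}}e\!\left(\frac ac\cdot\tfrac12(\mathbf{v}+\mathbf{w})^TG(\mathbf{v}+\mathbf{w})\right)=c^{n/2}\left(\frac{|a|}{c}\right)_K^n\left(\frac Dc\right)_K e\!\left(\frac{n\,\mathrm{sgn}(a)(1-c_0)}{8}\right)e\!\left(\frac{ac'}{2}\mathbf{w}^TG\mathbf{w}\right)C,$$ where $c_0$ is the odd part of $c$, $c'$ is any integer with $cc'\equiv1\pmod{aN}$, and $C=1$ if $\mathbf{h}^TG^\perp\mathbf{h}\equiv0\pmod{2c}$ and $N\mathbf{w}^T\mathbf{h}\equiv0\pmod c$; $C=0$ if $\mathbf{h}^TG^\perp\mathbf{h}\equiv0\pmod{2c}$ and $N\mathbf{w}^T\mathbf{h}\not\equiv0\pmod c$; and, if $\mathbf{h}^TG^\perp\mathbf{h}\not\equiv0\pmod{2c}$, $$C=u^{-1}\sum_{v=0}^{u-1}e\!\left(\frac{a^\perp\mathbf{h}^TG^\perp\mathbf{h}}{2c}\Big(v^2-\frac{2aN\mathbf{w}^T\mathbf{h}}{\mathbf{h}^TG^\perp\mathbf{h}}v\Big)\right),$$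 with $a^\perp$ any integer satisfying $a^\perp aN\equiv-1\pmod c$.
   Context: $e(z)=\exp(2\pi i z)$. Even integral: integer entries, even diagonal. Level: least positive $N$ with $NG^{-1}$ even integral. $(\frac{\cdot}{\cdot})_K$ is the Kronecker–Jacobi symbol; $c=2^ec_0$ with $c_0$ odd. The summand on the left is independent of integer representatives $\mathbf{v}$. *)

theory Defs
  imports
    "HOL-Analysis.Analysis"
    "HOL-Number_Theory.Residues"
    "HOL-Library.Real_Mod"
begin

definition e2pi :: "complex \<Rightarrow> complex" where
  "e2pi z = exp (2 * of_real pi * \<i> * z)"

definition real_vec :: "int ^ 'n \<Rightarrow> real ^ 'n" where
  "real_vec x = (\<chi> i. real_of_int (x $ i))"

definition even_integral :: "real ^ 'n ^ 'n \<Rightarrow> bool" where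
  "even_integral A \<longleftrightarrow>
     (\<forall>i j. A $ i $ j \<in> \<int>) \<and> (\<forall>i. \<exists>k::int. A $ i $ i = 2 * real_of_int k)"

definition level :: "real ^ 'n ^ 'n \<Rightarrow> nat" where
  "level G = (LEAST N. N > 0 \<and> even_integral (real N *\<^sub>R matrix_inv G))"

(* The library's Legendre symbol only has its usual meaning at odd primes
   (every odd integer is a square modulo 2), so the prime 2 is treated separately. *)
definition kronecker_prime :: "int \<Rightarrow> int \<Rightarrow> int" where
  "kronecker_prime a p =
     (if p = 2 then (if even a then 0 else if a mod 8 = 1 \<or> a mod 8 = 7 then 1 else -1)
      else Legendre a p)"

(* The factor in front of the product is the value at the unit part of m:
   (a / -1) = -1 for a < 0 and 1 otherwise, and (a / 1) = 1. *)
definition kronecker :: "int \<Rightarrow> int \<Rightarrow> int" where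
  "kronecker a m =
     (if m = 0 then (if \<bar>a\<bar> = 1 then 1 else 0)
      else (if m < 0 \<and> a < 0 then -1 else 1) *
           (\<Prod>p\<in>#prime_factorization \<bar>m\<bar>. kronecker_prime a p))"

(* R contains exactly one representative of every class of Z^n / c Z^n. *)
definition residue_system :: "int \<Rightarrow> (int ^ 'n) set \<Rightarrow> bool" where
  "residue_system c R \<longleftrightarrow> (\<forall>x. \<exists>!v. v \<in> R \<and> (\<forall>i. [x $ i = v $ i] (mod c)))"

end

theory Submission
  imports Defs "HOL-Number_Theory.Euler_Criterion"
begin

text \<open>
  Detecting \<open>v\<^sup>T h \<equiv> 0\<close> by additive characters modulo \<open>c\<close> and completing the square (possible since
  \<open>G G\<^sup>\<bottom> = N\<close> is a unit modulo \<open>c\<close>) splits off the complete sum \<open>S(a; c)\<close> of \<open>e(a Q(v) / c)\<close>; what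
  remains is the one-variable mean \<open>C\<close>, whose period is \<open>u\<close> rather than \<open>c\<close>.

  The complete sum is multiplicative, \<open>S(a; c d) = S(a d; c) S(a c; d)\<close> for coprime \<open>c\<close>, \<open>d\<close>, and
  \<open>S(a; p\<^sup>2 c) = p\<^sup>n S(a; c)\<close> for every prime \<open>p\<close> not dividing \<open>a D\<close>, so only prime moduli remain.
  Modulo an odd prime the form is diagonalised; modulo 2 it splits into binary blocks, because it is even
  with odd determinant. The one-variable sum is compared with the sum of \<open>e(2 x\<^sup>2 / c)\<close> by the same two
  reductions, which makes quadratic reciprocity unnecessary. The sign of that last sum is Gauss's
  evaluation: at \<open>q = e(-1 / c)\<close> the alternating sum of Gaussian binomials is the sum of
  \<open>e(j (j + 1) / (2 c))\<close>, and it is also a product in which every sine is positive.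
\<close>

section \<open>Additive characters and sums over residue classes\<close>

text \<open>The comparison sum is that of \<open>2 x^2\<close> because halving v^T G v modulo an odd
  prime is multiplication by the inverse of 2, which equals 2 up to a square; its value sqrt(c) e((1
  - c) / 8) needs no distinction of \<open>c\<close> modulo 4. A negative \<open>a\<close>
  conjugates it, hence the sign of \<open>a\<close> in the phase. An even \<open>c\<close> forces
  \<open>D\<close> odd, and an even form of odd determinant has even dimension; so the
  \<open>n\<close>-th powers of symbols are 1 there and only the odd part \<open>c0\<close> is left
  in the phase. Two obstacles shape the rest. The dimension is a type, so splitting a form cannot
  lower it: sums are replaced by means, which ignore the coordinates on which a function does not
  depend. And matrices over Z/p are never formed: base changes are integral with denominators
  cleared, and their determinants, prime to \<open>p\<close>, enter only as squares, which the
  symbol ignores. The real vector \<open>w\<close> enters only through the integral vectors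
  \<open>G w\<close> and \<open>N w\<close>; its own phase is the one exponent whose denominator is
  not \<open>c\<close>.\<close>

lemma int_congE:
  fixes x y n :: int
  assumes "[x = y] (mod n)" obtains k where "x = y + n * k"
  using cong_sym[OF assms] unfolding cong_iff_lin by blast

text \<open>This is e(x / c) with an integer numerator, so that exponents can be changed by
  congruences modulo \<open>c\<close>.\<close>

definition ec :: "int \<Rightarrow> int \<Rightarrow> complex" where
  "ec c x = cis (2 * pi * of_int x / of_int c)"

lemma ec_0 [simp]: "ec c 0 = 1"
  by (simp add: ec_def)

lemma ec_add: "ec c (x + y) = ec c x * ec c y"
  by (simp add: ec_def cis_mult add_divide_distrib ring_distribs)

lemma ec_minus: "ec c (- x) = cnj (ec c x)"
  by (simp add: ec_def cis_cnj)

lemma ec_nonzero [simp]: "ec c x \<noteq> 0"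
  by (simp add: ec_def)

lemma ec_cancel: "k \<noteq> 0 \<Longrightarrow> ec (k * c) (k * x) = ec c x"
  by (simp add: ec_def mult.assoc)

lemma ec_multiple: "ec c (c * k) = 1"
proof (cases "c = 0")
  case False
  then have "2 * pi * of_int (c * k) / of_int c = 2 * pi * of_int k" by simp
  then show ?thesis by (simp add: ec_def)
qed (simp add: ec_def)

lemma ec_cong:
  assumes "[x = y] (mod c)" shows "ec c x = ec c y"
proof -
  obtain k where "x = y + c * k" using assms by (rule int_congE)
  then show ?thesis by (simp add: ec_add ec_multiple)
qed

lemma ec_eq_1_iff:
  assumes "c \<noteq> 0" shows "ec c x = 1 \<longleftrightarrow> c dvd x"
proof
  assume "ec c x = 1"
  then have "cos (2 * pi * of_int x / of_int c) = 1"
    by (simp add: ec_def cis.code complex_eq_iff)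
  then obtain k :: int where "2 * pi * of_int x / of_int c = of_int k * (2 * pi)"
    by (auto simp: cos_one_2pi_int mult.commute)
  then have "(2 * pi) * (of_int x / of_int c) = (2 * pi) * of_int k" by (simp add: mult_ac)
  then have "of_int x / of_int c = (of_int k :: real)" by (subst (asm) mult_left_cancel) auto
  then have "(of_int x :: real) = of_int (k * c)" using assms by (simp add: field_simps)
  then have "x = k * c" by linarith
  then show "c dvd x" by simp
next
  assume "c dvd x"
  then show "ec c x = 1" by (auto simp: ec_multiple)
qed

lemma e2pi_of_real: "e2pi (complex_of_real x) = cis (2 * pi * x)"
  by (simp add: e2pi_def cis_conv_exp mult_ac)

section \<open>Boxes of representatives and sums over residue classes of vectors\<close>

definition rbox :: "int \<Rightarrow> (int ^ 'n) set" where
  "rbox c = {v. \<forall>i. 0 \<le> v $ i \<and> v $ i < c}"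

definition vcong :: "int \<Rightarrow> int ^ 'n \<Rightarrow> int ^ 'n \<Rightarrow> bool" where
  "vcong c v w \<longleftrightarrow> (\<forall>i. [v $ i = w $ i] (mod c))"

definition periodic :: "int \<Rightarrow> (int ^ 'n \<Rightarrow> complex) \<Rightarrow> bool" where
  "periodic c f \<longleftrightarrow> (\<forall>v w. vcong c v w \<longrightarrow> f v = f w)"

definition vmod :: "int \<Rightarrow> int ^ 'n \<Rightarrow> int ^ 'n" where
  "vmod c v = (\<chi> i. v $ i mod c)"

lemma vmod_in_rbox: "c > 0 \<Longrightarrow> vmod c v \<in> rbox c"
  by (simp add: vmod_def rbox_def)

lemma vcong_vmod: "vcong c (vmod c v) v"
  by (simp add: vcong_def vmod_def cong_def)

lemma vcong_sym: "vcong c v w \<Longrightarrow> vcong c w v"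
  by (simp add: vcong_def cong_sym_eq)

lemma vcong_trans: "vcong c v w \<Longrightarrow> vcong c w x \<Longrightarrow> vcong c v x"
  by (auto simp: vcong_def cong_def)

lemma vcong_rbox: "v \<in> rbox c \<Longrightarrow> w \<in> rbox c \<Longrightarrow> vcong c v w \<Longrightarrow> v = w"
  by (auto simp: vcong_def rbox_def vec_eq_iff cong_def)

lemma rbox_eq_image: "rbox c = vec_lambda ` (UNIV \<rightarrow>\<^sub>E {0..<c})"
proof
  show "rbox c \<subseteq> vec_lambda ` (UNIV \<rightarrow>\<^sub>E {0..<c})"
  proof
    fix v :: "int ^ 'n" assume "v \<in> rbox c"
    then have "v = vec_lambda (vec_nth v)" "vec_nth v \<in> (UNIV \<rightarrow>\<^sub>E {0..<c})"
      by (auto simp: rbox_def)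
    then show "v \<in> vec_lambda ` (UNIV \<rightarrow>\<^sub>E {0..<c})" by blast
  qed
qed (auto simp: rbox_def PiE_def Pi_def)

lemma finite_rbox [simp]: "finite (rbox c :: (int ^ 'n) set)"
  unfolding rbox_eq_image by (intro finite_imageI finite_PiE) auto

lemma card_rbox: "c \<ge> 0 \<Longrightarrow> card (rbox c :: (int ^ 'n) set) = nat c ^ CARD('n)"
proof -
  have "inj_on vec_lambda (UNIV \<rightarrow>\<^sub>E {0..<c} :: ('n \<Rightarrow> int) set)"
    by (auto simp: inj_on_def vec_lambda_inject)
  then show ?thesis
    unfolding rbox_eq_image by (simp add: card_image card_PiE)
qed

lemma sum_residue_system:
  fixes f :: "int ^ 'n \<Rightarrow> complex"
  assumes "c > 0" "residue_system c R" "periodic c f"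
  shows "(\<Sum>v\<in>R. f v) = (\<Sum>v\<in>rbox c. f v)"
proof (rule sum.reindex_bij_witness[where j = "vmod c"
      and i = "\<lambda>x. THE v. v \<in> R \<and> vcong c x v"])
  have ex: "\<exists>!v. v \<in> R \<and> vcong c x v" for x
    using assms(2) by (auto simp: residue_system_def vcong_def)
  fix v assume v: "v \<in> R"
  show "(THE w. w \<in> R \<and> vcong c (vmod c v) w) = v"
    using ex[of "vmod c v"] v vcong_vmod by (metis (mono_tags, lifting) the_equality)
  show "vmod c v \<in> rbox c" using assms vmod_in_rbox by blast
  show "f (vmod c v) = f v" using assms(3) vcong_vmod by (auto simp: periodic_def)
next
  have ex: "\<exists>!v. v \<in> R \<and> vcong c x v" for x
    using assms(2) by (auto simp: residue_system_def vcong_def)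
  fix x :: "int ^ 'n" assume x: "x \<in> rbox c"
  have t: "(THE v. v \<in> R \<and> vcong c x v) \<in> R \<and> vcong c x (THE v. v \<in> R \<and> vcong c x v)"
    using theI'[OF ex] .
  then show "(THE v. v \<in> R \<and> vcong c x v) \<in> R" by blast
  show "vmod c (THE v. v \<in> R \<and> vcong c x v) = x"
    using t x vmod_in_rbox[OF assms(1)] vcong_rbox vcong_trans vcong_vmod vcong_sym by meson
qed

text \<open>\<open>vmod c\<close> after \<open>T\<close> maps the finite box injectively into
  itself, hence onto. This one principle covers translations, multiplication by units and matrices
  invertible modulo \<open>c\<close>.\<close>

lemma sum_rbox_reindex:
  fixes f :: "int ^ 'n \<Rightarrow> complex" and T :: "int ^ 'n \<Rightarrow> int ^ 'n"
  assumes "c > 0" "periodic c f"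
    and inj: "\<And>v w. vcong c (T v) (T w) \<Longrightarrow> vcong c v w"
  shows "(\<Sum>v\<in>rbox c. f (T v)) = (\<Sum>v\<in>rbox c. f v)"
proof -
  have inj': "inj_on (vmod c \<circ> T) (rbox c)"
  proof (rule inj_onI)
    fix v w assume vw: "v \<in> rbox c" "w \<in> rbox c" "(vmod c \<circ> T) v = (vmod c \<circ> T) w"
    then have "vcong c (T v) (T w)"
      by (metis comp_apply vcong_sym vcong_trans vcong_vmod)
    then show "v = w" using inj vw vcong_rbox by blast
  qed
  moreover have "(vmod c \<circ> T) ` rbox c \<subseteq> rbox c"
    using vmod_in_rbox[OF assms(1)] by auto
  ultimately have im: "(vmod c \<circ> T) ` rbox c = rbox c"
    using endo_inj_surj[OF finite_rbox] by blast
  have "(\<Sum>v\<in>rbox c. f v) = (\<Sum>v\<in>rbox c. f ((vmod c \<circ> T) v))"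
    using sum.reindex[OF inj', of f] im by simp
  also have "\<dots> = (\<Sum>v\<in>rbox c. f (T v))"
    using assms(2) vcong_vmod by (auto simp: periodic_def intro!: sum.cong)
  finally show ?thesis by simp
qed

text \<open>Digits in base \<open>c1\<close>: \<open>x\<close> is the remainder and \<open>y\<close>
  the quotient of \<open>v\<close>. The splittings at coprime moduli, at a prime and at the period
  \<open>u\<close> all start here.\<close>

lemma sum_rbox_mult:
  fixes f :: "int ^ 'n \<Rightarrow> complex"
  assumes "c1 > 0" "c2 > 0"
  shows "(\<Sum>v\<in>rbox (c1 * c2). f v) = (\<Sum>x\<in>rbox c1. \<Sum>y\<in>rbox c2. f (x + c1 *s y))"
proof -
  have "(\<Sum>v\<in>rbox (c1 * c2). f v) = (\<Sum>(x, y)\<in>rbox c1 \<times> rbox c2. f (x + c1 *s y))"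
  proof (rule sum.reindex_bij_witness[where i = "\<lambda>(x, y). x + c1 *s y"
        and j = "\<lambda>v. (vmod c1 v, \<chi> i. v $ i div c1)"])
    fix v :: "int ^ 'n" assume v: "v \<in> rbox (c1 * c2)"
    show "(\<lambda>(x, y). x + c1 *s y) (vmod c1 v, \<chi> i. v $ i div c1) = v"
      by (simp add: vec_eq_iff vmod_def)
    have "v $ i div c1 < c2" for i
    proof (rule ccontr)
      assume "\<not> v $ i div c1 < c2"
      then have "c1 * c2 \<le> c1 * (v $ i div c1)" using assms by simp
      also have "\<dots> \<le> v $ i" using minus_mod_eq_mult_div[of "v $ i" c1] pos_mod_sign[of c1 "v $ i"] assms by linarith
      finally show False using v linorder_not_less[of "v $ i" "c1 * c2"] by (simp add: rbox_def)
    qed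
    then show "(vmod c1 v, \<chi> i. v $ i div c1) \<in> rbox c1 \<times> rbox c2"
      using v assms by (simp add: vmod_in_rbox) (simp add: rbox_def pos_imp_zdiv_nonneg_iff)
    show "(case (vmod c1 v, \<chi> i. v $ i div c1) of (x, y) \<Rightarrow> f (x + c1 *s y)) = f v"
      by (simp add: vmod_def) (rule arg_cong[of _ _ f], simp add: vec_eq_iff)
  next
    fix xy :: "(int ^ 'n) \<times> (int ^ 'n)" assume xy: "xy \<in> rbox c1 \<times> rbox c2"
    obtain x y where [simp]: "xy = (x, y)" by force
    have x: "0 \<le> x $ i" "x $ i < c1" and y: "0 \<le> y $ i" "y $ i < c2" for i
      using xy by (auto simp: rbox_def)
    have "x $ i + c1 * y $ i < c1 * c2" for i
    proof -
      have "y $ i + 1 \<le> c2" using y[of i] by simp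
      then have "c1 * (y $ i + 1) \<le> c1 * c2" using assms by (intro mult_left_mono) auto
      then show ?thesis using x[of i] by (simp add: algebra_simps)
    qed
    then show "(case xy of (x, y) \<Rightarrow> x + c1 *s y) \<in> rbox (c1 * c2)"
      using x y assms by (simp add: rbox_def)
    show "(vmod c1 (case xy of (x, y) \<Rightarrow> x + c1 *s y),
        \<chi> i. (case xy of (x, y) \<Rightarrow> x + c1 *s y) $ i div c1) = xy"
      using x y assms by (simp add: vec_eq_iff vmod_def)
  qed
  then show ?thesis by (simp add: sum.cartesian_product)
qed

text \<open>Normalised so that the average of a function of few coordinates does not depend on the
  ambient dimension. Coordinates can then be split off while the type \<open>'n\<close> stays the
  same.\<close>

definition mean :: "int \<Rightarrow> (int ^ 'n \<Rightarrow> complex) \<Rightarrow> complex" where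
  "mean c f = (\<Sum>v\<in>rbox c. f v) / of_int c ^ CARD('n)"

lemma mean_const [simp]: "c > 0 \<Longrightarrow> mean c (\<lambda>_. z) = z"
  by (simp add: mean_def card_rbox)

lemma mean_sum: "mean c (\<lambda>v. \<Sum>a\<in>A. f a v) = (\<Sum>a\<in>A. mean c (f a))"
  unfolding mean_def by (subst sum.swap) (simp add: sum_divide_distrib)

lemma mean_mult_left: "mean c (\<lambda>v. z * f v) = z * mean c f"
  by (simp add: mean_def sum_distrib_left)

text \<open>Exchanging the coordinates outside \<open>E\<close> between \<open>v\<close> and \<open>w\<close> is an involution of the
  pairs, which turns \<open>f v * g w\<close> into \<open>f v * g v\<close>.\<close>

lemma mean_independent:
  fixes f g :: "int ^ 'n \<Rightarrow> complex"
  assumes "c > 0"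
    and f: "\<And>v w. (\<And>i. i \<in> E \<Longrightarrow> v $ i = w $ i) \<Longrightarrow> f v = f w"
    and g: "\<And>v w. (\<And>i. i \<notin> E \<Longrightarrow> v $ i = w $ i) \<Longrightarrow> g v = g w"
  shows "mean c (\<lambda>v. f v * g v) = mean c f * mean c g"
proof -
  define mix :: "int ^ 'n \<Rightarrow> int ^ 'n \<Rightarrow> int ^ 'n" where
    "mix v w = (\<chi> i. if i \<in> E then v $ i else w $ i)" for v w
  have "(\<Sum>v\<in>rbox c. f v) * (\<Sum>w\<in>rbox c. g w) = (\<Sum>(v, w)\<in>rbox c \<times> rbox c. f v * g w)"
    by (simp only: sum_product sum.cartesian_product)
  also have "\<dots> = (\<Sum>(v, w :: int ^ 'n)\<in>rbox c \<times> rbox c. f v * g v)"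
  proof -
    have "f (mix v w) * g (mix v w) = f v * g w" for v w
      using f[of "mix v w" v] g[of "mix v w" w] by (simp add: mix_def)
    moreover have "mix (mix v w) (mix w v) = v" for v w
      by (simp add: mix_def vec_eq_iff)
    moreover have "v \<in> rbox c \<Longrightarrow> w \<in> rbox c \<Longrightarrow> mix v w \<in> rbox c" for v w
      by (simp add: mix_def rbox_def)
    ultimately show ?thesis
      by (intro sum.reindex_bij_witness[where i = "\<lambda>(v, w). (mix v w, mix w v)"
        and j = "\<lambda>(v, w). (mix v w, mix w v)"]) auto
  qed
  also have "\<dots> = (\<Sum>v\<in>rbox c. f v * g v) * of_int c ^ CARD('n)"
    using assms(1) by (simp add: sum.cartesian_product[symmetric] card_rbox sum_distrib_left mult_ac)
  finally show ?thesis
    using assms(1) by (simp add: mean_def field_simps)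
qed

lemma mean_reindex:
  fixes f :: "int ^ 'n \<Rightarrow> complex" and T :: "int ^ 'n \<Rightarrow> int ^ 'n"
  assumes "c > 0" "periodic c f" "\<And>v w. vcong c (T v) (T w) \<Longrightarrow> vcong c v w"
  shows "mean c (\<lambda>v. f (T v)) = mean c f"
  unfolding mean_def using sum_rbox_reindex[OF assms] by simp

text \<open>Translation along axis \<open>i\<close> carries each value of the coordinate to 0, so
  all \<open>c\<close> values have the same mean, and these means add up to 1.\<close>

lemma mean_eq_coord:
  fixes i :: "'n::finite"
  assumes "c > 0" "0 \<le> x" "x < c"
  shows "mean c (\<lambda>v :: int ^ 'n. of_bool (v $ i = x)) = 1 / of_int c"
proof -
  define I :: "int \<Rightarrow> int ^ 'n \<Rightarrow> complex" where "I y v = of_bool ([v $ i = y] (mod c))" for y v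
  have per: "periodic c (I y)" for y
    by (auto simp: periodic_def vcong_def I_def cong_def)
  have eq: "mean c (I y) = mean c (I 0)" for y
  proof -
    have "mean c (\<lambda>v. I y (v + axis i y)) = mean c (I y)"
      by (rule mean_reindex[OF assms(1) per]) (auto simp: vcong_def cong_add_rcancel)
    moreover have "I y (v + axis i y) = I 0 v" for v
      using cong_add_rcancel[of "v $ i" y 0 c] by (simp add: I_def)
    ultimately show ?thesis by simp
  qed
  have I: "v \<in> rbox c \<Longrightarrow> 0 \<le> y \<Longrightarrow> y < c \<Longrightarrow> I y v = of_bool (v $ i = y)" for y v
    by (simp add: I_def rbox_def cong_def)
  have "(\<Sum>y\<in>{0..<c}. mean c (I y)) = mean c (\<lambda>v :: int ^ 'n. \<Sum>y\<in>{0..<c}. I y v)"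
    by (simp add: mean_sum)
  also have "\<dots> = mean c (\<lambda>v :: int ^ 'n. 1)"
    unfolding mean_def
  proof (intro arg_cong2[where f = "(/)"] sum.cong refl)
    fix v :: "int ^ 'n" assume v: "v \<in> rbox c"
    have "(\<Sum>y\<in>{0..<c}. I y v) = (\<Sum>y\<in>{0..<c}. of_bool (v $ i = y))"
      using I[OF v] by (intro sum.cong) auto
    also have "\<dots> = 1"
      using v by (simp add: of_bool_def rbox_def)
    finally show "(\<Sum>y\<in>{0..<c}. I y v) = 1" .
  qed
  finally have "of_int c * mean c (I 0) = 1"
    using assms(1) by (subst (asm) eq) simp
  moreover have "mean c (\<lambda>v :: int ^ 'n. of_bool (v $ i = x)) = mean c (I x)"
    unfolding mean_def using I assms by (intro arg_cong2[where f = "(/)"] sum.cong) auto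
  ultimately show ?thesis
    using eq[of x] assms(1) by (simp add: field_simps)
qed

lemma mean_coord:
  fixes i :: "'n::finite"
  assumes "c > 0"
  shows "mean c (\<lambda>v :: int ^ 'n. f (v $ i)) = (\<Sum>x\<in>{0..<c}. f x) / of_int c"
proof -
  have "mean c (\<lambda>v :: int ^ 'n. f (v $ i)) =
      mean c (\<lambda>v :: int ^ 'n. \<Sum>x\<in>{0..<c}. f x * of_bool (v $ i = x))"
    unfolding mean_def
  proof (intro arg_cong2[where f = "(/)"] sum.cong refl)
    fix v :: "int ^ 'n" assume v: "v \<in> rbox c"
    have "(\<Sum>x\<in>{0..<c}. f x * of_bool (v $ i = x)) = (\<Sum>x\<in>{0..<c}. if v $ i = x then f x else 0)"
      by (intro sum.cong refl) auto
    then show "f (v $ i) = (\<Sum>x\<in>{0..<c}. f x * of_bool (v $ i = x))"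
      using v by (simp add: rbox_def)
  qed
  also have "\<dots> = (\<Sum>x\<in>{0..<c}. f x * (1 / of_int c))"
    unfolding mean_sum mean_mult_left
    using assms by (intro sum.cong refl) (simp only: mean_eq_coord atLeastLessThan_iff)
  finally show ?thesis by (simp add: sum_divide_distrib)
qed

lemma mean_coord2:
  fixes i j :: "'n::finite"
  assumes "c > 0" "i \<noteq> j"
  shows "mean c (\<lambda>v :: int ^ 'n. f (v $ i) (v $ j)) =
    (\<Sum>x\<in>{0..<c}. \<Sum>y\<in>{0..<c}. f x y) / of_int c ^ 2"
proof -
  have "mean c (\<lambda>v :: int ^ 'n. f (v $ i) (v $ j)) =
      mean c (\<lambda>v :: int ^ 'n. \<Sum>x\<in>{0..<c}. \<Sum>y\<in>{0..<c}.
        f x y * (of_bool (v $ i = x) * of_bool (v $ j = y)))"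
    unfolding mean_def
  proof (intro arg_cong2[where f = "(/)"] sum.cong refl)
    fix v :: "int ^ 'n" assume v: "v \<in> rbox c"
    have "(\<Sum>x\<in>{0..<c}. \<Sum>y\<in>{0..<c}. f x y * (of_bool (v $ i = x) * of_bool (v $ j = y)))
      = (\<Sum>x\<in>{0..<c}. if v $ i = x then \<Sum>y\<in>{0..<c}. if v $ j = y then f x y else 0 else 0)"
      by (intro sum.cong refl) auto
    also have "\<dots> = f (v $ i) (v $ j)"
      using v by (simp add: rbox_def)
    finally show "f (v $ i) (v $ j) =
      (\<Sum>x\<in>{0..<c}. \<Sum>y\<in>{0..<c}. f x y * (of_bool (v $ i = x) * of_bool (v $ j = y)))" by simp
  qed
  also have "\<dots> = (\<Sum>x\<in>{0..<c}. \<Sum>y\<in>{0..<c}. f x y * (1 / of_int c * (1 / of_int c)))"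
  proof -
    have "mean c (\<lambda>v :: int ^ 'n. of_bool (v $ i = x) * of_bool (v $ j = y)) =
      1 / of_int c * (1 / of_int c)" if "x \<in> {0..<c}" "y \<in> {0..<c}" for x y
      using that assms
      by (subst mean_independent[where E = "{i}"]) (auto simp: mean_eq_coord)
    then show ?thesis
      unfolding mean_sum mean_mult_left by (intro sum.cong refl) (simp only:)
  qed
  finally show ?thesis by (simp add: sum_divide_distrib power2_eq_square)
qed

section \<open>Quadratic forms modulo an integer\<close>

definition dot :: "int ^ 'n \<Rightarrow> int ^ 'n \<Rightarrow> int" where
  "dot v w = (\<Sum>i\<in>UNIV. v $ i * w $ i)"

lemma dot_commute: "dot v w = dot w v"
  by (simp add: dot_def mult.commute)

lemma dot_add_left: "dot (u + v) w = dot u w + dot v w"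
  by (simp add: dot_def sum.distrib ring_distribs)

lemma dot_add_right: "dot w (u + v) = dot w u + dot w v"
  by (simp add: dot_def sum.distrib ring_distribs)

lemma dot_scale_left: "dot (k *s v) w = k * dot v w"
  by (simp add: dot_def sum_distrib_left mult_ac)

lemma dot_scale_right: "dot v (k *s w) = k * dot v w"
  by (simp add: dot_def sum_distrib_left mult_ac)

lemma dot_axis [simp]: "dot (axis i k) v = k * v $ i"
  by (simp add: dot_def axis_def if_distrib [of "\<lambda>x. x * _"] cong: if_cong)

lemma dot_matrix: "dot v (A *v w) = dot (transpose A *v v) w"
proof -
  have "dot v (A *v w) = (\<Sum>i\<in>UNIV. \<Sum>j\<in>UNIV. v $ i * A $ i $ j * w $ j)"
    by (simp add: dot_def matrix_vector_mult_def sum_distrib_left mult_ac)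
  also have "\<dots> = (\<Sum>j\<in>UNIV. \<Sum>i\<in>UNIV. v $ i * A $ i $ j * w $ j)"
    by (rule sum.swap)
  also have "\<dots> = dot (transpose A *v v) w"
    unfolding dot_def matrix_vector_mult_def transpose_def vec_lambda_beta sum_distrib_right
    by (simp add: mult_ac)
  finally show ?thesis .
qed

lemma dot_symmetric_matrix:
  assumes "transpose A = A" shows "dot v (A *v w) = dot w (A *v v)"
  using dot_matrix[of v A w] assms by (simp add: dot_commute)

lemma dot_cong: "vcong c v v' \<Longrightarrow> vcong c w w' \<Longrightarrow> [dot v w = dot v' w'] (mod c)"
  unfolding dot_def vcong_def by (intro cong_sum cong_mult) auto

lemma vcong_matrix: "vcong c v w \<Longrightarrow> vcong c (A *v v) (A *v w)"
  unfolding vcong_def matrix_vector_mult_def by (auto intro!: cong_sum cong_mult)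

lemma transpose_eqD:
  assumes "transpose A = A" shows "A $ i $ j = A $ j $ i"
  using arg_cong[OF assms, of "\<lambda>M. M $ j $ i"] by (simp add: transpose_def)

definition even_sym :: "int ^ 'n ^ 'n \<Rightarrow> bool" where
  "even_sym A \<longleftrightarrow> transpose A = A \<and> (\<forall>i. even (A $ i $ i))"

text \<open>Off-diagonal terms occur in equal pairs, so only the even diagonal remains modulo
  2.\<close>

lemma even_sum_symmetric:
  fixes f :: "'a \<Rightarrow> 'a \<Rightarrow> int"
  assumes "finite S" "\<And>x y. f x y = f y x" "\<And>x. even (f x x)"
  shows "even (\<Sum>x\<in>S. \<Sum>y\<in>S. f x y)"
  using assms(1)
proof (induction S)
  case (insert a S)
  have "(\<Sum>x\<in>S. f x a) = (\<Sum>y\<in>S. f a y)" using assms(2) by (intro sum.cong) auto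
  then show ?case
    using insert assms(3) by (simp add: sum.distrib)
qed simp

lemma even_dot_even_sym:
  assumes "even_sym A" shows "even (dot v (A *v v))"
proof -
  have *: "dot v (A *v v) = (\<Sum>i\<in>UNIV. \<Sum>j\<in>UNIV. v $ i * v $ j * A $ i $ j)"
    by (simp add: dot_def matrix_vector_mult_def sum_distrib_left mult_ac)
  have "A $ i $ j = A $ j $ i" for i j
    using assms transpose_eqD unfolding even_sym_def by blast
  then show ?thesis
    unfolding * using assms by (intro even_sum_symmetric) (auto simp: even_sym_def mult_ac)
qed

text \<open>The division is exact when \<open>even_sym A\<close> holds; identities for
  \<open>quad\<close> are proved by doubling both sides, which keeps \<open>div\<close> out of the
  calculations.\<close>

definition quad :: "int ^ 'n ^ 'n \<Rightarrow> int ^ 'n \<Rightarrow> int" where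
  "quad A v = dot v (A *v v) div 2"

lemma two_quad: "even_sym A \<Longrightarrow> 2 * quad A v = dot v (A *v v)"
  unfolding quad_def by (rule dvd_mult_div_cancel) (rule even_dot_even_sym)

lemma quad_add:
  assumes "even_sym A"
  shows "quad A (v + w) = quad A v + quad A w + dot v (A *v w)"
proof -
  have "dot w (A *v v) = dot v (A *v w)"
    using assms dot_symmetric_matrix by (auto simp: even_sym_def)
  then have "2 * quad A (v + w) = 2 * (quad A v + quad A w + dot v (A *v w))"
    using assms by (simp add: two_quad ring_distribs dot_add_left dot_add_right matrix_vector_right_distrib)
  then show ?thesis by simp
qed

lemma quad_scale:
  assumes "even_sym A" shows "quad A (k *s v) = k\<^sup>2 * quad A v"
proof -
  have "A *v (k *s v) = k *s (A *v v)"
    by (simp add: vec_eq_iff matrix_vector_mult_def sum_distrib_left mult_ac)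
  then have "2 * quad A (k *s v) = 2 * (k\<^sup>2 * quad A v)"
    using assms two_quad[OF assms, of v]
    by (simp add: two_quad dot_scale_left dot_scale_right power2_eq_square algebra_simps)
  then show ?thesis by simp
qed

lemma matrix_vector_scale: "(A :: int ^ 'n ^ 'm) *v (k *s v) = k *s (A *v v)"
  by (simp add: vec_eq_iff matrix_vector_mult_def sum_distrib_left mult_ac)

lemma vcongE:
  assumes "vcong c v w" obtains z where "v = w + c *s z"
proof -
  have "\<exists>k. v $ i = w $ i + c * k" for i
    using assms int_congE unfolding vcong_def by metis
  then obtain z where "v $ i = w $ i + c * z i" for i by metis
  then have "v = w + c *s (\<chi> i. z i)" by (simp add: vec_eq_iff)
  then show thesis using that by blast
qed

text \<open>Halving costs nothing even when \<open>c\<close> is even: polarisation gives the cross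
  term c w^T A z without a factor 1/2.\<close>

lemma quad_cong:
  assumes "even_sym A" "vcong c v w" shows "[quad A v = quad A w] (mod c)"
proof -
  obtain z where z: "v = w + c *s z" using vcongE assms(2) .
  have "quad A v = quad A w + c * (c * quad A z + dot w (A *v z))"
    unfolding z quad_add[OF assms(1)] quad_scale[OF assms(1)] matrix_vector_scale dot_scale_right
    by (simp add: power2_eq_square algebra_simps)
  then show ?thesis by (simp add: cong_def)
qed

text \<open>If \<open>c\<close> does not divide \<open>t $ i\<close>, translation along axis
  \<open>i\<close> multiplies the sum by a number different from 1, so the sum is 0.\<close>

lemma sum_ec_dot:
  fixes t :: "int ^ 'n"
  assumes "c > 0"
  shows "(\<Sum>y\<in>rbox c. ec c (dot t y)) = (if \<forall>i. c dvd t $ i then of_int c ^ CARD('n) else 0)"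
proof (cases "\<forall>i. c dvd t $ i")
  case True
  have "c dvd dot t y" for y
    unfolding dot_def using True by (intro dvd_sum) auto
  then have "ec c (dot t y) = 1" for y
    using assms by (simp add: ec_eq_1_iff)
  then show ?thesis using True assms by (simp add: card_rbox)
next
  case False
  then obtain i where i: "\<not> c dvd t $ i" by auto
  have "(\<Sum>y\<in>rbox c. ec c (dot t (y + axis i 1))) = (\<Sum>y\<in>rbox c. ec c (dot t y))"
  proof (rule sum_rbox_reindex[OF assms])
    show "periodic c (\<lambda>v. ec c (dot t v))"
      by (auto simp: periodic_def intro!: ec_cong dot_cong) (simp add: vcong_def)
  qed (auto simp: vcong_def cong_add_rcancel)
  then have "(\<Sum>y\<in>rbox c. ec c (dot t y)) * ec c (t $ i) = (\<Sum>y\<in>rbox c. ec c (dot t y))"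
    by (simp add: dot_add_right ec_add sum_distrib_right dot_commute[of t "axis i 1"])
  moreover have "ec c (t $ i) \<noteq> 1" using i assms by (simp add: ec_eq_1_iff)
  ultimately show ?thesis using False by auto
qed

text \<open>Treating a scalar sum as the case of dimension 1 lets every result on vectors
  specialise.\<close>

lemma sum_int_eq_rbox:
  "(\<Sum>x\<in>{0..<c}. f x) = (\<Sum>v\<in>rbox c. f ((v :: int ^ 1) $ 1))"
  by (rule sum.reindex_bij_witness[where i = "\<lambda>v. v $ 1" and j = "\<lambda>x. \<chi> _. x"])
    (auto simp: rbox_def vec_eq_iff)

lemma sum_ec:
  assumes "c > 0"
  shows "(\<Sum>x\<in>{0..<c}. ec c (t * x)) = (if c dvd t then of_int c else 0)"
proof -
  have "(\<Sum>x\<in>{0..<c}. ec c (t * x)) = (\<Sum>v\<in>rbox c. ec c (dot (\<chi> _ :: 1. t) v))"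
    by (simp add: sum_int_eq_rbox dot_def)
  then show ?thesis using assms by (simp add: sum_ec_dot)
qed

lemma sum_int_reindex:
  fixes f :: "int \<Rightarrow> complex" and T :: "int \<Rightarrow> int"
  assumes "c > 0" "\<And>x y. [x = y] (mod c) \<Longrightarrow> f x = f y"
    and inj: "\<And>x y. [T x = T y] (mod c) \<Longrightarrow> [x = y] (mod c)"
  shows "(\<Sum>x\<in>{0..<c}. f (T x)) = (\<Sum>x\<in>{0..<c}. f x)"
proof -
  have "(\<Sum>v\<in>rbox c. f ((\<chi> i :: 1. T (v $ i)) $ 1)) = (\<Sum>v\<in>rbox c. f ((v :: int ^ 1) $ 1))"
    by (rule sum_rbox_reindex[where f = "\<lambda>v. f (v $ 1)" and T = "\<lambda>v. \<chi> i. T (v $ i)"])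
      (use assms in \<open>auto simp: periodic_def vcong_def\<close>)
  then show ?thesis by (simp add: sum_int_eq_rbox)
qed

section \<open>Integer matrices, adjugates and injectivity modulo \<open>c\<close>\<close>

definition rmat :: "int ^ 'n ^ 'm \<Rightarrow> real ^ 'n ^ 'm" where
  "rmat A = (\<chi> i j. real_of_int (A $ i $ j))"

lemma det_rmat: "det (rmat A) = real_of_int (det A)"
  by (simp add: det_def rmat_def)

lemma rmat_mult: "rmat (A ** B) = rmat A ** rmat B"
  by (simp add: rmat_def matrix_matrix_mult_def vec_eq_iff)

lemma rmat_vec: "rmat A *v real_vec v = real_vec (A *v v)"
  by (simp add: rmat_def real_vec_def matrix_vector_mult_def vec_eq_iff)

lemma rmat_eq_iff: "rmat A = rmat B \<longleftrightarrow> A = B"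
  by (simp add: rmat_def vec_eq_iff)

lemma
  assumes "invertible A"
  shows matrix_inv_right: "A ** matrix_inv A = mat 1" and matrix_inv_left: "matrix_inv A ** A = mat 1"
  using someI_ex[OF assms[unfolded invertible_def]] by (auto simp: matrix_inv_def)

text \<open>By Cramer's rule each entry is the determinant of an integer matrix.\<close>

lemma det_times_inverse_integral:
  fixes A :: "int ^ 'n ^ 'n"
  assumes "det A \<noteq> 0"
  obtains B where "rmat B = real_of_int (det A) *\<^sub>R matrix_inv (rmat A)"
proof -
  define M where "M = matrix_inv (rmat A)"
  have nz: "det (rmat A) \<noteq> 0" using assms by (simp add: det_rmat)
  then have inv: "rmat A ** M = mat 1"
    unfolding M_def using invertible_det_nz matrix_inv_right by blast
  have ent: "\<exists>z. real_of_int (det A) * M $ k $ j = real_of_int z" for k j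
  proof -
    define x where "x = (\<chi> k. M $ k $ j)"
    have "rmat A *v x = (\<chi> i. if i = j then 1 else 0)"
      using inv by (simp add: x_def vec_eq_iff matrix_vector_mult_def matrix_matrix_mult_def mat_def)
    then have "x = (\<chi> k. det (\<chi> i l. if l = k then (\<chi> i. if i = j then 1 else 0) $ i
        else rmat A $ i $ l) / det (rmat A))"
      using cramer[OF nz] by blast
    then have "x $ k * det (rmat A) = det (\<chi> i l. if l = k then (\<chi> i. if i = j then 1 else 0) $ i
        else rmat A $ i $ l)"
      using nz by (simp add: vec_eq_iff)
    also have "(\<chi> i l. if l = k then (\<chi> i. if i = j then 1 else 0) $ i else rmat A $ i $ l)
        = rmat (\<chi> i l. if l = k then (if i = j then 1 else 0) else A $ i $ l)"
      by (simp add: rmat_def vec_eq_iff)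
    finally show ?thesis
      by (auto simp: det_rmat x_def mult.commute)
  qed
  then obtain z where "real_of_int (det A) * M $ k $ j = real_of_int (z k j)" for k j by metis
  then have "rmat (\<chi> k j. z k j) = real_of_int (det A) *\<^sub>R M"
    by (simp add: rmat_def vec_eq_iff)
  then show thesis using that M_def by blast
qed

lemma int_adjugate:
  fixes A :: "int ^ 'n ^ 'n"
  assumes "det A \<noteq> 0"
  obtains B where "B ** A = mat (det A)"
proof -
  obtain B where B: "rmat B = real_of_int (det A) *\<^sub>R matrix_inv (rmat A)"
    using det_times_inverse_integral assms .
  have "invertible (rmat A)" using assms by (simp add: invertible_det_nz det_rmat)
  then have "rmat (B ** A) = rmat (mat (det A))"
    by (simp add: rmat_mult B matrix_inv_left scalar_matrix_assoc[symmetric])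
      (simp add: rmat_def mat_def vec_eq_iff)
  then show thesis using that rmat_eq_iff by blast
qed

lemma mat_vector: "(mat k :: int ^ 'n ^ 'n) *v v = k *s v"
  by (simp add: mat_def matrix_vector_mult_def vec_eq_iff if_distrib [of "\<lambda>x. x * _"] cong: if_cong)

text \<open>The adjugate turns \<open>A *v v\<close> into \<open>det A\<close> times
  \<open>v\<close>, and \<open>det A\<close> is a unit modulo \<open>c\<close>.\<close>

lemma matrix_injective_mod:
  fixes A :: "int ^ 'n ^ 'n"
  assumes "coprime c (det A)" "det A \<noteq> 0" "vcong c (A *v v) (A *v w)"
  shows "vcong c v w"
proof -
  obtain B where "B ** A = mat (det A)" using int_adjugate assms(2) .
  then have "B *v (A *v x) = det A *s x" for x
    by (simp add: matrix_vector_mul_assoc mat_vector)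
  then have "vcong c (det A *s v) (det A *s w)"
    using vcong_matrix[OF assms(3), of B] by simp
  then show ?thesis
    using assms(1) by (simp add: vcong_def cong_mult_lcancel coprime_commute)
qed

section \<open>Complete Gauss sums of an even form and their two reductions\<close>

definition gsum :: "int ^ 'n ^ 'n \<Rightarrow> int \<Rightarrow> int \<Rightarrow> complex" where
  "gsum A a c = (\<Sum>v\<in>rbox c. ec c (a * quad A v))"

lemma periodic_quad:
  "even_sym A \<Longrightarrow> periodic c (\<lambda>v. ec c (a * quad A v))"
  by (auto simp: periodic_def intro!: ec_cong cong_mult quad_cong)

lemma gsum_1 [simp]: "gsum (A :: int ^ 'n ^ 'n) a 1 = 1"
proof -
  have "rbox 1 = {0 :: int ^ 'n}" by (force simp: rbox_def vec_eq_iff intro: antisym)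
  then show ?thesis by (simp add: gsum_def quad_def dot_def)
qed

text \<open>For v = c2 x + c1 y the cross term is a multiple of the modulus c1 c2. The other two
  terms carry c2^2 and c1^2, of which one factor cancels against the modulus and one stays with
  \<open>a\<close>.\<close>

lemma gsum_coprime:
  fixes A :: "int ^ 'n ^ 'n"
  assumes A: "even_sym A" and pos: "c1 > 0" "c2 > 0" and "coprime c1 c2"
  shows "gsum A a (c1 * c2) = gsum A (a * c2) c1 * gsum A (a * c1) c2"
proof -
  define f where "f v = ec (c1 * c2) (a * quad A v)" for v :: "int ^ 'n"
  define F where "F x = (\<Sum>y\<in>rbox c2. f (x + c1 *s y))" for x :: "int ^ 'n"
  have perf: "periodic (c1 * c2) f"
    unfolding f_def by (rule periodic_quad[OF A])
  \<comment> \<open>Shifting \<open>x\<close> by c1 z amounts to shifting \<open>y\<close> by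
    \<open>z\<close>, which the complete sum over \<open>y\<close> absorbs.\<close>
  have perF: "periodic c1 F"
    unfolding periodic_def
  proof (intro allI impI)
    fix x x' :: "int ^ 'n" assume "vcong c1 x x'"
    then obtain z where z: "x = x' + c1 *s z" by (rule vcongE)
    have "F x = (\<Sum>y\<in>rbox c2. f (x' + c1 *s (y + z)))"
      by (simp add: F_def z vector_add_ldistrib add_ac)
    also have "\<dots> = (\<Sum>y\<in>rbox c2. f (x' + c1 *s y))"
    proof (rule sum_rbox_reindex[OF pos(2)])
      show "periodic c2 (\<lambda>y. f (x' + c1 *s y))"
        unfolding periodic_def
      proof (intro allI impI)
        fix y y' :: "int ^ 'n" assume "vcong c2 y y'"
        then have "vcong (c1 * c2) (x' + c1 *s y) (x' + c1 *s y')"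
          by (auto simp: vcong_def cong_iff_dvd_diff right_diff_distrib[symmetric])
        then show "f (x' + c1 *s y) = f (x' + c1 *s y')"
          using perf by (simp add: periodic_def)
      qed
    qed (simp add: vcong_def cong_add_rcancel)
    finally show "F x = F x'" by (simp add: F_def)
  qed
  have "gsum A a (c1 * c2) = (\<Sum>x\<in>rbox c1. F x)"
    unfolding gsum_def F_def f_def by (rule sum_rbox_mult[OF pos])
  \<comment> \<open>\<open>c2\<close> is a unit modulo \<open>c1\<close>, so \<open>x\<close> may be
    replaced by c2 x; this creates the factor that makes the cross term disappear.\<close>
  also have "\<dots> = (\<Sum>x\<in>rbox c1. F (c2 *s x))"
    using assms(4) by (intro sum_rbox_reindex[symmetric] pos(1) perF)
      (simp add: vcong_def cong_mult_lcancel coprime_commute)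
  also have "\<dots> = (\<Sum>x\<in>rbox c1. \<Sum>y\<in>rbox c2. ec c1 (a * c2 * quad A x) * ec c2 (a * c1 * quad A y))"
    unfolding F_def f_def
  proof (intro sum.cong refl)
    fix x y :: "int ^ 'n"
    have "a * quad A (c2 *s x + c1 *s y) =
        c2 * (a * c2 * quad A x) + c1 * (a * c1 * quad A y) + c1 * c2 * (a * dot x (A *v y))"
      unfolding quad_add[OF A] quad_scale[OF A] matrix_vector_scale dot_scale_left dot_scale_right
      by (simp add: power2_eq_square algebra_simps)
    then have "ec (c1 * c2) (a * quad A (c2 *s x + c1 *s y)) =
        ec (c2 * c1) (c2 * (a * c2 * quad A x)) * ec (c1 * c2) (c1 * (a * c1 * quad A y))"
      by (simp only: ec_add ec_multiple mult.commute[of c2 c1]) simp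
    then show "ec (c1 * c2) (a * quad A (c2 *s x + c1 *s y)) =
        ec c1 (a * c2 * quad A x) * ec c2 (a * c1 * quad A y)"
      using pos by (simp add: ec_cancel)
  qed
  finally show ?thesis by (simp add: gsum_def sum_product)
qed

text \<open>Split v = x + p c y. The sum over \<open>y\<close> is a character sum that vanishes
  unless \<open>p\<close> divides A x, that is, unless \<open>p\<close> divides \<open>x\<close>; on
  x = p z the factor p^2 cancels against the modulus. The prime 2 is included.\<close>

lemma gsum_square:
  fixes A :: "int ^ 'n ^ 'n"
  assumes A: "even_sym A" and p: "prime p" and "c > 0" and "\<not> p dvd a" "\<not> p dvd det A"
  shows "gsum A a (p\<^sup>2 * c) = of_int p ^ CARD('n) * gsum A a c"
proof -
  have p0: "p > 0" using p by (simp add: prime_gt_0_int)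
  \<comment> \<open>With this step size the term in \<open>quad A y\<close> carries m^2 = m p c, a
    multiple of the modulus m p.\<close>
  define m where "m = p * c"
  have m: "p\<^sup>2 * c = m * p" "m > 0" using p0 assms(3) by (auto simp: m_def power2_eq_square mult_ac)
  have nz: "det A \<noteq> 0" using assms(5) by auto
  have cop: "coprime p (det A)" using p assms(5) by (simp add: prime_imp_coprime)
  have "gsum A a (p\<^sup>2 * c) = (\<Sum>x\<in>rbox m. \<Sum>y\<in>rbox p. ec (m * p) (a * quad A (x + m *s y)))"
    unfolding gsum_def m(1) by (rule sum_rbox_mult[OF m(2) p0])
  also have "\<dots> = (\<Sum>x\<in>rbox m. \<Sum>y\<in>rbox p. ec (m * p) (a * quad A x) * ec p (dot (a *s (A *v x)) y))"
  proof (intro sum.cong refl)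
    fix x y :: "int ^ 'n"
    have "a * quad A (x + m *s y) = a * quad A x + m * dot (a *s (A *v x)) y + m * p * (a * c * quad A y)"
      unfolding quad_add[OF A] quad_scale[OF A] matrix_vector_scale dot_scale_left dot_scale_right
        dot_symmetric_matrix[OF conjunct1[OF A[unfolded even_sym_def]], of x y] dot_commute[of _ y]
      by (simp add: power2_eq_square m_def algebra_simps)
    then show "ec (m * p) (a * quad A (x + m *s y)) = ec (m * p) (a * quad A x) * ec p (dot (a *s (A *v x)) y)"
      using m(2) by (simp only: ec_add ec_multiple) (simp add: ec_cancel)
  qed
  also have "\<dots> = (\<Sum>x\<in>rbox m. ec (m * p) (a * quad A x) *
      (if \<forall>i. p dvd (a *s (A *v x)) $ i then of_int p ^ CARD('n) else 0))"
    by (simp only: sum_distrib_left[symmetric] sum_ec_dot[OF p0])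
  also have "\<dots> = (\<Sum>x\<in>rbox (p * c). if \<forall>i. p dvd x $ i
      then of_int p ^ CARD('n) * ec (m * p) (a * quad A x) else 0)"
  proof -
    have "(\<forall>i. p dvd (a *s (A *v x)) $ i) \<longleftrightarrow> (\<forall>i. p dvd x $ i)" for x :: "int ^ 'n"
    proof
      assume "\<forall>i. p dvd (a *s (A *v x)) $ i"
      then have "vcong p (A *v x) (A *v 0)"
        using p assms(4) by (auto simp: vcong_def cong_0_iff prime_dvd_mult_iff)
      then have "vcong p x 0" using matrix_injective_mod[OF cop nz] by blast
      then show "\<forall>i. p dvd x $ i" by (simp add: vcong_def cong_0_iff)
    qed (auto simp: matrix_vector_mult_def intro!: dvd_mult dvd_sum)
    then show ?thesis by (auto simp: m_def intro!: sum.cong)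
  qed
  also have "\<dots> = (\<Sum>x\<in>rbox p. \<Sum>z\<in>rbox c. if \<forall>i. p dvd (x + p *s z) $ i
      then of_int p ^ CARD('n) * ec (m * p) (a * quad A (x + p *s z)) else 0)"
    by (rule sum_rbox_mult[OF p0 assms(3)])
  also have "\<dots> = (\<Sum>x :: int ^ 'n\<in>rbox p. if x = 0 then
      (\<Sum>z\<in>rbox c. of_int p ^ CARD('n) * ec (m * p) (a * quad A (p *s z))) else 0)"
  proof (intro sum.cong refl)
    fix x :: "int ^ 'n" assume x: "x \<in> rbox p"
    \<comment> \<open>A digit in base \<open>p\<close> that is divisible by \<open>p\<close> is 0,
      so a single \<open>x\<close> survives.\<close>
    have "p dvd x $ i \<longleftrightarrow> x $ i = 0" for i
      using x zdvd_not_zless[of "x $ i" p] by (force simp: rbox_def order_le_less)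
    then have "(\<forall>i. p dvd (x + p *s z) $ i) \<longleftrightarrow> x = 0" for z
      by (simp add: vec_eq_iff dvd_add_left_iff)
    then show "(\<Sum>z\<in>rbox c. if \<forall>i. p dvd (x + p *s z) $ i
      then of_int p ^ CARD('n) * ec (m * p) (a * quad A (x + p *s z)) else 0) =
      (if x = 0 then (\<Sum>z\<in>rbox c. of_int p ^ CARD('n) * ec (m * p) (a * quad A (p *s z))) else 0)"
      by (simp only: if_distrib[of "\<lambda>b. sum _ _"]) auto
  qed
  also have "\<dots> = (\<Sum>z\<in>rbox c. of_int p ^ CARD('n) * ec (m * p) (a * quad A (p *s z)))"
  proof -
    have "(0 :: int ^ 'n) \<in> rbox p" using p0 by (simp add: rbox_def)
    then show ?thesis by simp
  qed
  also have "\<dots> = (\<Sum>z\<in>rbox c. of_int p ^ CARD('n) * ec c (a * quad A z))"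
  proof (intro sum.cong refl arg_cong2[where f = "(*)"])
    fix z :: "int ^ 'n"
    have mp: "m * p = p\<^sup>2 * c" and q: "a * quad A (p *s z) = p\<^sup>2 * (a * quad A z)"
      by (simp_all add: m_def quad_scale[OF A] power2_eq_square)
    show "ec (m * p) (a * quad A (p *s z)) = ec c (a * quad A z)"
      unfolding mp q using p0 by (simp add: ec_cancel)
  qed
  finally show ?thesis by (simp add: gsum_def sum_distrib_left)
qed

section \<open>The quadratic Gauss sum\<close>

text \<open>Gaussian binomial coefficients. Defining them by the q-Pascal rule instead of as
  quotients gives identities without nonvanishing denominators.\<close>

fun gbin :: "complex \<Rightarrow> nat \<Rightarrow> nat \<Rightarrow> complex" where
  "gbin q n 0 = 1"
| "gbin q 0 (Suc k) = 0"
| "gbin q (Suc n) (Suc k) = gbin q n k + q ^ Suc k * gbin q n (Suc k)"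

lemma gbin_eq_0: "n < k \<Longrightarrow> gbin q n k = 0"
  by (induction q n k rule: gbin.induct) auto

text \<open>The q-analogue of (k + 1) binom(n + 1, k + 1) = (n + 1) binom(n, k).\<close>

lemma gbin_absorb: "(1 - q ^ Suc k) * gbin q (Suc n) (Suc k) = (1 - q ^ Suc n) * gbin q n k"
proof (induction n arbitrary: k)
  case 0
  then show ?case by (cases k) auto
next
  case (Suc n)
  define X where "X = gbin q (Suc n) k"
  have rec: "gbin q (Suc (Suc n)) (Suc k) = X + q ^ Suc k * gbin q (Suc n) (Suc k)"
    by (simp add: X_def)
  have 1: "(1 - q ^ Suc k) * gbin q (Suc (Suc n)) (Suc k) =
      (1 - q ^ Suc k) * X + q ^ Suc k * ((1 - q ^ Suc n) * gbin q n k)"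
    unfolding rec Suc[of k, symmetric] by (simp add: algebra_simps del: gbin.simps)
  have 2: "q ^ k * ((1 - q ^ Suc n) * gbin q n k) = (q ^ k - q ^ Suc n) * X"
  proof (cases k)
    case 0
    then show ?thesis by (simp add: X_def)
  next
    case (Suc l)
    have "(1 - q ^ Suc l) * X = (1 - q ^ Suc n) * gbin q n l"
      using Suc.IH[of l] Suc by (simp add: X_def)
    moreover have "gbin q n l = X - q ^ k * gbin q n k"
      by (simp add: X_def Suc)
    ultimately show ?thesis
      using Suc by (simp add: algebra_simps)
  qed
  have "q ^ Suc k * ((1 - q ^ Suc n) * gbin q n k) = q * ((q ^ k - q ^ Suc n) * X)"
    unfolding 2[symmetric] by simp
  then show ?case
    unfolding 1 by (simp add: X_def algebra_simps)
qed

text \<open>The q-analogue of (n + 1 - k) binom(n + 1, k) = (n + 1) binom(n, k). It follows from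
  \<open>gbin_absorb\<close> and Pascal's rule after cancelling a power of \<open>q\<close>.\<close>

lemma gbin_absorb':
  assumes "q \<noteq> 0" "k \<le> Suc n"
  shows "(1 - q ^ (Suc n - k)) * gbin q (Suc n) k = (1 - q ^ Suc n) * gbin q n k"
proof (cases k)
  case (Suc l)
  have 1: "(1 - q ^ k) * gbin q (Suc n) k = (1 - q ^ Suc n) * gbin q n l"
    using gbin_absorb[of q l n] Suc by simp
  have 2: "gbin q n l = gbin q (Suc n) k - q ^ k * gbin q n k"
    by (simp add: Suc)
  have 3: "q ^ Suc n = q ^ k * q ^ (Suc n - k)"
    using assms(2) by (simp flip: power_add)
  have "q ^ k * ((1 - q ^ (Suc n - k)) * gbin q (Suc n) k) = q ^ k * ((1 - q ^ Suc n) * gbin q n k)"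
    using 1 unfolding 2 3 by (simp add: algebra_simps)
  then show ?thesis using assms(1) by simp
qed simp

text \<open>Equating the two absorption rules gives the ratio of neighbouring coefficients. It
  yields the second Pascal rule and, at a root of unity, each coefficient in closed form.\<close>

lemma gbin_step:
  assumes "q \<noteq> 0" "k \<le> n"
  shows "(1 - q ^ Suc k) * gbin q n (Suc k) = (1 - q ^ (n - k)) * gbin q n k"
proof (cases n)
  case (Suc m)
  then show ?thesis
    using gbin_absorb[of q k m] gbin_absorb'[of q k m] assms by simp
qed (use assms in auto)

lemma gbin_pascal':
  assumes "q \<noteq> 0" "k \<le> n"
  shows "gbin q (Suc n) (Suc k) = q ^ (n - k) * gbin q n k + gbin q n (Suc k)"
  using gbin_step[OF assms] by (simp add: algebra_simps)

text \<open>Gauss's recursion. By the second Pascal rule the sum for n + 2 is the alternating sum of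
  (1 - q^(n + 1 - k)) times the coefficients for n + 1, and \<open>gbin_absorb'\<close> extracts the
  constant factor 1 - q^(n + 1).\<close>

lemma alternating_gbin_sum_step:
  assumes "q \<noteq> 0"
  shows "(\<Sum>k\<le>n + 2. (-1) ^ k * gbin q (n + 2) k) = (1 - q ^ Suc n) * (\<Sum>k\<le>n. (-1) ^ k * gbin q n k)"
proof -
  have A: "(\<Sum>k\<le>Suc m. (-1) ^ k * gbin q (Suc m) k) =
      1 - (\<Sum>k\<le>m. (-1) ^ k * gbin q (Suc m) (Suc k))" for m
    by (subst sum.atMost_Suc_shift) (simp add: sum_negf)
  have "(\<Sum>k\<le>Suc n. (-1) ^ k * gbin q (Suc n) (Suc k)) =
      (\<Sum>k\<le>n. (-1) ^ k * gbin q (Suc n) (Suc k))"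
    by (simp add: gbin_eq_0 del: gbin.simps)
  then have B: "(\<Sum>k\<le>Suc n. (-1) ^ k * gbin q (Suc n) k) =
      1 - (\<Sum>k\<le>Suc n. (-1) ^ k * gbin q (Suc n) (Suc k))"
    using A[of n] by (simp only:)
  have "(\<Sum>k\<le>Suc n. (-1) ^ k * gbin q (Suc (Suc n)) (Suc k)) =
      (\<Sum>k\<le>Suc n. (-1) ^ k * (q ^ (Suc n - k) * gbin q (Suc n) k) + (-1) ^ k * gbin q (Suc n) (Suc k))"
    using assms by (intro sum.cong refl) (simp add: gbin_pascal' ring_distribs del: gbin.simps)
  then have "(\<Sum>k\<le>Suc (Suc n). (-1) ^ k * gbin q (Suc (Suc n)) k) =
      (\<Sum>k\<le>Suc n. (-1) ^ k * gbin q (Suc n) k) -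
      (\<Sum>k\<le>Suc n. (-1) ^ k * (q ^ (Suc n - k) * gbin q (Suc n) k))"
    unfolding A[of "Suc n"] B by (simp only: sum.distrib) (simp add: algebra_simps del: gbin.simps)
  also have "\<dots> = (\<Sum>k\<le>Suc n. (-1) ^ k * ((1 - q ^ (Suc n - k)) * gbin q (Suc n) k))"
    by (simp only: sum_subtractf[symmetric]) (intro sum.cong refl, simp add: algebra_simps)
  also have "\<dots> = (\<Sum>k\<le>Suc n. (-1) ^ k * ((1 - q ^ Suc n) * gbin q n k))"
    using assms by (intro sum.cong refl arg_cong2[where f = "(*)"] gbin_absorb') auto
  also have "\<dots> = (\<Sum>k\<le>n. (-1) ^ k * ((1 - q ^ Suc n) * gbin q n k))"
    by (simp add: gbin_eq_0)
  finally show ?thesis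
    by (simp add: sum_distrib_left mult_ac del: gbin.simps)
qed

lemma alternating_gbin_sum:
  assumes "q \<noteq> 0"
  shows "(\<Sum>k\<le>2 * m. (-1) ^ k * gbin q (2 * m) k) = (\<Prod>j<m. 1 - q ^ (2 * j + 1))"
proof (induction m)
  case (Suc m)
  then show ?case
    using alternating_gbin_sum_step[OF assms, of "2 * m"] by (simp add: mult.commute del: gbin.simps)
qed simp

lemma triangle_Suc: "int (Suc k) * (int (Suc k) + 1) div 2 = int k * (int k + 1) div 2 + (int k + 1)"
proof -
  have "int (Suc k) * (int (Suc k) + 1) = int k * (int k + 1) + 2 * (int k + 1)"
    by (simp add: algebra_simps)
  then show ?thesis by simp
qed

lemma ec_power: "ec c x ^ n = ec c (int n * x)"
  by (induction n) (simp_all add: ec_add ring_distribs)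

text \<open>For q = e(-1 / c) the ratio in \<open>gbin_step\<close> degenerates to -e((k + 1) / c).
  Each signed coefficient is therefore e of a triangular number over \<open>c\<close>, and the
  product comes from \<open>alternating_gbin_sum\<close>.\<close>

lemma sum_ec_triangle:
  assumes c: "c = 2 * int m + 1"
  shows "(\<Sum>k\<le>2 * m. ec c (int k * (int k + 1) div 2)) = (\<Prod>j<m. 1 - ec c (- int (2 * j + 1)))"
proof -
  define q where "q = ec c (- 1)"
  have "(-1) ^ k * gbin q (2 * m) k = ec c (int k * (int k + 1) div 2)" if "k \<le> 2 * m" for k
    using that
  proof (induction k)
    case (Suc k)
    \<comment> \<open>Because q^c = 1, the power of \<open>q\<close> with exponent 2 m - k is the
      inverse of q^(k + 1).\<close>
    have k: "int (2 * m - k) = c - (int k + 1)" using Suc.prems by (simp add: c)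
    have pos: "q ^ (2 * m - k) = ec c (int k + 1)"
      unfolding q_def ec_power k by (intro ec_cong) (simp add: cong_iff_dvd_diff)
    have neg: "q ^ Suc k = ec c (- (int k + 1))"
      unfolding q_def ec_power by (simp add: algebra_simps)
    have inv: "ec c (int k + 1) * ec c (- (int k + 1)) = 1"
      by (simp flip: ec_add)
    \<comment> \<open>Here 0 < k + 1 < c, which is what permits division by 1 - q^(k + 1).\<close>
    have "\<not> c dvd int k + 1"
      using Suc.prems zdvd_not_zless[of "int k + 1" c] by (simp add: c)
    then have "ec c (- (int k + 1)) \<noteq> 1"
      by (subst ec_eq_1_iff, simp add: c) (simp only: dvd_minus_iff, simp)
    then have nz: "1 - q ^ Suc k \<noteq> 0"
      unfolding neg by simp
    have "(1 - q ^ Suc k) * gbin q (2 * m) (Suc k) = (1 - q ^ (2 * m - k)) * gbin q (2 * m) k"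
      using Suc.prems by (intro gbin_step) (auto simp: q_def)
    also have "1 - q ^ (2 * m - k) = (1 - q ^ Suc k) * (- ec c (int k + 1))"
      unfolding pos neg using inv by (simp add: algebra_simps)
    finally have "gbin q (2 * m) (Suc k) = - ec c (int k + 1) * gbin q (2 * m) k"
      using mult_left_cancel[OF nz] by (simp only: mult.assoc)
    then have "(-1) ^ Suc k * gbin q (2 * m) (Suc k) = ec c (int k + 1) * ((-1) ^ k * gbin q (2 * m) k)"
      by simp
    also have "\<dots> = ec c (int (Suc k) * (int (Suc k) + 1) div 2)"
      using Suc by (simp only: triangle_Suc ec_add) (simp add: mult.commute)
    finally show ?case .
  qed simp
  then have "(\<Sum>k\<le>2 * m. ec c (int k * (int k + 1) div 2)) = (\<Sum>k\<le>2 * m. (-1) ^ k * gbin q (2 * m) k)"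
    by simp
  also have "\<dots> = (\<Prod>j<m. 1 - q ^ (2 * j + 1))"
    by (rule alternating_gbin_sum) (simp add: q_def)
  finally show ?thesis
    unfolding q_def ec_power by simp
qed

section \<open>Gauss sums in one variable\<close>

definition gauss_sum :: "int \<Rightarrow> int \<Rightarrow> complex" where
  "gauss_sum b c = (\<Sum>x\<in>{0..<c}. ec c (b * x\<^sup>2))"

lemma gauss_sum_cong: "[a = b] (mod c) \<Longrightarrow> gauss_sum a c = gauss_sum b c"
  unfolding gauss_sum_def by (intro sum.cong refl ec_cong cong_mult) auto

lemma gauss_sum_mult_square:
  assumes "c > 0" "coprime s c" shows "gauss_sum (b * s\<^sup>2) c = gauss_sum b c"
proof -
  have "gauss_sum (b * s\<^sup>2) c = (\<Sum>x\<in>{0..<c}. ec c (b * (s * x)\<^sup>2))"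
    by (simp add: gauss_sum_def power_mult_distrib mult.assoc)
  also have "\<dots> = gauss_sum b c"
    unfolding gauss_sum_def
    by (rule sum_int_reindex[OF assms(1)])
      (use assms in \<open>auto intro!: ec_cong cong_mult cong_pow simp: cong_mult_lcancel\<close>)
  finally show ?thesis .
qed

text \<open>The 1 by 1 matrix (2) has the quadratic form x^2, so both reductions carry over; its
  determinant 2 is the reason why the square reduction is stated at odd primes.\<close>

lemma gauss_sum_eq_gsum: "gauss_sum b c = gsum (mat 2 :: int ^ 1 ^ 1) b c"
  unfolding gauss_sum_def gsum_def sum_int_eq_rbox
  by (simp add: quad_def dot_def mat_vector power2_eq_square)

lemma even_sym_mat_2: "even_sym (mat 2 :: int ^ 1 ^ 1)"
  by (simp add: even_sym_def transpose_mat) (simp add: mat_def)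

lemma gauss_sum_coprime:
  assumes "c1 > 0" "c2 > 0" "coprime c1 c2"
  shows "gauss_sum a (c1 * c2) = gauss_sum (a * c2) c1 * gauss_sum (a * c1) c2"
  using gsum_coprime[OF even_sym_mat_2 assms] by (simp add: gauss_sum_eq_gsum)

lemma not_prime_dvd_2:
  fixes p :: int
  assumes "prime p" "odd p" shows "\<not> p dvd 2"
  using assms prime_ge_2_int[OF assms(1)] zdvd_imp_le[of p 2] by fastforce

lemma gauss_sum_square:
  assumes "prime p" "odd p" "c > 0" "\<not> p dvd a"
  shows "gauss_sum a (p\<^sup>2 * c) = of_int p * gauss_sum a c"
proof -
  have "\<not> p dvd 2" using assms(1,2) by (rule not_prime_dvd_2)
  then show ?thesis
    using gsum_square[OF even_sym_mat_2 assms(1,3,4)] by (simp add: gauss_sum_eq_gsum det_1 mat_def)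
qed

lemma gauss_sum_1 [simp]: "gauss_sum a 1 = 1"
  by (simp add: gauss_sum_eq_gsum)

lemma gauss_sum_uminus: "gauss_sum (- a) c = cnj (gauss_sum a c)"
  by (simp add: gauss_sum_def ec_minus cnj_sum)

text \<open>Substituting x = d + y leaves the linear character e(4 d y / c), whose sum over
  \<open>y\<close> keeps only d = 0. This supplies the absolute value in
  \<open>gauss_sum_2\<close>.\<close>

lemma norm_gauss_sum_2:
  assumes "c > 0" "odd c" shows "gauss_sum 2 c * cnj (gauss_sum 2 c) = of_int c"
proof -
  have cop: "coprime 4 c"
    using assms(2) coprime_power_left_iff[of 2 2 c] by (simp add: coprime_left_2_iff_odd)
  have "gauss_sum 2 c * cnj (gauss_sum 2 c) = (\<Sum>y\<in>{0..<c}. \<Sum>x\<in>{0..<c}. ec c (2 * x\<^sup>2) * ec c (- (2 * y\<^sup>2)))"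
  proof -
    have "cnj (gauss_sum 2 c) = (\<Sum>y\<in>{0..<c}. ec c (- (2 * y\<^sup>2)))"
      by (simp add: gauss_sum_def cnj_sum ec_minus)
    then show ?thesis
      unfolding gauss_sum_def sum_product by (simp only: sum_product) (rule sum.swap)
  qed
  also have "\<dots> = (\<Sum>y\<in>{0..<c}. \<Sum>d\<in>{0..<c}. ec c (2 * (d + y)\<^sup>2) * ec c (- (2 * y\<^sup>2)))"
    by (intro sum.cong refl sum_int_reindex[where T = "\<lambda>d. d + _", symmetric] assms(1)
        arg_cong2[where f = "(*)"] ec_cong cong_mult cong_pow) (auto simp: cong_add_rcancel)
  also have "\<dots> = (\<Sum>y\<in>{0..<c}. \<Sum>d\<in>{0..<c}. ec c (2 * d\<^sup>2) * ec c (4 * d * y))"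
    by (simp add: power2_eq_square algebra_simps flip: ec_add)
  also have "\<dots> = (\<Sum>d\<in>{0..<c}. ec c (2 * d\<^sup>2) * (\<Sum>y\<in>{0..<c}. ec c (4 * d * y)))"
    by (subst sum.swap) (simp add: sum_distrib_left)
  also have "\<dots> = (\<Sum>d\<in>{0..<c}. if d = 0 then of_int c else 0)"
  proof (intro sum.cong refl)
    fix d assume d: "d \<in> {0..<c}"
    have "c dvd d \<longleftrightarrow> d = 0"
      using d zdvd_not_zless[of d c] by (cases "d = 0") auto
    then have "c dvd 4 * d \<longleftrightarrow> d = 0"
      using cop by (simp add: coprime_dvd_mult_right_iff coprime_commute)
    then show "ec c (2 * d\<^sup>2) * (\<Sum>y\<in>{0..<c}. ec c (4 * d * y)) = (if d = 0 then of_int c else 0)"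
      using sum_ec[OF assms(1), of "4 * d"] by simp
  qed
  finally show ?thesis using assms(1) by simp
qed

lemma eight_dvd_one_minus_square:
  fixes c :: int
  assumes "odd c" shows "8 dvd 1 - c\<^sup>2"
proof -
  obtain n where n: "c = 2 * n + 1" using assms by (elim oddE)
  obtain r where r: "n * (n + 1) = 2 * r" by (metis even_mult_iff even_plus_one_iff evenE)
  have "1 - c\<^sup>2 = - 4 * (n * (n + 1))" by (simp add: n power2_eq_square algebra_simps)
  then have "1 - c\<^sup>2 = 8 * - r" unfolding r by simp
  then show ?thesis by (rule dvdI)
qed

text \<open>Substitute \<open>x = s (2 k + 1)\<close> with \<open>4 s \<equiv> 1\<close>; \<open>(1 - c\<^sup>2) / 8\<close> is an explicit inverse of 8 modulo \<open>c\<close>.\<close>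

lemma gauss_sum_2_eq_triangle:
  assumes "c > 0" "odd c"
  shows "gauss_sum 2 c = ec c ((1 - c\<^sup>2) div 8) * (\<Sum>x\<in>{0..<c}. ec c (x * (x + 1) div 2))"
proof -
  have cop2: "coprime 2 c" using assms(2) by (simp add: coprime_left_2_iff_odd)
  then have cop4: "coprime 4 c" and cop8: "coprime 8 c"
    using coprime_power_left_iff[of 2 2 c] coprime_power_left_iff[of 2 3 c] by simp_all
  obtain s where s: "[4 * s = 1] (mod c)"
    using cong_solve_coprime_int cop4 by blast
  then have cops: "coprime s c"
    using coprime_cong_transfer_right cong_imp_coprime by (metis coprime_1_left coprime_mult_left_iff cong_sym)
  have 8: "8 * ((1 - c\<^sup>2) div 8) = 1 - c\<^sup>2"
    using eight_dvd_one_minus_square[OF assms(2)] by simp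
  have e: "[2 * s\<^sup>2 = (1 - c\<^sup>2) div 8] (mod c)"
  proof -
    have "[(4 * s)\<^sup>2 = 1\<^sup>2] (mod c)" using s by (rule cong_pow)
    moreover have "[1 - c\<^sup>2 = 1] (mod c)" by (simp add: cong_iff_dvd_diff power2_eq_square)
    ultimately have "[8 * (2 * s\<^sup>2) = 8 * ((1 - c\<^sup>2) div 8)] (mod c)"
      unfolding 8 by (simp add: power2_eq_square) (metis cong_sym cong_trans)
    then show ?thesis using cong_mult_lcancel[of 8 c] cop8 by blast
  qed
  have tri: "2 * (x * (x + 1) div 2) = x * (x + 1)" for x :: int
    by simp
  have "gauss_sum 2 c = (\<Sum>x\<in>{0..<c}. ec c (2 * (s * (2 * x + 1))\<^sup>2))"
    unfolding gauss_sum_def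
  proof (rule sum_int_reindex[symmetric, OF assms(1)])
    fix x y assume "[s * (2 * x + 1) = s * (2 * y + 1)] (mod c)"
    then show "[x = y] (mod c)"
      using cops cop2 by (simp add: cong_mult_lcancel cong_add_rcancel)
  qed (auto intro!: ec_cong cong_mult cong_pow)
  also have "\<dots> = (\<Sum>x\<in>{0..<c}. ec c ((1 - c\<^sup>2) div 8 + x * (x + 1) div 2))"
  proof (intro sum.cong refl ec_cong)
    fix x
    have "2 * (s * (2 * x + 1))\<^sup>2 = 2 * s\<^sup>2 + 8 * s\<^sup>2 * (x * (x + 1))"
      by (simp add: power2_eq_square algebra_simps)
    also have "8 * s\<^sup>2 * (x * (x + 1)) = 8 * s\<^sup>2 * (2 * (x * (x + 1) div 2))"
      by (simp only: tri)
    finally have "2 * (s * (2 * x + 1))\<^sup>2 = 2 * s\<^sup>2 + (4 * s)\<^sup>2 * (x * (x + 1) div 2)"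
      by (simp add: power_mult_distrib)
    moreover have "[2 * s\<^sup>2 + (4 * s)\<^sup>2 * (x * (x + 1) div 2) =
        (1 - c\<^sup>2) div 8 + 1\<^sup>2 * (x * (x + 1) div 2)] (mod c)"
      using e s by (intro cong_add cong_mult cong_pow) auto
    ultimately show "[2 * (s * (2 * x + 1))\<^sup>2 = (1 - c\<^sup>2) div 8 + x * (x + 1) div 2] (mod c)"
      by simp
  qed
  finally show ?thesis by (simp add: ec_add sum_distrib_left)
qed

text \<open>Separates a factor of Gauss's product into a phase and a real number that is positive
  for 0 < t < pi.\<close>

lemma one_minus_cis: "1 - cis (- (2 * t)) = cis (pi / 2 - t) * of_real (2 * sin t)"
proof -
  have "cis (pi / 2 - t) * of_real (2 * sin t) = \<i> * cis (- t) * of_real (2 * sin t)"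
    by (simp add: cis_mult[symmetric] diff_conv_add_uminus del: add_uminus_conv_diff)
  also have "\<dots> = 1 - cis (- (2 * t))"
    by (simp add: complex_eq_iff cos_double_sin sin_double power2_eq_square)
  finally show ?thesis by simp
qed

lemma sum_odd: "(\<Sum>j<m. real (2 * j + 1)) = (real m)\<^sup>2"
  by (induction m) (simp_all add: power2_eq_square algebra_simps)

lemma prod_cis: "(\<Prod>j<(m::nat). cis (f j)) = cis (\<Sum>j<m. f j)"
  by (induction m) (simp_all add: cis_mult)

text \<open>The product formula gives an explicit phase times a product \<open>P\<close> of positive
  sines. The squared modulus is already known to be \<open>c\<close>, so positivity forces P =
  sqrt(c) without evaluating the sines.\<close>

lemma gauss_sum_2:
  assumes "c > 0" "odd c"
  shows "gauss_sum 2 c = of_real (sqrt (of_int c)) * cis (2 * pi * (1 - of_int c) / 8)"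
proof -
  obtain n where n: "c = 2 * n + 1" using assms(2) by (elim oddE)
  define m where "m = nat n"
  have m: "c = 2 * int m + 1" using assms(1) by (simp add: n m_def)
  define t where "t j = pi * real (2 * j + 1) / of_int c" for j
  define P where "P = (\<Prod>j<m. 2 * sin (t j))"
  have "P > 0"
    unfolding P_def
  proof (intro prod_pos ballI)
    fix j assume "j \<in> {..<m}"
    then have "real (2 * j + 1) < of_int c" by (simp add: m)
    then have "t j < pi" by (simp add: t_def m field_simps)
    moreover have "0 < t j"
      unfolding t_def using assms(1) by (intro divide_pos_pos mult_pos_pos) auto
    ultimately show "0 < 2 * sin (t j)" by (simp add: sin_gt_zero)
  qed
  have factor: "1 - ec c (- int (2 * j + 1)) = cis (pi / 2 - t j) * of_real (2 * sin (t j))" for j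
  proof -
    have "2 * pi * of_int (- int (2 * j + 1)) / of_int c = - (2 * t j)"
      using assms(1) by (simp add: t_def field_simps)
    then show ?thesis unfolding one_minus_cis[symmetric] by (simp only: ec_def)
  qed
  have "(\<Sum>x\<in>{0..<c}. ec c (x * (x + 1) div 2)) = (\<Sum>k\<le>2 * m. ec c (int k * (int k + 1) div 2))"
    by (rule sum.reindex_bij_witness[where i = int and j = nat]) (auto simp: m)
  also have "\<dots> = (\<Prod>j<m. cis (pi / 2 - t j) * of_real (2 * sin (t j)))"
    unfolding sum_ec_triangle[OF m] factor ..
  also have "\<dots> = cis (\<Sum>j<m. pi / 2 - t j) * of_real P"
    by (simp add: prod.distrib prod_cis P_def)
  also have "(\<Sum>j<m. pi / 2 - t j) = pi * m / 2 - pi * (real m)\<^sup>2 / of_int c"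
    by (simp add: sum_subtractf t_def sum_odd[symmetric] sum_distrib_left sum_divide_distrib)
  finally have tri: "(\<Sum>x\<in>{0..<c}. ec c (x * (x + 1) div 2)) =
      cis (pi * m / 2 - pi * (real m)\<^sup>2 / of_int c) * of_real P" .
  have "8 dvd 1 - c\<^sup>2"
    using assms(2) by (rule eight_dvd_one_minus_square)
  then have int_div: "of_int ((1 - c\<^sup>2) div 8) = (1 - (of_int c)\<^sup>2) / (8 :: real)"
    by (simp add: real_of_int_div)
  have "ec c ((1 - c\<^sup>2) div 8) = cis (pi * (1 - (of_int c)\<^sup>2) / (4 * of_int c))"
    unfolding ec_def int_div using assms(1) by (intro arg_cong[of _ _ cis]) (simp add: field_simps)
  then have "gauss_sum 2 c = cis (pi * (1 - (of_int c)\<^sup>2) / (4 * of_int c) +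
      (pi * m / 2 - pi * (real m)\<^sup>2 / of_int c)) * of_real P"
    unfolding gauss_sum_2_eq_triangle[OF assms] tri by (simp add: cis_mult mult.assoc[symmetric])
  \<comment> \<open>The contributions of the inverse of 8, of the constants pi / 2 and of the angles
    \<open>t j\<close> collapse on inserting m = (c - 1) / 2.\<close>
  also have "pi * (1 - (of_int c)\<^sup>2) / (4 * of_int c) + (pi * m / 2 - pi * (real m)\<^sup>2 / of_int c)
      = 2 * pi * (1 - of_int c) / 8"
  proof -
    have rm: "real m = (of_int c - 1) / 2" by (simp add: m)
    show ?thesis unfolding rm using assms(1) by (simp add: field_simps power2_eq_square)
  qed
  finally have g: "gauss_sum 2 c = cis (2 * pi * (1 - of_int c) / 8) * of_real P" .
  have "of_int c = (of_real (P\<^sup>2) :: complex)"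
    using norm_gauss_sum_2[OF assms] unfolding g
    by (simp add: cis_cnj cis_mult power2_eq_square mult_ac mult.assoc[of "cis _", symmetric])
  then have "of_int c = P\<^sup>2"
    by (metis of_real_eq_iff of_real_of_int_eq)
  then have "P = sqrt (of_int c)"
    using \<open>P > 0\<close> by simp
  then show ?thesis unfolding g by simp
qed

section \<open>The Kronecker symbol and Gauss sums\<close>

lemma not_prime_dvd_1:
  fixes p :: int
  assumes "prime p" shows "\<not> p dvd 1"
  using prime_ge_2_int[OF assms] zdvd_imp_le[of p 1] by fastforce

lemma kronecker_prime_cases:
  assumes "prime p" "\<not> p dvd a"
  shows "kronecker_prime a p = 1 \<or> kronecker_prime a p = -1"
  using assms by (auto simp: kronecker_prime_def Legendre_def cong_0_iff)

lemma kronecker_prime_1 [simp]: "prime p \<Longrightarrow> kronecker_prime 1 p = 1"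
proof -
  assume p: "prime p"
  have "\<not> p dvd 1" using p by (rule not_prime_dvd_1)
  moreover have "QuadRes p 1" by (auto simp: QuadRes_def intro: exI[of _ 1])
  ultimately show ?thesis by (simp add: kronecker_prime_def Legendre_def cong_0_iff)
qed

text \<open>Euler's criterion gives the identity only modulo \<open>p\<close>. Both sides are 1 or
  -1, so a difference would be 2 up to sign, which an odd prime does not divide.\<close>

lemma Legendre_mult:
  fixes p :: int
  assumes p: "prime p" "odd p" and a: "\<not> p dvd a" "\<not> p dvd b"
  shows "Legendre (a * b) p = Legendre a p * Legendre b p"
proof -
  have p2: "p > 2" using p prime_ge_2_int[OF p(1)] by (cases "p = 2") auto
  obtain P where P: "p = int P" using p2 zero_le_imp_eq_int[of p] by auto
  have "prime P" "2 < P" using p p2 by (auto simp: P)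
  note E = euler_criterion[OF this, folded P]
  have "[Legendre (a * b) p = (a * b) ^ ((P - 1) div 2)] (mod p)" by (rule E)
  also have "(a * b) ^ ((P - 1) div 2) = a ^ ((P - 1) div 2) * b ^ ((P - 1) div 2)"
    by (rule power_mult_distrib)
  also have "[\<dots> = Legendre a p * Legendre b p] (mod p)"
    by (intro cong_mult cong_sym[OF E])
  finally have "p dvd Legendre (a * b) p - Legendre a p * Legendre b p"
    by (simp add: cong_iff_dvd_diff)
  moreover have "\<not> p dvd 2" using p by (rule not_prime_dvd_2)
  moreover have "\<not> p dvd a * b" using p a by (simp add: prime_dvd_mult_iff)
  ultimately show ?thesis
    using a by (auto simp: Legendre_def cong_0_iff split: if_splits)
qed

lemma kronecker_prime_mult:
  assumes p: "prime p" and a: "\<not> p dvd a" "\<not> p dvd b"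
  shows "kronecker_prime (a * b) p = kronecker_prime a p * kronecker_prime b p"
proof (cases "p = 2")
  case True
  \<comment> \<open>At 2 the symbol is read off residues modulo 8, so multiplicativity is a finite
    table over the odd residues.\<close>
  have res: "x mod 8 \<in> {1, 3, 5, 7}" if "odd x" for x :: int
  proof -
    have "x mod 8 = 1 \<or> x mod 8 = 3 \<or> x mod 8 = 5 \<or> x mod 8 = 7" using that by presburger
    then show ?thesis by simp
  qed
  have kr: "kronecker_prime x 2 = (if x mod 8 = 1 \<or> x mod 8 = 7 then 1 else -1)" if "odd x" for x
    using that by (simp add: kronecker_prime_def)
  have table: "(if (r * s) mod 8 = 1 \<or> (r * s) mod 8 = 7 then 1 else -1) =
      (if r = 1 \<or> r = 7 then 1 else -1) * (if s = 1 \<or> s = 7 then 1 else - 1 :: int)"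
    if "r \<in> {1, 3, 5, 7}" "s \<in> {1, 3, 5, 7}" for r s :: int
    using that by auto
  have odd: "odd a" "odd b" "odd (a * b)" using a True by simp_all
  have m: "(a * b) mod 8 = ((a mod 8) * (b mod 8)) mod 8" by (simp only: mod_mult_eq)
  show ?thesis
    unfolding True kr[OF odd(1)] kr[OF odd(2)] kr[OF odd(3)] m
    by (rule table[OF res[OF odd(1)] res[OF odd(2)]])
next
  case False
  have "odd p" using prime_ge_2_int[OF p] prime_odd_int[OF p] False by linarith
  then show ?thesis using Legendre_mult[OF p _ a] False by (simp add: kronecker_prime_def)
qed

text \<open>Makes the symbol of a determinant invariant under base changes whose determinant is
  prime to \<open>p\<close>.\<close>

lemma kronecker_prime_mult_square:
  assumes "prime p" "\<not> p dvd a" "\<not> p dvd t"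
  shows "kronecker_prime (t\<^sup>2 * a) p = kronecker_prime a p"
proof -
  have "\<not> p dvd t * a" using assms by (simp add: prime_dvd_mult_iff)
  then have "kronecker_prime (t * (t * a)) p = kronecker_prime t p * (kronecker_prime t p * kronecker_prime a p)"
    using assms by (simp add: kronecker_prime_mult)
  then show ?thesis
    using kronecker_prime_cases[OF assms(1,3)] by (auto simp: power2_eq_square mult.assoc)
qed

lemma kronecker_1 [simp]: "kronecker a 1 = 1"
  by (simp add: kronecker_def)

lemma kronecker_prime_times:
  assumes "prime p" "c > 0"
  shows "kronecker a (p * c) = kronecker_prime a p * kronecker a c"
proof -
  have "p > 0" using assms(1) by (rule prime_gt_0_int)
  moreover have "prime_factorization (p * c) = {#p#} + prime_factorization c"
    using assms by (simp add: prime_factorization_mult prime_factorization_prime)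
  ultimately show ?thesis
    using assms by (simp add: kronecker_def abs_mult mult_less_0_iff)
qed

lemma kronecker_square_times:
  assumes "prime p" "c > 0" "\<not> p dvd a"
  shows "kronecker a (p\<^sup>2 * c) = kronecker a c"
proof -
  have "p * c > 0" using assms prime_gt_0_int[OF assms(1)] by simp
  then have "kronecker a (p * (p * c)) = kronecker_prime a p * (kronecker_prime a p * kronecker a c)"
    using assms by (simp add: kronecker_prime_times)
  then show ?thesis
    using kronecker_prime_cases[OF assms(1,3)] by (auto simp: power2_eq_square mult.assoc)
qed

text \<open>An induction fitted to the two reductions: a prime factor of \<open>c\<close> either
  divides the cofactor too, and then its square is removed whatever remains, or it is coprime to the
  cofactor.\<close>

lemma square_prime_induct [consumes 1, case_names one square prime]:
  fixes c :: int
  assumes "c > 0" and "P 1"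
    and "\<And>p c. prime p \<Longrightarrow> c > 0 \<Longrightarrow> P c \<Longrightarrow> P (p\<^sup>2 * c)"
    and "\<And>p c. prime p \<Longrightarrow> c > 0 \<Longrightarrow> coprime p c \<Longrightarrow> P c \<Longrightarrow> P (p * c)"
  shows "P c"
  using assms(1)
proof (induction "nat c" arbitrary: c rule: less_induct)
  case less
  show ?case
  proof (cases "c = 1")
    case False
    then obtain p where p: "prime p" "p dvd c"
      using less.prems prime_divisorE[of c] by auto
    note p2 = prime_ge_2_int[OF p(1)]
    obtain d where d: "c = p * d" using p(2) by (elim dvdE)
    have d0: "d > 0" using less.prems p2 unfolding d by (simp add: zero_less_mult_iff)
    have dc: "d < c" using p2 d0 unfolding d by simp
    show ?thesis
    proof (cases "p dvd d")
      case True
      then obtain e where e: "d = p * e" by (elim dvdE)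
      have e0: "e > 0" using d0 p2 unfolding e by (simp add: zero_less_mult_iff)
      have "e \<le> d" using p2 e0 unfolding e by simp
      then have "P e" using dc d0 e0 by (intro less.hyps) auto
      then show ?thesis
        using assms(3)[OF p(1) e0] by (simp add: d e power2_eq_square mult.assoc)
    next
      case False
      then have "coprime p d" using p(1) by (simp add: prime_imp_coprime)
      moreover have "P d" using dc d0 by (intro less.hyps) auto
      ultimately show ?thesis using assms(4)[OF p(1) d0] d by simp
    qed
  qed (use assms(2) in simp)
qed

section \<open>Representation numbers of a x^2 modulo a prime, and the dependence of Gauss sums on
  the multiplier\<close>

lemma roots_mod_prime:
  fixes p :: int
  assumes p: "prime p" and "\<not> p dvd a" "\<not> p dvd z"
  shows "card {x \<in> {0..<p}. a * x\<^sup>2 mod p = z mod p} \<le> 2"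
proof (cases "{x \<in> {0..<p}. a * x\<^sup>2 mod p = z mod p} = {}")
  case False
  then obtain y where y: "0 \<le> y" "y < p" "a * y\<^sup>2 mod p = z mod p" by auto
  have "{x \<in> {0..<p}. a * x\<^sup>2 mod p = z mod p} \<subseteq> {y, (- y) mod p}"
  proof
    fix x assume x: "x \<in> {x \<in> {0..<p}. a * x\<^sup>2 mod p = z mod p}"
    then have "[a * x\<^sup>2 = a * y\<^sup>2] (mod p)" using y by (simp add: cong_def)
    then have "p dvd a * ((x - y) * (x + y))"
      by (simp add: cong_iff_dvd_diff power2_eq_square algebra_simps)
    then have "p dvd x - y \<or> p dvd x - (- y)" using p assms(2) by (simp add: prime_dvd_mult_iff)
    then have "x mod p = y mod p \<or> x mod p = (- y) mod p" by (simp only: mod_eq_dvd_iff)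
    then show "x \<in> {y, (- y) mod p}" using x y by auto
  qed
  then have "card {x \<in> {0..<p}. a * x\<^sup>2 mod p = z mod p} \<le> card {y, (- y) mod p}"
    by (intro card_mono) auto
  also have "\<dots> \<le> 2" by (simp add: card_insert_if)
  finally show ?thesis .
qed (simp only: card.empty le0)

text \<open>Grouping \<open>x\<close> by the value of a x^2 reduces a comparison of two Gauss sums
  to a comparison of representation numbers.\<close>

lemma gauss_sum_fibres:
  assumes "p > 0"
  shows "gauss_sum (b * a) p = (\<Sum>z\<in>{0..<p}. of_nat (card {x \<in> {0..<p}. a * x\<^sup>2 mod p = z}) * ec p (b * z))"
proof -
  have "gauss_sum (b * a) p = (\<Sum>x\<in>{0..<p}. ec p (b * (a * x\<^sup>2 mod p)))"
    unfolding gauss_sum_def by (intro sum.cong refl ec_cong) (simp add: cong_def mod_mult_right_eq mult.assoc)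
  also have "\<dots> = (\<Sum>z\<in>{0..<p}. \<Sum>x | x \<in> {0..<p} \<and> a * x\<^sup>2 mod p = z. ec p (b * (a * x\<^sup>2 mod p)))"
    using assms by (intro sum.group[symmetric]) auto
  also have "\<dots> = (\<Sum>z\<in>{0..<p}. of_nat (card {x \<in> {0..<p}. a * x\<^sup>2 mod p = z}) * ec p (b * z))"
    by (intro sum.cong refl) simp
  finally show ?thesis .
qed

text \<open>Every class has at most two representations as \<open>x\<^sup>2\<close> or \<open>a x\<^sup>2\<close> altogether, and the total
  number of representations is \<open>2 p\<close>, so every class has exactly two.\<close>

lemma gauss_sum_nonresidue:
  assumes p: "prime p" and a: "\<not> p dvd a" "\<not> QuadRes p a" and b: "\<not> p dvd b"
  shows "gauss_sum (b * a) p = - gauss_sum b p"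
proof -
  define N where "N a z = card {x \<in> {0..<p}. a * x\<^sup>2 mod p = z}" for a z
  have p0: "p > 0" using p by (rule prime_gt_0_int)
  have zero: "N a 0 = 1" if "\<not> p dvd a" for a
  proof -
    have z: "a * x\<^sup>2 mod p = 0 \<longleftrightarrow> x = 0" if "x \<in> {0..<p}" for x
      using that \<open>\<not> p dvd a\<close> p zdvd_not_zless[of x p]
      by (cases "x = 0") (auto simp: mod_eq_0_iff_dvd prime_dvd_mult_iff prime_dvd_power_iff)
    have "{x \<in> {0..<p}. a * x\<^sup>2 mod p = 0} = {x \<in> {0..<p}. x = 0}"
      by (intro Collect_cong conj_cong refl z)
    also have "\<dots> = {0}" using p0 by auto
    finally show ?thesis unfolding N_def by (simp only: card.insert card.empty) simp
  qed
  have ex: "\<exists>x. a * x\<^sup>2 mod p = z" if "N a z \<noteq> 0" for a z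
  proof (rule ccontr)
    assume "\<not> ?thesis"
    then have "{x \<in> {0..<p}. a * x\<^sup>2 mod p = z} = {}" by blast
    then show False using that by (simp only: N_def card.empty)
  qed
  have p1: "\<not> p dvd 1" using p by (rule not_prime_dvd_1)
  have le: "N 1 z + N a z \<le> 2" if z: "z \<in> {0..<p}" for z
  proof (cases "z = 0")
    case False
    then have pz: "\<not> p dvd z" using z zdvd_not_zless[of z p] by auto
    have 2: "N 1 z \<le> 2" "N a z \<le> 2"
      unfolding N_def using roots_mod_prime[OF p p1 pz] roots_mod_prime[OF p a(1) pz] z by simp_all
    \<comment> \<open>Representations of both kinds give x^2 = a y^2 with \<open>y\<close> a unit,
      and then \<open>a\<close> would be the square of x / y.\<close>
    have "N 1 z = 0 \<or> N a z = 0"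
    proof (rule ccontr)
      assume "\<not> (N 1 z = 0 \<or> N a z = 0)"
      then obtain x y where x: "x\<^sup>2 mod p = z" and y: "a * y\<^sup>2 mod p = z"
        using ex[of 1 z] ex[of a z] by auto
      have "\<not> p dvd y" using y pz p0 by (auto simp: power2_eq_square)
      then obtain i where i: "[y * i = 1] (mod p)"
        using p cong_solve_coprime_int[of y p] by (auto simp: coprime_commute prime_imp_coprime)
      have "[(x * i)\<^sup>2 = x\<^sup>2 * i\<^sup>2] (mod p)" by (simp add: power_mult_distrib)
      also have "[x\<^sup>2 * i\<^sup>2 = a * y\<^sup>2 * i\<^sup>2] (mod p)" using x y by (intro cong_mult) (auto simp: cong_def)
      also have "a * y\<^sup>2 * i\<^sup>2 = a * (y * i)\<^sup>2" by (simp add: power_mult_distrib)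
      also have "[\<dots> = a * 1\<^sup>2] (mod p)" using i by (intro cong_mult cong_pow) auto
      finally show False using a(2) by (auto simp: QuadRes_def)
    qed
    then show ?thesis using 2 by auto
  qed (use zero[OF a(1)] zero[OF p1] in simp)
  have total: "(\<Sum>z\<in>{0..<p}. N a z) = nat p" for a
  proof -
    have "(\<Sum>z\<in>{0..<p}. N a z) = (\<Sum>z\<in>{0..<p}. \<Sum>x | x \<in> {0..<p} \<and> a * x\<^sup>2 mod p = z. 1)"
      by (simp add: N_def)
    also have "\<dots> = (\<Sum>x\<in>{0..<p}. 1)"
      using p0 by (intro sum.group) auto
    finally show ?thesis by simp
  qed
  have eq: "N 1 z + N a z = 2" if "z \<in> {0..<p}" for z
  proof (rule ccontr)
    assume "N 1 z + N a z \<noteq> 2"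
    then have "N 1 z + N a z < 2" using le[OF that] by simp
    then have "(\<Sum>z\<in>{0..<p}. N 1 z + N a z) < (\<Sum>z\<in>{0..<p}. 2)"
      using that le by (intro sum_strict_mono_ex1) auto
    then show False using total[of 1] total[of a] by (simp add: sum.distrib)
  qed
  have "gauss_sum (b * 1) p + gauss_sum (b * a) p = (\<Sum>z\<in>{0..<p}. of_nat (N 1 z + N a z) * ec p (b * z))"
    unfolding gauss_sum_fibres[OF p0] N_def by (simp add: sum.distrib ring_distribs)
  also have "\<dots> = (\<Sum>z\<in>{0..<p}. 2 * ec p (b * z))"
    by (intro sum.cong refl) (simp only: eq, simp)
  also have "\<dots> = 0"
    using sum_ec[OF p0, of b] b by (simp add: sum_distrib_left[symmetric])
  finally show ?thesis by (simp add: eq_neg_iff_add_eq_0 add.commute)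
qed

text \<open>A residue a = y^2 is absorbed by scaling the variable by the unit \<open>y\<close>; a
  nonresidue reverses the sign.\<close>

lemma gauss_sum_prime:
  assumes p: "prime p" "odd p" and a: "\<not> p dvd a" and b: "\<not> p dvd b"
  shows "gauss_sum (b * a) p = of_int (kronecker_prime a p) * gauss_sum b p"
proof -
  have k: "kronecker_prime a p = Legendre a p" using p by (auto simp: kronecker_prime_def)
  show ?thesis
  proof (cases "QuadRes p a")
    case True
    then obtain y where y: "[y\<^sup>2 = a] (mod p)" by (auto simp: QuadRes_def)
    then have "\<not> p dvd y" using a cong_dvd_iff by (auto simp: power2_eq_square dest: cong_dvd_iff)
    then have "coprime y p" using p by (simp add: coprime_commute prime_imp_coprime)
    then have "gauss_sum (b * y\<^sup>2) p = gauss_sum b p"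
      using prime_gt_0_int[OF p(1)] by (rule gauss_sum_mult_square[rotated])
    moreover have "gauss_sum (b * y\<^sup>2) p = gauss_sum (b * a) p"
      using y by (intro gauss_sum_cong cong_mult) auto
    ultimately show ?thesis using True a k by (simp add: Legendre_def cong_0_iff)
  next
    case False
    then show ?thesis using gauss_sum_nonresidue[OF p(1) a False b] a k
      by (simp add: Legendre_def cong_0_iff)
  qed
qed

text \<open>\<open>b\<close> varies in the induction because coprime splitting multiplies it by the
  cofactors. Splitting \<open>gauss_sum b\<close> on the right in the same way makes these cofactors
  match, at the place where reciprocity would otherwise enter.\<close>

lemma gauss_sum_kronecker:
  assumes "c > 0"
  shows "odd c \<Longrightarrow> coprime a c \<Longrightarrow> coprime b c \<Longrightarrow>
    gauss_sum (b * a) c = of_int (kronecker a c) * gauss_sum b c"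
  using assms
proof (induction c arbitrary: b rule: square_prime_induct)
  case (square p c)
  have "\<not> p dvd a" "\<not> p dvd b"
    using square.prems square.hyps not_prime_unit by (auto simp: coprime_def)
  then show ?case
    using square by (simp add: gauss_sum_square prime_dvd_mult_iff kronecker_square_times)
next
  case (prime p c)
  have p: "odd p" "coprime a p" "coprime b p" "\<not> p dvd a" "\<not> p dvd b" "\<not> p dvd c"
    using prime.prems prime.hyps not_prime_unit by (auto simp: coprime_def)
  have c: "odd c" "coprime a c" "coprime b c" "coprime p c"
    using prime by auto
  have p0: "p > 0" using prime.hyps by (simp add: prime_gt_0_int)
  have "gauss_sum (b * a) (p * c) = gauss_sum (b * c * a) p * gauss_sum (b * p * a) c"
    using gauss_sum_coprime[OF p0 prime.hyps(2,3), of "b * a"] by (simp add: mult_ac)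
  also have "gauss_sum (b * c * a) p = of_int (kronecker_prime a p) * gauss_sum (b * c) p"
    using p prime.hyps by (intro gauss_sum_prime) (auto simp: prime_dvd_mult_iff)
  also have "gauss_sum (b * p * a) c = of_int (kronecker a c) * gauss_sum (b * p) c"
    using c by (intro prime.IH) auto
  finally show ?case
    unfolding gauss_sum_coprime[OF p0 prime.hyps(2,3), of b]
      kronecker_prime_times[OF prime.hyps(1,2), of a]
    by (simp only: of_int_mult mult_ac)
qed simp

section \<open>Quadratic forms modulo a prime\<close>

text \<open>Extending a block by the identity keeps the type of the matrices fixed while the dimension
  drops in the inductions on \<open>K\<close>.\<close>

definition block_on :: "'n set \<Rightarrow> int ^ 'n ^ 'n \<Rightarrow> bool" where
  "block_on K A \<longleftrightarrow> (\<forall>i j. i \<notin> K \<or> j \<notin> K \<longrightarrow> A $ i $ j = of_bool (i = j))"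

definition form_on :: "'n set \<Rightarrow> int ^ 'n ^ 'n \<Rightarrow> int ^ 'n \<Rightarrow> int" where
  "form_on K A v = (\<Sum>i\<in>K. \<Sum>j\<in>K. A $ i $ j * v $ i * v $ j)"

definition block :: "'n set \<Rightarrow> int ^ 'n ^ 'n \<Rightarrow> int ^ 'n ^ 'n" where
  "block E A = (\<chi> i j. if i \<in> E \<and> j \<in> E then A $ i $ j else of_bool (i = j))"

lemma block_on_block: "block_on E (block E A)"
  by (auto simp: block_on_def block_def)

lemma form_on_block: "form_on E (block E A) = form_on E A"
  by (rule ext) (auto simp: form_on_def block_def intro!: sum.cong)

lemma transpose_block:
  assumes "transpose A = A" shows "transpose (block E A) = block E A"
  using transpose_eqD[OF assms] by (auto simp: block_def transpose_def vec_eq_iff)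

lemma block_on_mult:
  fixes A B :: "int ^ 'n ^ 'n"
  assumes "block_on K A" "block_on K B" shows "block_on K (A ** B)"
proof -
  have "(A ** B) $ i $ j = of_bool (i = j)" if "i \<notin> K \<or> j \<notin> K" for i j
  proof (cases "i \<in> K")
    case False
    then have "(A ** B) $ i $ j = (\<Sum>k\<in>UNIV. if i = k then B $ k $ j else 0)"
      unfolding matrix_matrix_mult_def using assms(1) by (auto simp: block_on_def intro!: sum.cong)
    then show ?thesis using assms(2) False by (simp add: block_on_def)
  next
    case True
    then have "(A ** B) $ i $ j = (\<Sum>k\<in>UNIV. if k = j then A $ i $ k else 0)"
      unfolding matrix_matrix_mult_def using assms(2) that by (auto simp: block_on_def intro!: sum.cong)
    then show ?thesis using assms(1) True that by (simp add: block_on_def)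
  qed
  then show ?thesis by (simp add: block_on_def)
qed

lemma block_on_transpose: "block_on K A \<Longrightarrow> block_on K (transpose A)"
  by (auto simp: block_on_def transpose_def)

lemma block_on_vector:
  assumes "block_on K P" "i \<notin> K" shows "(P *v v) $ i = v $ i"
proof -
  have "(P *v v) $ i = (\<Sum>k\<in>UNIV. if i = k then v $ k else 0)"
    unfolding matrix_vector_mult_def using assms by (auto simp: block_on_def intro!: sum.cong)
  then show ?thesis by simp
qed

lemma dot_eq_form_on:
  fixes A :: "int ^ 'n ^ 'n"
  assumes "block_on K A"
  shows "dot v (A *v v) = form_on K A v + (\<Sum>i\<in>- K. (v $ i)\<^sup>2)"
proof -
  have "dot v (A *v v) = (\<Sum>i\<in>UNIV. \<Sum>j\<in>UNIV. A $ i $ j * v $ i * v $ j)"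
    by (simp add: dot_def matrix_vector_mult_def sum_distrib_left mult_ac)
  also have "\<dots> = (\<Sum>i\<in>K. \<Sum>j\<in>UNIV. A $ i $ j * v $ i * v $ j) +
      (\<Sum>i\<in>- K. \<Sum>j\<in>UNIV. A $ i $ j * v $ i * v $ j)"
    by (subst sum.union_disjoint[symmetric]) (auto intro!: sum.cong)
  also have "(\<Sum>i\<in>K. \<Sum>j\<in>UNIV. A $ i $ j * v $ i * v $ j) = form_on K A v"
    unfolding form_on_def
    by (intro sum.cong refl sum.mono_neutral_right) (use assms in \<open>auto simp: block_on_def\<close>)
  also have "(\<Sum>i\<in>- K. \<Sum>j\<in>UNIV. A $ i $ j * v $ i * v $ j) = (\<Sum>i\<in>- K. (v $ i)\<^sup>2)"
  proof (intro sum.cong refl)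
    fix i assume "i \<in> - K"
    then have "(\<Sum>j\<in>UNIV. A $ i $ j * v $ i * v $ j) = (\<Sum>j\<in>UNIV. if i = j then v $ i * v $ j else 0)"
      using assms by (intro sum.cong) (auto simp: block_on_def)
    then show "(\<Sum>j\<in>UNIV. A $ i $ j * v $ i * v $ j) = (v $ i)\<^sup>2"
      by (simp add: power2_eq_square)
  qed
  finally show ?thesis .
qed

text \<open>\<open>P\<close> fixes the coordinates outside \<open>K\<close>, so their squares occur
  on both sides of the identity for the full forms and cancel.\<close>

lemma form_on_transform:
  fixes A P :: "int ^ 'n ^ 'n"
  assumes "block_on K P" "block_on K A"
  shows "form_on K (transpose P ** A ** P) v = form_on K A (P *v v)"
proof -
  have "block_on K (transpose P ** A ** P)"
    using assms by (intro block_on_mult block_on_transpose)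
  then have "form_on K (transpose P ** A ** P) v + (\<Sum>i\<in>- K. (v $ i)\<^sup>2) =
      dot v ((transpose P ** A ** P) *v v)"
    by (simp add: dot_eq_form_on)
  also have "\<dots> = dot (P *v v) (A *v (P *v v))"
    by (simp only: matrix_vector_mul_assoc[symmetric] dot_matrix[of v "transpose P"] transpose_transpose)
  also have "\<dots> = form_on K A (P *v v) + (\<Sum>i\<in>- K. ((P *v v) $ i)\<^sup>2)"
    using assms(2) by (rule dot_eq_form_on)
  also have "(\<Sum>i\<in>- K. ((P *v v) $ i)\<^sup>2) = (\<Sum>i\<in>- K. (v $ i)\<^sup>2)"
    using assms(1) by (intro sum.cong) (auto simp: block_on_vector)
  finally show ?thesis by simp
qed

lemma transpose_congruence:
  fixes A P :: "int ^ 'n ^ 'n"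
  shows "transpose A = A \<Longrightarrow> transpose (transpose P ** A ** P) = transpose P ** A ** P"
  by (simp add: matrix_transpose_mul matrix_mul_assoc)

lemma form_on_axis: "i \<in> K \<Longrightarrow> form_on K A (axis i 1) = A $ i $ i"
proof -
  assume i: "i \<in> K"
  have "form_on K A (axis i 1) = (\<Sum>k\<in>K. \<Sum>j\<in>K. if j = i then (if k = i then A $ k $ j else 0) else 0)"
    unfolding form_on_def by (intro sum.cong refl) (simp add: axis_def)
  then show ?thesis using i by simp
qed

text \<open>Orthogonality makes \<open>A\<close> block diagonal. Each block carries the identity on
  its complement, so the direct sum is a matrix product and the determinant splits by
  multiplicativity.\<close>

lemma block_factorization:
  fixes A :: "int ^ 'n ^ 'n"
  assumes A: "block_on K A" "transpose A = A" and E: "E \<subseteq> K"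
    and orth: "\<And>i j. i \<in> E \<Longrightarrow> j \<in> K - E \<Longrightarrow> A $ i $ j = 0"
  shows "A = block E A ** block (K - E) A"
    and "form_on K A v = form_on E A v + form_on (K - E) A v"
proof -
  have orth': "A $ i $ j = 0" if "j \<in> E" "i \<in> K - E" for i j
    using orth[OF that] transpose_eqD[OF A(2)] by metis
  have "(block E A ** block (K - E) A) $ i $ j = A $ i $ j" for i j
  proof (cases "i \<in> E")
    case True
    have "(block E A ** block (K - E) A) $ i $ j = (\<Sum>k\<in>UNIV. if k = j then (if j \<in> E then A $ i $ k else 0) else 0)"
      unfolding matrix_matrix_mult_def vec_lambda_beta using True
      by (intro sum.cong refl) (auto simp: block_def)
    also have "\<dots> = A $ i $ j"
      using orth[of i j] True A(1) E by (cases "j \<in> K"; cases "j \<in> E") (auto simp: block_on_def)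
    finally show ?thesis .
  next
    case False
    then have "(block E A ** block (K - E) A) $ i $ j = (\<Sum>k\<in>UNIV. if i = k then block (K - E) A $ k $ j else 0)"
      unfolding matrix_matrix_mult_def vec_lambda_beta
      by (intro sum.cong refl) (auto simp: block_def)
    also have "\<dots> = A $ i $ j"
      using orth'[of j i] False A(1) E
      by (cases "i \<in> K"; cases "j \<in> E") (auto simp: block_on_def block_def)
    finally show ?thesis .
  qed
  then show "A = block E A ** block (K - E) A" by (simp add: vec_eq_iff)
  have split: "sum g K = sum g E + sum g (K - E)" for g :: "'n \<Rightarrow> int"
    using sum.subset_diff[OF E, of g] by simp
  have "form_on K A v = (\<Sum>i\<in>E. (\<Sum>j\<in>E. A $ i $ j * v $ i * v $ j) + (\<Sum>j\<in>K - E. A $ i $ j * v $ i * v $ j))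
      + (\<Sum>i\<in>K - E. (\<Sum>j\<in>E. A $ i $ j * v $ i * v $ j) + (\<Sum>j\<in>K - E. A $ i $ j * v $ i * v $ j))"
    by (simp only: form_on_def split)
  also have "\<dots> = form_on E A v + form_on (K - E) A v"
    by (simp add: form_on_def orth orth' sum.distrib)
  finally show "form_on K A v = form_on E A v + form_on (K - E) A v" .
qed

text \<open>The Schur complement with cleared denominators. \<open>U\<close> plays the role of
  \<open>d\<close> times the inverse of the block on \<open>E\<close> times the part of
  \<open>A\<close> from \<open>E\<close> to \<open>K - E\<close>. In block form P = [[1, -U],
  [0, d]], and P' = [[d, U], [0, 1]] inverts it up to \<open>d\<close>.\<close>

lemma orthogonalize:
  fixes A U :: "int ^ 'n ^ 'n"
  assumes A: "block_on K A" and E: "E \<subseteq> K"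
    and U: "\<And>i j. \<not> (i \<in> E \<and> j \<in> K - E) \<Longrightarrow> U $ i $ j = 0"
    and solve: "\<And>i j. i \<in> E \<Longrightarrow> j \<in> K - E \<Longrightarrow> (\<Sum>l\<in>E. A $ i $ l * U $ l $ j) = d * A $ i $ j"
  obtains P P' where "block_on K P" "P ** P' = mat d"
    "\<And>i j. i \<in> E \<Longrightarrow> j \<in> E \<Longrightarrow> (transpose P ** A ** P) $ i $ j = A $ i $ j"
    "\<And>i j. i \<in> E \<Longrightarrow> j \<in> K - E \<Longrightarrow> (transpose P ** A ** P) $ i $ j = 0"
proof -
  \<comment> \<open>Outside \<open>K\<close> the diagonal of \<open>P\<close> has to be 1 for
    \<open>block_on\<close>, so that of \<open>P'\<close> is \<open>d\<close> there.\<close>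
  define y where "y j = (if j \<in> K - E then d else 1)" for j
  define y' where "y' j = (if j \<in> K - E then 1 else d)" for j
  define P where "P = (\<chi> i j. (if i = j then y i else 0) - U $ i $ j)"
  define P' where "P' = (\<chi> i j. (if i = j then y' i else 0) + U $ i $ j)"
  have "block_on K P"
    using E U by (auto simp: block_on_def P_def y_def)
  moreover have "P ** P' = mat d"
  proof -
    have "(P ** P') $ i $ j = (if i = j then d else 0)" for i j
    proof -
      have "(P ** P') $ i $ j = (\<Sum>k\<in>UNIV. (if i = k then (if k = j then y i * y' k else 0) else 0) +
          (if i = k then y i * U $ k $ j else 0) - (if k = j then U $ i $ k * y' k else 0))"
        unfolding matrix_matrix_mult_def vec_lambda_beta P_def P'_def
      proof (intro sum.cong refl)
        fix k
        \<comment> \<open>The nonzero rows of \<open>U\<close> lie in \<open>E\<close> and its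
          nonzero columns in \<open>K - E\<close>, so U^2 = 0.\<close>
        have "U $ i $ k * U $ k $ j = 0" using U[of i k] U[of k j] by auto
        then show "((if i = k then y i else 0) - U $ i $ k) * ((if k = j then y' k else 0) + U $ k $ j) =
          (if i = k then (if k = j then y i * y' k else 0) else 0) +
          (if i = k then y i * U $ k $ j else 0) - (if k = j then U $ i $ k * y' k else 0)"
          by (auto simp: algebra_simps)
      qed
      also have "\<dots> = (if i = j then y i * y' j else 0) + y i * U $ i $ j - U $ i $ j * y' j"
        by (simp add: sum.distrib sum_subtractf)
      also have "y i * U $ i $ j = U $ i $ j" using U[of i j] by (auto simp: y_def)
      also have "U $ i $ j * y' j = U $ i $ j" using U[of i j] by (auto simp: y'_def)
      finally show ?thesis by (simp add: y_def y'_def)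
    qed
    then show ?thesis by (simp add: vec_eq_iff mat_def)
  qed
  \<comment> \<open>The columns of \<open>P\<close> with index in \<open>E\<close> are unit vectors,
    so on rows in \<open>E\<close> the left factor \<open>transpose P\<close> changes
    nothing.\<close>
  moreover have AP: "(transpose P ** A ** P) $ i $ j = (\<Sum>l\<in>UNIV. A $ i $ l * P $ l $ j)" if i: "i \<in> E" for i j
  proof -
    have "(transpose P ** A) $ i $ l = (\<Sum>k\<in>UNIV. if k = i then A $ k $ l else 0)" for l
      unfolding matrix_matrix_mult_def vec_lambda_beta transpose_def
      using i U E by (intro sum.cong refl) (auto simp: P_def y_def)
    then have "(transpose P ** A) $ i $ l = A $ i $ l" for l by simp
    then show ?thesis by (subst matrix_matrix_mult_def) simp
  qed
  have AP': "(transpose P ** A ** P) $ i $ j = A $ i $ j * y j - (\<Sum>l\<in>E. A $ i $ l * U $ l $ j)"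
    if "i \<in> E" for i j
  proof -
    have "(\<Sum>l\<in>UNIV. A $ i $ l * P $ l $ j) =
        (\<Sum>l\<in>UNIV. (if l = j then A $ i $ l * y l else 0) - A $ i $ l * U $ l $ j)"
      by (intro sum.cong refl) (simp add: P_def right_diff_distrib)
    also have "\<dots> = A $ i $ j * y j - (\<Sum>l\<in>UNIV. A $ i $ l * U $ l $ j)"
      by (simp add: sum_subtractf)
    also have "(\<Sum>l\<in>UNIV. A $ i $ l * U $ l $ j) = (\<Sum>l\<in>E. A $ i $ l * U $ l $ j)"
      using U by (intro sum.mono_neutral_right) auto
    finally show ?thesis using AP[OF that] by simp
  qed
  have "(transpose P ** A ** P) $ i $ j = A $ i $ j" if "i \<in> E" "j \<in> E" for i j
    using that U by (simp add: AP' y_def)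
  moreover have "(transpose P ** A ** P) $ i $ j = 0" if "i \<in> E" "j \<in> K - E" for i j
    using that solve[OF that] by (simp add: AP' y_def)
  ultimately show thesis using that by blast
qed

text \<open>\<open>det P\<close> divides a power of \<open>d\<close>.\<close>

lemma not_dvd_det:
  fixes P P' :: "int ^ 'n ^ 'n"
  assumes "prime p" "\<not> p dvd d" "P ** P' = mat d"
  shows "\<not> p dvd det P"
proof -
  have "det P * det P' = d ^ CARD('n)"
    using det_mul[of P P'] assms(3) by (simp add: det_diagonal mat_def)
  then show ?thesis
    using assms(1,2) by (metis dvd_mult2 prime_dvd_power)
qed

text \<open>\<open>P\<close> permutes the classes modulo \<open>p\<close>, which preserves the mean,
  and multiplies the determinant of the form by the square of \<open>det P\<close>, which preserves
  the symbol.\<close>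

lemma transform_mod_prime:
  fixes A P P' :: "int ^ 'n ^ 'n"
  assumes p: "prime p" and d: "\<not> p dvd d" "P ** P' = mat d"
    and K: "block_on K P" "block_on K A" and "\<not> p dvd det A"
    and per: "periodic p (\<lambda>v. f (form_on K A v))"
  defines "A' \<equiv> transpose P ** A ** P"
  shows "\<not> p dvd det A'"
    and "kronecker_prime (det A') p = kronecker_prime (det A) p"
    and "mean p (\<lambda>v. f (form_on K A' v)) = mean p (\<lambda>v. f (form_on K A v))"
proof -
  have P: "\<not> p dvd det P" using not_dvd_det[OF p d] .
  have det: "det A' = (det P)\<^sup>2 * det A"
    by (simp add: A'_def det_mul power2_eq_square)
  show "\<not> p dvd det A'"
    using P p assms(6) by (simp add: det prime_dvd_mult_iff prime_dvd_power_iff)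
  show "kronecker_prime (det A') p = kronecker_prime (det A) p"
    unfolding det using p assms(6) P by (rule kronecker_prime_mult_square)
  have "coprime p (det P)" "det P \<noteq> 0" using P p by (auto simp: prime_imp_coprime)
  note inj = matrix_injective_mod[OF this]
  have "mean p (\<lambda>v. f (form_on K A (P *v v))) = mean p (\<lambda>v. f (form_on K A v))"
    by (rule mean_reindex[OF prime_gt_0_int[OF p] per, of "(*v) P"]) (rule inj)
  then show "mean p (\<lambda>v. f (form_on K A' v)) = mean p (\<lambda>v. f (form_on K A v))"
    using K by (simp add: A'_def form_on_transform)
qed

lemma mean_block_factorization:
  fixes A :: "int ^ 'n ^ 'n"
  assumes "c > 0" "block_on K A" "transpose A = A" "E \<subseteq> K"
    and orth: "\<And>i j. i \<in> E \<Longrightarrow> j \<in> K - E \<Longrightarrow> A $ i $ j = 0"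
    and f: "\<And>x y. f (x + y) = f x * f y"
  shows "mean c (\<lambda>v. f (form_on K A v)) = mean c (\<lambda>v. f (form_on E A v)) * mean c (\<lambda>v. f (form_on (K - E) A v))"
proof -
  have eq: "f (form_on K A v) = f (form_on E A v) * f (form_on (K - E) A v)" for v
    using block_factorization(2)[OF assms(2-4), of v] orth f by simp
  show ?thesis
    unfolding eq
  proof (rule mean_independent[OF assms(1), where E = E])
  show "f (form_on E A v) = f (form_on E A w)" if "\<And>i. i \<in> E \<Longrightarrow> v $ i = w $ i" for v w
    using that by (intro arg_cong[of _ _ f]) (simp add: form_on_def)
  show "f (form_on (K - E) A v) = f (form_on (K - E) A w)" if "\<And>i. i \<notin> E \<Longrightarrow> v $ i = w $ i" for v w
    using that by (intro arg_cong[of _ _ f]) (simp add: form_on_def)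
  qed
qed

text \<open>Otherwise column \<open>i\<close> would vanish modulo \<open>p\<close>, since its
  entries outside \<open>K\<close> are 0, and \<open>A\<close> would kill a basis vector although it
  is injective modulo \<open>p\<close>.\<close>

lemma exists_entry_not_dvd:
  fixes A :: "int ^ 'n ^ 'n"
  assumes p: "prime p" "\<not> p dvd det A" and A: "block_on K A" and i: "i \<in> K"
  shows "\<exists>j\<in>K. \<not> p dvd A $ j $ i"
proof (rule ccontr)
  assume "\<not> ?thesis"
  then have dvd: "p dvd A $ j $ i" if "j \<in> K" for j using that by blast
  have "p dvd A $ j $ i" for j
    using dvd[of j] A i by (cases "j \<in> K") (auto simp: block_on_def)
  moreover have "(A *v axis i 1) $ j = A $ j $ i" for j
    by (simp add: matrix_vector_mult_def axis_def if_distrib[of "\<lambda>x. _ * x"] cong: if_cong)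
  ultimately have "vcong p (A *v axis i 1) (A *v 0)"
    by (simp add: vcong_def cong_0_iff)
  moreover have "coprime p (det A)" "det A \<noteq> 0" using p by (auto simp: prime_imp_coprime)
  ultimately have "vcong p (axis i 1) (0 :: int ^ 'n)"
    using matrix_injective_mod by blast
  then have "[axis i 1 $ i = (0 :: int ^ 'n) $ i] (mod p)" unfolding vcong_def by blast
  then show False using not_prime_dvd_1[OF p(1)] by (simp add: cong_0_iff)
qed

lemma block_on_empty: "block_on {} A \<Longrightarrow> A = mat 1"
  by (simp add: block_on_def mat_def vec_eq_iff)

section \<open>Determinants of blocks of size one and two, and periodicity of the characters\<close>

lemma det_block_on_singleton:
  fixes A :: "int ^ 'n ^ 'n"
  assumes "block_on {i} A" shows "det A = A $ i $ i"
proof -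
  have "det A = (\<Prod>j\<in>UNIV. A $ j $ j)"
  proof (rule det_diagonal)
    show "A $ j $ k = 0" if "j \<noteq> k" for j k
      using assms that unfolding block_on_def by (cases "j = i") auto
  qed
  also have "\<dots> = (\<Prod>j\<in>UNIV. if j = i then A $ i $ i else 1)"
    using assms by (intro prod.cong refl) (auto simp: block_on_def)
  finally show ?thesis by simp
qed

lemma permutes_doubleton:
  assumes "p permutes {e, f}" "e \<noteq> f"
  shows "p = id \<or> p = Transposition.transpose e f"
proof -
  have fix_out: "p x = x" if "x \<notin> {e, f}" for x using assms(1) that by (rule permutes_not_in)
  have "p e \<in> {e, f}" "p f \<in> {e, f}" using assms(1) by (simp_all only: permutes_in_image insertI1 insertI2)
  moreover have "p e \<noteq> p f" using assms by (metis permutes_inj injD)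
  ultimately consider "p e = e" "p f = f" | "p e = f" "p f = e" by auto
  then show ?thesis
  proof cases
    case 1
    then have "p x = x" for x using fix_out[of x] by (cases "x \<in> {e, f}") auto
    then show ?thesis by auto
  next
    case 2
    then have "p x = Transposition.transpose e f x" for x
      using fix_out[of x] by (cases "x \<in> {e, f}") (auto simp: transpose_def)
    then show ?thesis by auto
  qed
qed

text \<open>In the Leibniz formula a permutation that moves an index outside \<open>{e, f}\<close>
  meets a zero entry, so only the identity and the transposition contribute.\<close>

lemma det_block_on_doubleton:
  fixes A :: "int ^ 'n ^ 'n"
  assumes A: "block_on {e, f} A" and "e \<noteq> f"
  shows "det A = A $ e $ e * A $ f $ f - A $ e $ f * A $ f $ e"
proof -
  define t where "t = Transposition.transpose e f"
  define g where "g p = of_int (sign p) * (\<Prod>i\<in>UNIV. A $ i $ p i)" for p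
  have "det A = (\<Sum>p\<in>{p. p permutes UNIV}. g p)"
    by (simp add: det_def g_def)
  also have "\<dots> = (\<Sum>p\<in>{id, t}. g p)"
  proof (rule sum.mono_neutral_right)
    show "{id, t} \<subseteq> {p. p permutes UNIV}"
      by (auto simp: t_def permutes_id permutes_swap_id)
    show "\<forall>p\<in>{p. p permutes UNIV} - {id, t}. g p = 0"
    proof
      fix p :: "'n \<Rightarrow> 'n" assume p: "p \<in> {p. p permutes UNIV} - {id, t}"
      have "\<exists>i. i \<notin> {e, f} \<and> p i \<noteq> i"
      proof (rule ccontr)
        assume "\<nexists>i. i \<notin> {e, f} \<and> p i \<noteq> i"
        then have "p permutes {e, f}" using p by (auto simp: permutes_def)
        then show False using p permutes_doubleton[OF _ assms(2)] by (auto simp: t_def)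
      qed
      then obtain i where "i \<notin> {e, f}" "p i \<noteq> i" by blast
      then have "A $ i $ p i = 0" using A by (auto simp: block_on_def)
      then have "(\<Prod>i\<in>UNIV. A $ i $ p i) = 0" by (intro prod_zero) auto
      then show "g p = 0" by (simp add: g_def)
    qed
  qed (simp add: finite_permutations)
  also have "\<dots> = g id + g t"
  proof -
    have "t e \<noteq> id e" using assms(2) by (simp add: t_def)
    then have "id \<noteq> t" by metis
    then show ?thesis by simp
  qed
  also have "g id = A $ e $ e * A $ f $ f"
  proof -
    have "(\<Prod>i\<in>UNIV. A $ i $ i) = (\<Prod>i\<in>{e, f}. A $ i $ i)"
      using A by (intro prod.mono_neutral_right) (auto simp: block_on_def)
    then show ?thesis using assms(2) by (simp add: g_def sign_id)
  qed
  also have "g t = - (A $ e $ f * A $ f $ e)"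
  proof -
    have "(\<Prod>i\<in>UNIV. A $ i $ t i) = (\<Prod>i\<in>{e, f}. A $ i $ t i)"
      using A by (intro prod.mono_neutral_right) (auto simp: block_on_def t_def transpose_def)
    then show ?thesis using assms(2) by (simp add: g_def t_def sign_swap_id)
  qed
  finally show ?thesis by simp
qed

lemma periodic_form_on: "periodic p (\<lambda>v. ec p (b * form_on K A v))"
  by (auto simp: periodic_def vcong_def form_on_def intro!: ec_cong cong_mult cong_sum)

text \<open>For an increment 2 z both the cross term and the square of the increment are multiples
  of 4. So a mean modulo 2 makes sense for a character modulo 4, as required by e(Q / 2) = e(2 Q /
  4).\<close>

lemma periodic_form_on_4:
  fixes A :: "int ^ 'n ^ 'n"
  assumes "block_on K A" "transpose A = A"
  shows "periodic 2 (\<lambda>v. ec 4 (form_on K A v))"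
  unfolding periodic_def
proof (intro allI impI ec_cong)
  fix v w :: "int ^ 'n" assume "vcong 2 v w"
  then obtain z where z: "v = w + 2 *s z" by (rule vcongE)
  have "dot v (A *v v) = dot w (A *v w) + 4 * (dot w (A *v z) + dot z (A *v z))"
    unfolding z dot_add_left dot_add_right matrix_vector_right_distrib matrix_vector_scale
      dot_scale_left dot_scale_right using dot_symmetric_matrix[OF assms(2), of z w]
    by (simp add: algebra_simps)
  moreover have "(\<Sum>i\<in>- K. (v $ i)\<^sup>2) = (\<Sum>i\<in>- K. (w $ i)\<^sup>2) + 4 * (\<Sum>i\<in>- K. w $ i * z $ i + (z $ i)\<^sup>2)"
    unfolding z sum_distrib_left sum.distrib[symmetric]
    by (intro sum.cong refl) (simp add: power2_eq_square algebra_simps)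
  ultimately have "form_on K A v - form_on K A w =
      4 * (dot w (A *v z) + dot z (A *v z) - (\<Sum>i\<in>- K. w $ i * z $ i + (z $ i)\<^sup>2))"
    unfolding dot_eq_form_on[OF assms(1)] by (simp only: right_diff_distrib)
  then show "[form_on K A v = form_on K A w] (mod 4)"
    by (simp add: cong_iff_dvd_diff)
qed

text \<open>The induction step shared by odd primes, where \<open>E\<close> has one index, and the
  prime 2, where it has two; \<open>f\<close> stands for a character modulo \<open>p\<close> or
  modulo 4. The last conclusion lets \<open>B\<close> inherit the evenness of values from
  \<open>A\<close>.\<close>

lemma split_off_block:
  fixes A U :: "int ^ 'n ^ 'n"
  assumes p: "prime p" and A: "block_on K A" "transpose A = A" "\<not> p dvd det A"
    and E: "E \<subseteq> K" and d: "det (block E A) = d" "\<not> p dvd d"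
    and U: "\<And>i j. \<not> (i \<in> E \<and> j \<in> K - E) \<Longrightarrow> U $ i $ j = 0"
    and solve: "\<And>i j. i \<in> E \<Longrightarrow> j \<in> K - E \<Longrightarrow> (\<Sum>l\<in>E. A $ i $ l * U $ l $ j) = d * A $ i $ j"
    and f: "\<And>x y. f (x + y) = f x * f y" and per: "periodic p (\<lambda>v. f (form_on K A v))"
  obtains B where "block_on (K - E) B" "transpose B = B" "\<not> p dvd det B"
    "kronecker_prime (det A) p = kronecker_prime d p * kronecker_prime (det B) p"
    "mean p (\<lambda>v. f (form_on K A v)) = mean p (\<lambda>v. f (form_on E A v)) * mean p (\<lambda>v. f (form_on (K - E) B v))"
    "\<And>v. \<exists>w. form_on (K - E) B v = form_on K A w"
proof -
  obtain P P' where P: "block_on K P" "P ** P' = mat d"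
    and EE: "\<And>i j. i \<in> E \<Longrightarrow> j \<in> E \<Longrightarrow> (transpose P ** A ** P) $ i $ j = A $ i $ j"
    and orth: "\<And>i j. i \<in> E \<Longrightarrow> j \<in> K - E \<Longrightarrow> (transpose P ** A ** P) $ i $ j = 0"
    using orthogonalize[OF A(1) E U solve] by blast
  define A' where "A' = transpose P ** A ** P"
  note EE = EE[folded A'_def] and orth = orth[folded A'_def]
  note tr = transform_mod_prime[OF p d(2) P(2,1) A(1,3) per, folded A'_def]
  define B where "B = block (K - E) A'"
  have A': "block_on K A'" "transpose A' = A'"
    unfolding A'_def using P A by (auto intro!: block_on_mult block_on_transpose transpose_congruence)
  note fac = block_factorization[OF A' E orth]
  have blockE: "block E A' = block E A"
    using EE by (auto simp: block_def vec_eq_iff)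
  have formE: "form_on E A' v = form_on E A v" for v
    using EE by (simp add: form_on_def)
  have formB: "form_on (K - E) A' v = form_on (K - E) B v" for v
    by (simp add: B_def form_on_block)
  have det: "det A' = d * det B"
    using arg_cong[OF fac(1), of det] by (simp add: det_mul blockE d(1) B_def)
  then have "\<not> p dvd det B" using tr(1) by auto
  moreover have "kronecker_prime (det A) p = kronecker_prime d p * kronecker_prime (det B) p"
    using kronecker_prime_mult[OF p d(2) \<open>\<not> p dvd det B\<close>] tr(2) by (simp add: det)
  moreover have "mean p (\<lambda>v. f (form_on K A v)) = mean p (\<lambda>v. f (form_on E A v)) * mean p (\<lambda>v. f (form_on (K - E) B v))"
    using mean_block_factorization[OF prime_gt_0_int[OF p] A' E orth, of f] f tr(3)
    by (simp add: formE formB)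
  moreover have "\<exists>w. form_on (K - E) B v = form_on K A w" for v
  proof -
    \<comment> \<open>Extension by 0 silences the part of the form on \<open>E\<close>.\<close>
    define v0 where "v0 = (\<chi> i. if i \<in> K - E then v $ i else 0)"
    have "form_on K A (P *v v0) = form_on K A' v0"
      using P(1) A(1) by (simp add: A'_def form_on_transform)
    also have "\<dots> = form_on E A' v0 + form_on (K - E) A' v0" by (rule fac(2))
    also have "form_on E A' v0 = 0" by (auto simp: form_on_def v0_def intro!: sum.neutral)
    also have "form_on (K - E) A' v0 = form_on (K - E) B v"
      unfolding formB[symmetric] by (auto simp: form_on_def v0_def intro!: sum.cong)
    finally show ?thesis by (intro exI[of _ "P *v v0"]) simp
  qed
  moreover have "block_on (K - E) B" "transpose B = B"
    unfolding B_def using A' by (auto intro: block_on_block transpose_block)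
  ultimately show thesis using that by blast
qed

text \<open>Splitting off a diagonal entry prime to \<open>p\<close> contributes one Gauss sum and
  the symbol of that entry. If there is none, a base change creates one, because 2 is invertible
  modulo \<open>p\<close>.\<close>

lemma mean_form_odd_prime:
  fixes A :: "int ^ 'n ^ 'n"
  assumes p: "prime p" "odd p" and b: "\<not> p dvd b"
    and A: "block_on K A" "transpose A = A" "\<not> p dvd det A"
  shows "mean p (\<lambda>v. ec p (b * form_on K A v)) =
    of_int (kronecker_prime (det A) p) * (gauss_sum b p / of_int p) ^ card K"
  using A
proof (induction "card K" arbitrary: K A)
  case 0
  then have "K = {}" by simp
  with 0 have "A = mat 1" by (simp add: block_on_empty)
  with \<open>K = {}\<close> show ?case using p prime_gt_0_int[of p] by (simp add: form_on_def)
next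
  case (Suc n)
  note p0 = prime_gt_0_int[OF p(1)]
  define f where "f x = ec p (b * x)" for x
  have f: "f (x + y) = f x * f y" for x y by (simp add: f_def ec_add ring_distribs)
  have per: "periodic p (\<lambda>v. f (form_on K A v))" for A :: "int ^ 'n ^ 'n"
    unfolding f_def by (rule periodic_form_on)
  \<comment> \<open>Stated for every matrix on \<open>K\<close>, since it also has to apply after
    the base change below.\<close>
  have diagonal: "mean p (\<lambda>v. f (form_on K A v)) =
      of_int (kronecker_prime (det A) p) * (gauss_sum b p / of_int p) ^ card K"
    if A: "block_on K A" "transpose A = A" "\<not> p dvd det A" and i: "i \<in> K" "\<not> p dvd A $ i $ i"
    for A :: "int ^ 'n ^ 'n" and i
  proof -
    \<comment> \<open>With d = A_ii the equation A_ii U_ij = d A_ij is solved by U_ij =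
      A_ij.\<close>
    define U :: "int ^ 'n ^ 'n" where "U = (\<chi> l j. if l = i \<and> j \<in> K - {i} then A $ l $ j else 0)"
    have det: "det (block {i} A) = A $ i $ i"
      using det_block_on_singleton[OF block_on_block[of "{i}" A]] by (simp add: block_def)
    obtain B where B: "block_on (K - {i}) B" "transpose B = B" "\<not> p dvd det B"
      "kronecker_prime (det A) p = kronecker_prime (A $ i $ i) p * kronecker_prime (det B) p"
      "mean p (\<lambda>v. f (form_on K A v)) = mean p (\<lambda>v. f (form_on {i} A v)) * mean p (\<lambda>v. f (form_on (K - {i}) B v))"
    proof (rule split_off_block[OF p(1) A _ det i(2) _ _ f per])
      show "{i} \<subseteq> K" using i by simp
      show "U $ l $ j = 0" if "\<not> (l \<in> {i} \<and> j \<in> K - {i})" for l j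
        using that by (auto simp: U_def)
      show "(\<Sum>l\<in>{i}. A $ k $ l * U $ l $ j) = A $ i $ i * A $ k $ j" if "k \<in> {i}" "j \<in> K - {i}" for k j
        using that by (simp add: U_def)
    qed blast
    have card: "n = card (K - {i})" "card K = Suc (card (K - {i}))"
      using Suc.hyps(2) i by simp_all
    have "mean p (\<lambda>v. f (form_on {i} A v)) = mean p (\<lambda>v. ec p (b * A $ i $ i * (v $ i)\<^sup>2))"
      by (simp add: f_def form_on_def power2_eq_square mult_ac)
    also have "\<dots> = gauss_sum (b * A $ i $ i) p / of_int p"
      using p0 by (simp add: mean_coord[where f = "\<lambda>x. ec p (b * A $ i $ i * x\<^sup>2)"] gauss_sum_def)
    also have "\<dots> = of_int (kronecker_prime (A $ i $ i) p) * (gauss_sum b p / of_int p)"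
      using gauss_sum_prime[OF p i(2) b] by simp
    finally show ?thesis
      using Suc.hyps(1)[OF card(1) B(1-3)] unfolding B(4,5) card(2) by (simp add: f_def mult_ac)
  qed
  have "mean p (\<lambda>v. f (form_on K A v)) =
      of_int (kronecker_prime (det A) p) * (gauss_sum b p / of_int p) ^ card K"
  proof (cases "\<exists>i\<in>K. \<not> p dvd A $ i $ i")
    case True
    then show ?thesis using diagonal Suc.prems by blast
  next
    case False
    obtain i where i: "i \<in> K" using Suc.hyps(2) by (metis card.empty nat.distinct(1) ex_in_conv)
    then obtain j where j: "j \<in> K" "\<not> p dvd A $ j $ i"
      using exists_entry_not_dvd[OF p(1) Suc.prems(3,1)] by blast
    then have "i \<noteq> j" using False by auto
    \<comment> \<open>Replacing e_i by e_i + e_j makes the diagonal entry A_ii + A_jj + 2 A_ji, a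
      unit modulo \<open>p\<close> because \<open>p\<close> divides the first two terms but not the
      third.\<close>
    define P :: "int ^ 'n ^ 'n" where "P = (\<chi> k l. of_bool (k = l) + of_bool (k = j \<and> l = i))"
    define P' :: "int ^ 'n ^ 'n" where "P' = (\<chi> k l. of_bool (k = l) - of_bool (k = j \<and> l = i))"
    have P: "block_on K P" using i j \<open>i \<noteq> j\<close> by (auto simp: block_on_def P_def)
    have PP: "P ** P' = mat 1"
    proof -
      have "(P ** P') $ k $ l = of_bool (k = l)" for k l
      proof -
        have "(P ** P') $ k $ l = (\<Sum>m\<in>UNIV. (if m = k then of_bool (m = l) - of_bool (m = j \<and> l = i) else 0)
            + (if m = i then of_bool (k = j \<and> m = l) else 0))"
          unfolding matrix_matrix_mult_def vec_lambda_beta P_def P'_def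
          using \<open>i \<noteq> j\<close> by (intro sum.cong refl) auto
        then show ?thesis by (auto simp: sum.distrib)
      qed
      then show ?thesis by (simp add: vec_eq_iff mat_def of_bool_def)
    qed
    define A' where "A' = transpose P ** A ** P"
    note tr = transform_mod_prime[OF p(1) not_prime_dvd_1[OF p(1)] PP P Suc.prems(1,3) per, folded A'_def]
    have A': "block_on K A'" "transpose A' = A'"
      unfolding A'_def using P Suc.prems by (auto intro!: block_on_mult block_on_transpose transpose_congruence)
    have Pa: "P *v axis i 1 = axis i 1 + axis j 1"
      using \<open>i \<noteq> j\<close> by (auto simp: vec_eq_iff matrix_vector_mult_def P_def axis_def if_distrib[of "\<lambda>x. _ * x"] cong: if_cong)
    have outside: "(\<Sum>k\<in>- K. ((axis i 1 + axis j 1 :: int ^ 'n) $ k)\<^sup>2) = 0"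
      using i j by (intro sum.neutral) (auto simp: axis_def)
    have col: "(A *v axis k 1) $ l = A $ l $ k" for k l
      by (simp add: matrix_vector_mult_def axis_def if_distrib[of "\<lambda>x. _ * x"] cong: if_cong)
    have "A' $ i $ i = form_on K A' (axis i 1)" using i by (simp add: form_on_axis)
    also have "\<dots> = form_on K A (axis i 1 + axis j 1)"
      using P Suc.prems(1) by (simp add: A'_def form_on_transform Pa)
    also have "\<dots> = dot (axis i 1 + axis j 1) (A *v (axis i 1 + axis j 1))"
      using dot_eq_form_on[OF Suc.prems(1), of "axis i 1 + axis j 1"] outside by simp
    also have "\<dots> = A $ i $ i + A $ j $ j + 2 * A $ j $ i"
      using transpose_eqD[OF Suc.prems(2), of i j]
      by (simp add: matrix_vector_right_distrib dot_add_left dot_add_right col)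
    finally have A'ii: "A' $ i $ i = A $ i $ i + A $ j $ j + 2 * A $ j $ i" .
    have "\<not> p dvd 2 * A $ j $ i"
      using p j not_prime_dvd_2[OF p] by (simp add: prime_dvd_mult_iff)
    moreover have "p dvd A $ i $ i + A $ j $ j" using False i j by simp
    ultimately have "\<not> p dvd A' $ i $ i"
      unfolding A'ii by (simp add: dvd_add_right_iff)
    then have "mean p (\<lambda>v. f (form_on K A' v)) =
        of_int (kronecker_prime (det A') p) * (gauss_sum b p / of_int p) ^ card K"
      using diagonal[OF A' tr(1) i] by blast
    then show ?thesis unfolding tr(2,3) .
  qed
  then show ?case by (simp add: f_def)
qed

text \<open>Even values make the diagonal even, so no single index splits off; but an odd entry
  \<open>y\<close> gives a binary block of odd determinant x z - y^2. Each block has mean 1/2 or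
  -1/2, and removing two indices at a time shows that the size is even.\<close>

lemma mean_form_2:
  fixes A :: "int ^ 'n ^ 'n"
  assumes "block_on K A" "transpose A = A" "odd (det A)" "\<And>v. even (form_on K A v)"
  shows "even (card K) \<and> mean 2 (\<lambda>v. ec 4 (form_on K A v)) =
    of_int (kronecker_prime (det A) 2) * (1 / of_real (sqrt 2)) ^ card K"
  using assms
proof (induction "card K" arbitrary: K A rule: less_induct)
  case less
  have p: "prime (2::int)" by simp
  show ?case
  proof (cases "K = {}")
    case True
    then have "A = mat 1" using less.prems by (simp add: block_on_empty)
    with True show ?thesis by (simp add: form_on_def)
  next
    case False
    then obtain e where e: "e \<in> K" by blast
    have "\<not> 2 dvd det A" using less.prems by simp
    then obtain g where g: "g \<in> K" "odd (A $ g $ e)"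
      using exists_entry_not_dvd[OF p _ less.prems(1) e] by blast
    have diag: "even (A $ i $ i)" if "i \<in> K" for i
      using less.prems(4)[of "axis i 1"] that by (simp add: form_on_axis)
    have "e \<noteq> g" using g diag by auto
    define x y z where "x = A $ e $ e" and "y = A $ e $ g" and "z = A $ g $ g"
    have y': "A $ g $ e = y" using transpose_eqD[OF less.prems(2)] by (simp add: y_def)
    have par: "even x" "odd y" "even z" using diag e g y' by (auto simp: x_def z_def)
    define d where "d = x * z - y * y"
    have "odd d" using par by (simp add: d_def)
    have det: "det (block {e, g} A) = d"
      using det_block_on_doubleton[OF block_on_block[of "{e, g}" A] \<open>e \<noteq> g\<close>] y'
      by (simp add: block_def d_def x_def y_def z_def)
    \<comment> \<open>The adjugate [[z, -y], [-y, x]] of the block, applied to the rows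
      \<open>e\<close> and \<open>g\<close> of \<open>A\<close>.\<close>
    define U :: "int ^ 'n ^ 'n" where "U = (\<chi> l j. if j \<in> K - {e, g} then
        (if l = e then z * A $ e $ j - y * A $ g $ j
         else if l = g then x * A $ g $ j - y * A $ e $ j else 0) else 0)"
    obtain B where B: "block_on (K - {e, g}) B" "transpose B = B" "\<not> 2 dvd det B"
      "kronecker_prime (det A) 2 = kronecker_prime d 2 * kronecker_prime (det B) 2"
      "mean 2 (\<lambda>v. ec 4 (form_on K A v)) = mean 2 (\<lambda>v. ec 4 (form_on {e, g} A v)) *
        mean 2 (\<lambda>v. ec 4 (form_on (K - {e, g}) B v))"
      "\<And>v. \<exists>w. form_on (K - {e, g}) B v = form_on K A w"
    proof (rule split_off_block[OF p less.prems(1,2) _ _ det, where U = U and f = "ec 4"])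
      show "\<not> 2 dvd det A" "\<not> 2 dvd d" using less.prems \<open>odd d\<close> by simp_all
      show "{e, g} \<subseteq> K" using e g by simp
      show "U $ l $ j = 0" if "\<not> (l \<in> {e, g} \<and> j \<in> K - {e, g})" for l j
        using that by (auto simp: U_def)
      show "(\<Sum>l\<in>{e, g}. A $ k $ l * U $ l $ j) = d * A $ k $ j" if "k \<in> {e, g}" "j \<in> K - {e, g}" for k j
      proof -
        have "A $ k $ e * (z * A $ e $ j - y * A $ g $ j) + A $ k $ g * (x * A $ g $ j - y * A $ e $ j) = d * A $ k $ j"
          using that(1) y' by (auto simp: x_def y_def z_def d_def algebra_simps)
        then show ?thesis using that(2) \<open>e \<noteq> g\<close> by (simp add: U_def)
      qed
      show "periodic 2 (\<lambda>v. ec 4 (form_on K A v))"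
        by (rule periodic_form_on_4[OF less.prems(1,2)])
    qed (use ec_add in blast)+
    have card: "card K = card (K - {e, g}) + 2"
    proof -
      have "card {e, g} = 2" using \<open>e \<noteq> g\<close> by simp
      moreover have "card {e, g} \<le> card K" using e g by (intro card_mono) auto
      ultimately show ?thesis using e g by (simp add: card_Diff_subset)
    qed
    have IH: "even (card (K - {e, g})) \<and> mean 2 (\<lambda>v. ec 4 (form_on (K - {e, g}) B v)) =
        of_int (kronecker_prime (det B) 2) * (1 / of_real (sqrt 2)) ^ card (K - {e, g})"
    proof (rule less.hyps)
      show "even (form_on (K - {e, g}) B v)" for v using B(6) less.prems(4) by metis
    qed (use card B in auto)
    obtain a where a: "x = 2 * a" using par by blast
    obtain c where c: "z = 2 * c" using par by blast
    have "form_on {e, g} A v = x * (v $ e)\<^sup>2 + 2 * y * (v $ e) * (v $ g) + z * (v $ g)\<^sup>2" for v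
      using \<open>e \<noteq> g\<close> y' by (simp add: form_on_def x_def y_def z_def power2_eq_square algebra_simps)
    then have "mean 2 (\<lambda>v. ec 4 (form_on {e, g} A v)) =
        mean 2 (\<lambda>v. ec 4 (x * (v $ e)\<^sup>2 + 2 * y * (v $ e) * (v $ g) + z * (v $ g)\<^sup>2))" by simp
    also have "\<dots> = (\<Sum>s\<in>{0..<2}. \<Sum>t\<in>{0..<2}. ec 4 (x * s\<^sup>2 + 2 * y * s * t + z * t\<^sup>2)) / of_int 2 ^ 2"
      using \<open>e \<noteq> g\<close> by (intro mean_coord2[where f = "\<lambda>s t. ec 4 (x * s\<^sup>2 + 2 * y * s * t + z * t\<^sup>2)"]) auto
    also have "\<dots> = (1 + ec 4 z + ec 4 x + ec 4 (x + 2 * y + z)) / 4"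
    proof -
      have "{0..<2::int} = {0, 1}" by auto
      then show ?thesis by simp
    qed
    also have "\<dots> = of_int (kronecker_prime d 2) / 2"
    proof -
      have sgn: "ec 4 (2 * m) = (if even m then 1 else -1)" for m
      proof (cases "even m")
        case True
        then have "4 dvd 2 * m" by (auto elim!: evenE)
        then show ?thesis using True ec_eq_1_iff[of 4 "2 * m"] by simp
      next
        case False
        then have "[2 * m = 2] (mod 4)" by (auto elim!: oddE simp: cong_iff_dvd_diff)
        then have "ec 4 (2 * m) = ec 4 2" by (rule ec_cong)
        then show ?thesis using False by (simp add: ec_def)
      qed
      \<comment> \<open>Odd squares are 1 modulo 8, so \<open>d\<close> is 4 a c - 1 modulo 8: 3 if
        \<open>a\<close> and \<open>c\<close> are both odd, otherwise 7.\<close>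
      have kr: "kronecker_prime d 2 = (if odd a \<and> odd c then -1 else 1)"
      proof -
        have "8 dvd 1 - y\<^sup>2" using par(2) by (rule eight_dvd_one_minus_square)
        then obtain q where "1 - y\<^sup>2 = 8 * q" by (elim dvdE)
        then have q: "y * y = 1 - 8 * q" by (simp add: power2_eq_square)
        have d8: "d = 4 * (a * c) - 1 + 8 * q" by (simp add: d_def q a c)
        show ?thesis
        proof (cases "odd a \<and> odd c")
          case True
          then obtain m where "a * c = 2 * m + 1" by (meson even_mult_iff oddE)
          then have "d mod 8 = 3" unfolding d8 by presburger
          then show ?thesis using True \<open>odd d\<close> by (simp add: kronecker_prime_def)
        next
          case False
          then obtain m where "a * c = 2 * m" by (meson even_mult_iff evenE)
          then have "d mod 8 = 7" unfolding d8 by presburger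
          then show ?thesis using False \<open>odd d\<close> by (auto simp: kronecker_prime_def)
        qed
      qed
      have s: "x + 2 * y + z = 2 * (a + y + c)" by (simp add: a c)
      \<comment> \<open>As \<open>y\<close> is odd, the numerator is 1 + (-1)^c + (-1)^a - (-1)^(a +
        c), which is -2 if \<open>a\<close> and \<open>c\<close> are both odd and 2
        otherwise.\<close>
      show ?thesis unfolding s unfolding a c sgn kr using par(2) by auto
    qed
    also have "\<dots> = of_int (kronecker_prime d 2) * (1 / of_real (sqrt 2)) ^ 2"
      by (simp add: power_divide flip: of_real_power)
    finally have block: "mean 2 (\<lambda>v. ec 4 (form_on {e, g} A v)) =
        of_int (kronecker_prime d 2) * (1 / of_real (sqrt 2)) ^ 2" .
    show ?thesis
    proof
      show "even (card K)" using IH by (simp add: card)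
      show "mean 2 (\<lambda>v. ec 4 (form_on K A v)) =
          of_int (kronecker_prime (det A) 2) * (1 / of_real (sqrt 2)) ^ card K"
        unfolding B(4,5) card block conjunct2[OF IH] power_add by (simp only: of_int_mult mult_ac)
    qed
  qed
qed

lemma form_on_UNIV: "form_on UNIV A v = dot v (A *v v)"
  using dot_eq_form_on[of UNIV A v] by (simp add: block_on_def)

text \<open>Modulo \<open>p\<close> halving is multiplication by h = (p + 1) / 2. Multiplying a h by
  the square 4 gives 2 a, which explains the multiplier on the right.\<close>

lemma gsum_odd_prime:
  fixes A :: "int ^ 'n ^ 'n"
  assumes p: "prime p" "odd p" and A: "even_sym A" and "\<not> p dvd a" "\<not> p dvd det A"
  shows "gsum A a p = of_int (kronecker_prime (det A) p) * gauss_sum (2 * a) p ^ CARD('n)"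
proof -
  note p0 = prime_gt_0_int[OF p(1)]
  obtain h where h: "p + 1 = 2 * h" using p(2) by (metis evenE even_plus_one_iff)
  have h1: "[2 * h = 1] (mod p)" unfolding h[symmetric] by (simp add: cong_iff_dvd_diff)
  then have ph: "\<not> p dvd h" "\<not> p dvd 2"
    using not_prime_dvd_1[OF p(1)] cong_dvd_iff[OF h1] by (metis dvd_mult, metis dvd_mult2)
  have "ec p (a * quad A v) = ec p (a * h * form_on UNIV A v)" for v
  proof (rule ec_cong)
    have "[2 * h * (a * quad A v) = 1 * (a * quad A v)] (mod p)" using h1 by (intro cong_mult) auto
    then show "[a * quad A v = a * h * form_on UNIV A v] (mod p)"
      using two_quad[OF A, of v] by (simp add: form_on_UNIV cong_sym_eq mult_ac)
  qed
  then have "gsum A a p = mean p (\<lambda>v. ec p (a * h * form_on UNIV A v)) * of_int p ^ CARD('n)"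
    using p0 by (simp add: gsum_def mean_def)
  also have "\<dots> = of_int (kronecker_prime (det A) p) * gauss_sum (a * h) p ^ CARD('n)"
    using assms ph p0 by (subst mean_form_odd_prime[OF p])
      (auto simp: block_on_def even_sym_def prime_dvd_mult_iff power_divide)
  also have "gauss_sum (a * h) p = gauss_sum (2 * a) p"
  proof -
    have "coprime 2 p" using p ph(2) by (simp add: coprime_left_2_iff_odd)
    then have "gauss_sum (a * h) p = gauss_sum (a * h * 2\<^sup>2) p"
      using gauss_sum_mult_square[OF p0, of 2 "a * h"] by (simp only:)
    also have "[2 * a * (2 * h) = 2 * a * 1] (mod p)" using h1 by (intro cong_mult) auto
    then have "gauss_sum (a * h * 2\<^sup>2) p = gauss_sum (2 * a) p"
      by (intro gauss_sum_cong) (simp add: mult_ac)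
    finally show ?thesis .
  qed
  finally show ?thesis .
qed

text \<open>An odd multiplier is invisible modulo 2, and e(Q / 2) = e(2 Q / 4) leads to the mean
  modulo 4. The parity of the dimension comes from the same splitting into binary blocks.\<close>

lemma gsum_2:
  fixes A :: "int ^ 'n ^ 'n"
  assumes A: "even_sym A" and "odd a" "odd (det A)"
  shows "even CARD('n)" and
    "gsum A a 2 = of_int (kronecker_prime (det A) 2) * of_real (sqrt 2) ^ CARD('n)"
proof -
  have m: "even (card (UNIV :: 'n set)) \<and> mean 2 (\<lambda>v. ec 4 (form_on UNIV A v)) =
    of_int (kronecker_prime (det A) 2) * (1 / of_real (sqrt 2)) ^ card (UNIV :: 'n set)"
    using assms even_dot_even_sym[OF A]
    by (intro mean_form_2) (auto simp: block_on_def even_sym_def form_on_UNIV)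
  then show "even CARD('n)" by simp
  have "ec 2 (a * quad A v) = ec 4 (form_on UNIV A v)" for v
  proof -
    have "ec 2 (a * quad A v) = ec 2 (quad A v)"
      using assms(2) by (intro ec_cong) (auto simp: cong_iff_dvd_diff)
    also have "\<dots> = ec (2 * 2) (2 * quad A v)" by (rule ec_cancel[symmetric]) simp
    finally show ?thesis by (simp add: two_quad[OF A] form_on_UNIV)
  qed
  then have "gsum A a 2 = mean 2 (\<lambda>v. ec 4 (form_on UNIV A v)) * 2 ^ CARD('n)"
    by (simp add: gsum_def mean_def)
  also have "\<dots> = of_int (kronecker_prime (det A) 2) * (2 / of_real (sqrt 2)) ^ CARD('n)"
    using m by (simp add: power_divide)
  also have "2 / complex_of_real (sqrt 2) = of_real (sqrt 2)"
    using real_sqrt_mult_self[of 2] by (simp add: field_simps flip: of_real_mult)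
  finally show "gsum A a 2 = of_int (kronecker_prime (det A) 2) * of_real (sqrt 2) ^ CARD('n)" .
qed

section \<open>Evaluation of the Gauss sum of a form\<close>

lemma gsum_odd:
  fixes A :: "int ^ 'n ^ 'n"
  assumes A: "even_sym A" and "c > 0"
  shows "odd c \<Longrightarrow> coprime a c \<Longrightarrow> coprime (det A) c \<Longrightarrow>
    gsum A a c = of_int (kronecker (det A) c) * gauss_sum (2 * a) c ^ CARD('n)"
  using assms(2)
proof (induction c arbitrary: a rule: square_prime_induct)
  case (square p c)
  have p: "odd p" "\<not> p dvd a" "\<not> p dvd det A"
    using square.prems square.hyps not_prime_unit by (auto simp: coprime_def)
  have "\<not> p dvd 2 * a"
    using p square.hyps not_prime_dvd_2 by (simp add: prime_dvd_mult_iff)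
  then show ?case
    using square p by (simp add: gauss_sum_square gsum_square[OF A] kronecker_square_times power_mult_distrib)
next
  case (prime p c)
  have p: "odd p" "coprime a p" "\<not> p dvd a" "\<not> p dvd det A" "\<not> p dvd c"
    using prime.prems prime.hyps not_prime_unit by (auto simp: coprime_def)
  have c: "odd c" "coprime a c" "coprime (det A) c" "coprime p c"
    using prime by auto
  have p0: "p > 0" using prime.hyps by (simp add: prime_gt_0_int)
  have "gsum A a (p * c) = gsum A (a * c) p * gsum A (a * p) c"
    by (rule gsum_coprime[OF A p0 prime.hyps(2,3)])
  also have "gsum A (a * c) p = of_int (kronecker_prime (det A) p) * gauss_sum (2 * (a * c)) p ^ CARD('n)"
    using p prime.hyps by (intro gsum_odd_prime A) (auto simp: prime_dvd_mult_iff)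
  also have "gsum A (a * p) c = of_int (kronecker (det A) c) * gauss_sum (2 * (a * p)) c ^ CARD('n)"
    using c by (intro prime.IH) auto
  finally show ?case
    unfolding gauss_sum_coprime[OF p0 prime.hyps(2,3), of "2 * a"]
      kronecker_prime_times[OF prime.hyps(1,2), of "det A"] power_mult_distrib
    by (simp only: of_int_mult mult_ac)
qed simp

lemma gsum_power_2:
  fixes A :: "int ^ 'n ^ 'n"
  assumes A: "even_sym A" and "odd a" "odd (det A)"
  shows "gsum A a (2 ^ k) = of_int (kronecker (det A) (2 ^ k)) * of_real (sqrt 2 ^ k) ^ CARD('n)"
proof (induction k rule: nat_induct2)
  case 1
  show ?case
    using gsum_2(2)[OF assms] kronecker_prime_times[of 2 1 "det A"] by simp
next
  case (step k)
  have two: "(2::int) ^ (k + 2) = 2\<^sup>2 * 2 ^ k" by (simp add: power_add)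
  have g: "gsum A a (2 ^ (k + 2)) = 2 ^ CARD('n) * gsum A a (2 ^ k)"
    unfolding two using gsum_square[OF A, of 2 "2 ^ k" a] assms by simp
  have kr: "kronecker (det A) (2 ^ (k + 2)) = kronecker (det A) (2 ^ k)"
    unfolding two using assms by (intro kronecker_square_times) auto
  have rt: "complex_of_real (sqrt 2 ^ (k + 2)) = 2 * of_real (sqrt 2 ^ k)"
  proof -
    have "sqrt 2 ^ (k + 2) = 2 * sqrt 2 ^ k" by (simp add: power_add)
    then show ?thesis by (simp only: of_real_mult of_real_numeral)
  qed
  show ?case unfolding g step kr rt power_mult_distrib by (simp only: mult_ac)
qed simp

lemma kronecker_power_2_times:
  "c > 0 \<Longrightarrow> kronecker a (2 ^ k * c) = kronecker a (2 ^ k) * kronecker a c"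
proof (induction k)
  case (Suc k)
  have "kronecker a (2 * (2 ^ k * c)) = kronecker_prime a 2 * kronecker a (2 ^ k * c)"
    using Suc.prems by (intro kronecker_prime_times) auto
  moreover have "kronecker a (2 * 2 ^ k) = kronecker_prime a 2 * kronecker a (2 ^ k)"
    by (intro kronecker_prime_times) auto
  ultimately show ?case using Suc by (simp add: mult.assoc)
qed simp

lemma kronecker_cases:
  assumes "c > 0" shows "coprime a c \<Longrightarrow> kronecker a c = 1 \<or> kronecker a c = -1"
  using assms
proof (induction c rule: square_prime_induct)
  case (square p c)
  then have "\<not> p dvd a" using not_prime_unit by (auto simp: coprime_def)
  then show ?case using square by (simp add: kronecker_square_times)
next
  case (prime p c)
  then have "\<not> p dvd a" using not_prime_unit by (auto simp: coprime_def)
  then show ?case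
    using prime kronecker_prime_cases[of p a] by (auto simp: kronecker_prime_times)
qed simp

lemma kronecker_even_power:
  assumes "c > 0" "coprime a c" "even n" shows "(of_int (kronecker a c) :: complex) ^ n = 1"
  using kronecker_cases[OF assms(1,2)] assms(3) by auto

text \<open>The symbol is taken at the absolute value of \<open>a\<close>; a negative
  \<open>a\<close> conjugates the sum, which only reverses the phase.\<close>

lemma gauss_sum_double:
  assumes c: "c > 0" "odd c" and a: "a \<noteq> 0" "coprime a c"
  shows "gauss_sum (2 * a) c = of_real (sqrt (of_int c)) * of_int (kronecker \<bar>a\<bar> c) *
    cis (2 * pi * (of_int (sgn a) * (1 - of_int c) / 8))"
proof -
  have "coprime 2 c" using c by (simp add: coprime_left_2_iff_odd)
  then have abs: "gauss_sum (2 * \<bar>a\<bar>) c = of_int (kronecker \<bar>a\<bar> c) * gauss_sum 2 c"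
    using c a by (intro gauss_sum_kronecker) auto
  show ?thesis
  proof (cases "a > 0")
    case True
    then have ang: "2 * pi * (of_int (sgn a) * (1 - of_int c) / 8) = 2 * pi * (1 - of_int c) / 8" by simp
    have "gauss_sum (2 * a) c = gauss_sum (2 * \<bar>a\<bar>) c" using True by simp
    then show ?thesis unfolding abs gauss_sum_2[OF c] ang by (simp only: mult_ac)
  next
    case False
    then have sgn: "sgn a = -1" and "2 * a = - (2 * \<bar>a\<bar>)" using a by auto
    then have "gauss_sum (2 * a) c = cnj (gauss_sum (2 * \<bar>a\<bar>) c)"
      by (simp only: gauss_sum_uminus)
    moreover have ang: "2 * pi * (of_int (sgn a) * (1 - of_int c) / 8) = - (2 * pi * (1 - of_int c) / 8)"
      by (simp add: sgn field_simps)
    ultimately show ?thesis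
      unfolding abs gauss_sum_2[OF c] ang cis_cnj[symmetric]
      by (simp only: complex_cnj_mult complex_cnj_of_int complex_cnj_complex_of_real mult_ac)
  qed
qed

text \<open>For even \<open>c\<close> the dimension is even. Its power then removes the symbol of
  2^k at \<open>c0\<close> left over by the coprime splitting, as well as the symbols of the
  absolute value of \<open>a\<close> at \<open>c0\<close> and \<open>c\<close>, and the power of 2
  contributes no phase.\<close>

lemma gsum_eval:
  fixes A :: "int ^ 'n ^ 'n"
  assumes A: "even_sym A" and c: "c = 2 ^ k * c0" "odd c0" "c > 0"
    and a: "a \<noteq> 0" "coprime a c" and det: "coprime (det A) c"
  shows "gsum A a c = of_real (sqrt (of_int c)) ^ CARD('n) * of_int (kronecker \<bar>a\<bar> c) ^ CARD('n) *
    of_int (kronecker (det A) c) * cis (2 * pi * (of_int (sgn a) * (1 - of_int c0) / 8)) ^ CARD('n)"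
proof -
  have c0: "c0 > 0" using c(1,3) by (simp add: zero_less_mult_iff)
  have cop0: "coprime a c0" "coprime (det A) c0" using a det c(1) by auto
  show ?thesis
  proof (cases "k = 0")
    case True
    then have "c = c0" using c by simp
    then show ?thesis
      using gsum_odd[OF A c0 c(2) cop0] gauss_sum_double[OF c0 c(2) a(1) cop0(1)]
      by (simp add: power_mult_distrib mult_ac)
  next
    case False
    then have "coprime a 2" "coprime (det A) 2" using a det c(1) by auto
    then have odd: "odd a" "odd (det A)" by (simp_all add: coprime_right_2_iff_odd)
    have n: "even CARD('n)" using gsum_2(1)[OF A odd] .
    have cop: "coprime (2 ^ k) c0" using c(2) by (simp add: coprime_left_2_iff_odd)
    have "gsum A a c = gsum A (a * c0) (2 ^ k) * gsum A (a * 2 ^ k) c0"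
      unfolding c(1) by (rule gsum_coprime[OF A _ c0 cop]) simp
    also have "gsum A (a * c0) (2 ^ k) = of_int (kronecker (det A) (2 ^ k)) * of_real (sqrt 2 ^ k) ^ CARD('n)"
      using odd c(2) by (intro gsum_power_2[OF A]) auto
    also have "gsum A (a * 2 ^ k) c0 = of_int (kronecker (det A) c0) * gauss_sum (2 * (a * 2 ^ k)) c0 ^ CARD('n)"
      using cop0 cop by (intro gsum_odd[OF A c0 c(2)]) auto
    also have "gauss_sum (2 * (a * 2 ^ k)) c0 = of_int (kronecker (2 ^ k) c0) * gauss_sum (2 * a) c0"
      using gauss_sum_kronecker[OF c0 c(2), of "2 ^ k" "2 * a"] cop cop0 c(2)
      by (simp add: coprime_left_2_iff_odd mult_ac)
    also have "gauss_sum (2 * a) c0 = of_real (sqrt (of_int c0)) * of_int (kronecker \<bar>a\<bar> c0) *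
        cis (2 * pi * (of_int (sgn a) * (1 - of_int c0) / 8))"
      by (rule gauss_sum_double[OF c0 c(2) a(1) cop0(1)])
    also have "of_real (sqrt (of_int c)) = (of_real (sqrt 2 ^ k) * of_real (sqrt (of_int c0)) :: complex)"
      unfolding c(1) by (simp add: real_sqrt_mult real_sqrt_power)
    moreover have "kronecker (det A) c = kronecker (det A) (2 ^ k) * kronecker (det A) c0"
      unfolding c(1) using c0 by (rule kronecker_power_2_times)
    ultimately show ?thesis
      using kronecker_even_power[OF c0 cop n] kronecker_even_power[OF c(3), of "\<bar>a\<bar>", OF _ n]
        kronecker_even_power[OF c0, of "\<bar>a\<bar>", OF _ n] a cop0
      by (simp add: power_mult_distrib mult_ac)
  qed
qed

text \<open>\<open>b\<close> is minus the inverse of a N modulo \<open>c\<close> and A B = N, so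
  shifting \<open>v\<close> by b B l adds a b N times \<open>dot v l\<close> and kills the linear
  term. The constants -b Q_B(l) and 2 b Q_B(l) add up to b Q_B(l), where Q_B is
  \<open>quad B\<close>.\<close>

lemma sum_complete_square:
  fixes A B :: "int ^ 'n ^ 'n"
  assumes A: "even_sym A" and B: "even_sym B" "A ** B = mat N" and "c > 0"
    and b: "[b * a * N = - 1] (mod c)"
  shows "(\<Sum>v\<in>rbox c. ec c (a * quad A v + dot v l)) = ec c (b * quad B l) * gsum A a c"
proof -
  define y where "y = B *v l"
  have Ay: "A *v y = N *s l"
    by (simp add: y_def matrix_vector_mul_assoc B(2) mat_vector)
  have yl: "dot y l = 2 * quad B l"
    using two_quad[OF B(1), of l] by (simp add: y_def dot_commute)
  have "2 * quad A y = 2 * (N * quad B l)"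
    by (simp add: two_quad[OF A] Ay dot_scale_right yl)
  then have qy: "quad A y = N * quad B l" by simp
  have "(\<Sum>v\<in>rbox c. ec c (a * quad A v + dot v l)) =
      (\<Sum>v\<in>rbox c. ec c (a * quad A (v + b *s y) + dot (v + b *s y) l))"
  proof (rule sum_rbox_reindex[symmetric, OF assms(4)])
    show "periodic c (\<lambda>v. ec c (a * quad A v + dot v l))"
      by (auto simp: periodic_def intro!: ec_cong cong_add cong_mult quad_cong[OF A] dot_cong)
        (simp add: vcong_def)
  qed (auto simp: vcong_def cong_add_rcancel)
  also have "\<dots> = (\<Sum>v\<in>rbox c. ec c (b * quad B l + a * quad A v))"
  proof (intro sum.cong refl ec_cong)
    fix v :: "int ^ 'n"
    have "a * quad A (v + b *s y) + dot (v + b *s y) l =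
        a * quad A v + (b * a * N) * (dot v l + b * quad B l) + dot v l + 2 * (b * quad B l)"
      unfolding quad_add[OF A] quad_scale[OF A] matrix_vector_scale Ay qy dot_add_left dot_scale_left
        dot_scale_right yl by (simp add: power2_eq_square algebra_simps)
    also have "[\<dots> = a * quad A v + (- 1) * (dot v l + b * quad B l) + dot v l + 2 * (b * quad B l)] (mod c)"
      using b by (intro cong_add cong_mult) auto
    finally show "[a * quad A (v + b *s y) + dot (v + b *s y) l = b * quad B l + a * quad A v] (mod c)"
      by (simp add: algebra_simps)
  qed
  finally show ?thesis by (simp add: ec_add gsum_def sum_distrib_left)
qed

lemma sum_hyperplane:
  fixes f :: "int ^ 'n \<Rightarrow> complex"
  assumes "c > 0"
  shows "(\<Sum>v\<in>{v \<in> rbox c. c dvd dot v h}. f v) =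
    (\<Sum>t\<in>{0..<c}. \<Sum>v\<in>rbox c. f v * ec c (dot v (t *s h))) / of_int c"
proof -
  have "(\<Sum>v\<in>{v \<in> rbox c. c dvd dot v h}. f v) = (\<Sum>v\<in>rbox c. if c dvd dot v h then f v else 0)"
    by (simp add: sum.If_cases Collect_conj_eq Int_commute)
  also have "\<dots> = (\<Sum>v\<in>rbox c. f v * (\<Sum>t\<in>{0..<c}. ec c (dot v h * t)) / of_int c)"
    using assms by (intro sum.cong refl) (simp add: sum_ec)
  also have "\<dots> = (\<Sum>v\<in>rbox c. \<Sum>t\<in>{0..<c}. f v * ec c (dot v (t *s h))) / of_int c"
    by (simp add: sum_divide_distrib sum_distrib_left dot_scale_right mult.commute[of "dot _ _"])
  finally show ?thesis by (subst sum.swap)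
qed

text \<open>\<open>m\<close> will be \<open>G w\<close>, so the linear term is the effect of the
  shift by \<open>w\<close>. Completing the square at the frequency a m + t h separates a factor
  depending on \<open>m\<close> alone from a quadratic polynomial in \<open>t\<close>.\<close>

lemma sum_quadratic_hyperplane:
  fixes A B :: "int ^ 'n ^ 'n"
  assumes A: "even_sym A" and B: "even_sym B" "A ** B = mat N" and c: "c > 0"
    and b: "[b * a * N = - 1] (mod c)"
  shows "(\<Sum>v\<in>{v \<in> rbox c. c dvd dot v h}. ec c (a * quad A v + dot v (a *s m))) =
    gsum A a c * ec c (b * a\<^sup>2 * quad B m) *
      ((\<Sum>t\<in>{0..<c}. ec c (b * quad B h * t\<^sup>2 + b * a * dot m (B *v h) * t)) / of_int c)"
proof -
  have "(\<Sum>v\<in>{v \<in> rbox c. c dvd dot v h}. ec c (a * quad A v + dot v (a *s m))) =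
    (\<Sum>t\<in>{0..<c}. \<Sum>v\<in>rbox c. ec c (a * quad A v + dot v (a *s m)) * ec c (dot v (t *s h))) / of_int c"
    by (rule sum_hyperplane[OF c])
  also have "\<dots> = (\<Sum>t\<in>{0..<c}. \<Sum>v\<in>rbox c. ec c (a * quad A v + dot v (a *s m + t *s h))) / of_int c"
    by (simp add: dot_add_right add.assoc flip: ec_add)
  also have "\<dots> = (\<Sum>t\<in>{0..<c}. ec c (b * quad B (a *s m + t *s h)) * gsum A a c) / of_int c"
    unfolding sum_complete_square[OF A B c b] ..
  also have "\<dots> = (\<Sum>t\<in>{0..<c}. gsum A a c * ec c (b * a\<^sup>2 * quad B m) *
      ec c (b * quad B h * t\<^sup>2 + b * a * dot m (B *v h) * t)) / of_int c"
  proof (intro arg_cong2[where f = "(/)"] sum.cong refl)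
    fix t
    have "b * quad B (a *s m + t *s h) = b * a\<^sup>2 * quad B m + (b * quad B h * t\<^sup>2 + b * a * dot m (B *v h) * t)"
      unfolding quad_add[OF B(1)] quad_scale[OF B(1)] matrix_vector_scale dot_scale_left dot_scale_right
      by (simp add: algebra_simps)
    then show "ec c (b * quad B (a *s m + t *s h)) * gsum A a c = gsum A a c * ec c (b * a\<^sup>2 * quad B m) *
        ec c (b * quad B h * t\<^sup>2 + b * a * dot m (B *v h) * t)"
      by (simp add: ec_add)
  qed
  finally show ?thesis by (simp add: sum_distrib_left)
qed

lemma sum_int_periodic:
  fixes f :: "int \<Rightarrow> complex"
  assumes "u > 0" "g > 0" and per: "\<And>x y. [x = y] (mod u) \<Longrightarrow> f x = f y"
  shows "(\<Sum>x\<in>{0..<u * g}. f x) = of_int g * (\<Sum>x\<in>{0..<u}. f x)"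
proof -
  have "(\<Sum>x\<in>{0..<u * g}. f x) = (\<Sum>x\<in>rbox u. \<Sum>y\<in>rbox g. f ((x + u *s y :: int ^ 1) $ 1))"
    unfolding sum_int_eq_rbox by (rule sum_rbox_mult[OF assms(1,2)])
  also have "\<dots> = (\<Sum>x\<in>rbox u. \<Sum>y :: int ^ 1\<in>rbox g. f ((x :: int ^ 1) $ 1))"
    by (intro sum.cong refl per) (simp add: cong_def)
  also have "\<dots> = of_int g * (\<Sum>x\<in>{0..<u}. f x)"
    using assms(2) by (simp add: card_rbox sum_int_eq_rbox sum_distrib_left)
  finally show ?thesis .
qed

section \<open>From real matrices to integer matrices; the level\<close>

lemma even_integral_symmetric:
  fixes M :: "real ^ 'n ^ 'n"
  assumes "even_integral M" "transpose M = M"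
  obtains A where "M = rmat A" "even_sym A"
proof -
  define A :: "int ^ 'n ^ 'n" where "A = (\<chi> i j. \<lfloor>M $ i $ j\<rfloor>)"
  have "real_of_int (A $ i $ j) = M $ i $ j" for i j
    using assms(1) by (simp add: A_def even_integral_def)
  then have M: "M = rmat A" by (simp add: rmat_def vec_eq_iff)
  have "transpose A = A"
    using transpose_eqD[OF assms(2)] by (simp add: A_def transpose_def vec_eq_iff)
  moreover have "even (A $ i $ i)" for i
  proof -
    obtain k :: int where "M $ i $ i = 2 * real_of_int k" using assms(1) unfolding even_integral_def by blast
    then have "M $ i $ i = real_of_int (2 * k)" by simp
    then have "A $ i $ i = 2 * k" by (simp only: A_def vec_lambda_beta floor_of_int)
    then show ?thesis by simp
  qed
  ultimately show thesis using that M by (auto simp: even_sym_def)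
qed

lemma transpose_matrix_inv:
  fixes G :: "real ^ 'n ^ 'n"
  assumes "invertible G" "transpose G = G" shows "transpose (matrix_inv G) = matrix_inv G"
proof -
  have "transpose (matrix_inv G) ** G = transpose (G ** matrix_inv G)"
    by (simp add: matrix_transpose_mul assms(2))
  then have "transpose (matrix_inv G) ** G = mat 1"
    by (simp add: matrix_inv_right[OF assms(1)] transpose_mat)
  then have "transpose (matrix_inv G) ** (G ** matrix_inv G) = matrix_inv G"
    by (simp add: matrix_mul_assoc)
  then show ?thesis by (simp add: matrix_inv_right[OF assms(1)])
qed

text \<open>The set whose least element is taken is not empty: \<open>det A\<close> times the
  inverse is integral and doubling makes its diagonal even, so twice the absolute value of
  \<open>det A\<close> belongs to it.\<close>

lemma level_even_integral:
  fixes A :: "int ^ 'n ^ 'n"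
  assumes "det A \<noteq> 0"
  shows "level (rmat A) > 0 \<and> even_integral (real (level (rmat A)) *\<^sub>R matrix_inv (rmat A))"
  unfolding level_def
proof (rule LeastI_ex)
  obtain B where B: "rmat B = real_of_int (det A) *\<^sub>R matrix_inv (rmat A)"
    using det_times_inverse_integral assms .
  have B': "real_of_int (B $ i $ j) = real_of_int (det A) * matrix_inv (rmat A) $ i $ j" for i j
    using arg_cong[OF B, of "\<lambda>M. M $ i $ j"] by (simp add: rmat_def)
  have entry: "(real (nat \<bar>2 * det A\<bar>) *\<^sub>R matrix_inv (rmat A)) $ i $ j = 2 * real_of_int (sgn (det A) * B $ i $ j)" for i j
  proof -
    have "\<bar>2 * det A\<bar> = 2 * sgn (det A) * det A" by (simp only: abs_mult abs_sgn[of "det A"]) simp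
    then have "real (nat \<bar>2 * det A\<bar>) = 2 * real_of_int (sgn (det A)) * real_of_int (det A)"
      by (metis abs_ge_zero of_int_mult of_int_numeral of_nat_nat)
    then show ?thesis by (simp add: B')
  qed
  have "even_integral (real (nat \<bar>2 * det A\<bar>) *\<^sub>R matrix_inv (rmat A))"
    unfolding even_integral_def entry by (auto intro: exI[of _ "sgn (det A) * B $ _ $ _"])
  then show "\<exists>N>0. even_integral (real N *\<^sub>R matrix_inv (rmat A))"
    using assms by (intro exI[of _ "nat \<bar>2 * det A\<bar>"]) simp
qed

lemma rcong_0_iff_dvd:
  assumes "c > 0"
  shows "[real_of_int x = 0] (rmod (real_of_int c)) \<longleftrightarrow> c dvd x"
proof -
  have "[real_of_int x = 0] (rmod (real_of_int c)) \<longleftrightarrow> frac (real_of_int x / real_of_int c) = 0"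
    using assms by (simp add: rcong_def rmod_conv_frac)
  also have "\<dots> \<longleftrightarrow> real_of_int x / real_of_int c \<in> \<int>"
    by (simp add: frac_eq_0_iff)
  also have "\<dots> \<longleftrightarrow> c dvd x"
  proof
    assume "real_of_int x / real_of_int c \<in> \<int>"
    then obtain k where "real_of_int x / real_of_int c = real_of_int k" by (auto elim: Ints_cases)
    then have "real_of_int x = real_of_int (c * k)" using assms by (simp add: field_simps)
    then show "c dvd x" by (metis dvd_triv_left of_int_eq_iff)
  next
    assume "c dvd x"
    then show "real_of_int x / real_of_int c \<in> \<int>" using assms by (auto elim!: dvdE)
  qed
  finally show ?thesis .
qed

lemma real_vec_inner: "real_vec x \<bullet> real_vec y = real_of_int (dot x y)"
  by (simp add: real_vec_def dot_def inner_vec_def)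

lemma inner_rmat:
  assumes "transpose A = A" shows "x \<bullet> (rmat A *v y) = (rmat A *v x) \<bullet> y"
proof -
  have "transpose (rmat A) = rmat A"
    using transpose_eqD[OF assms] by (simp add: rmat_def transpose_def vec_eq_iff)
  then show ?thesis using dot_lmul_matrix[of x "rmat A" y] by (metis transpose_matrix_vector)
qed

section \<open>The constrained sum\<close>

lemma residue_system_finite:
  fixes R :: "(int ^ 'n) set"
  assumes "c > 0" "residue_system c R"
  shows "finite R"
proof -
  have "inj_on (vmod c) R"
  proof (rule inj_onI)
    fix v w assume vw: "v \<in> R" "w \<in> R" "vmod c v = vmod c w"
    have "\<exists>!x. x \<in> R \<and> vcong c (vmod c v) x"
      using assms(2) by (auto simp: residue_system_def vcong_def)
    moreover have "vcong c (vmod c v) v" "vcong c (vmod c v) w"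
      using vcong_vmod[of c v] vcong_vmod[of c w] vw(3) by simp_all
    ultimately show "v = w" using vw by blast
  qed
  moreover have "vmod c ` R \<subseteq> rbox c" using vmod_in_rbox[OF assms(1)] by auto
  ultimately show ?thesis using finite_rbox by (metis finite_imageD finite_subset)
qed

lemma sum_residue_system_filter:
  fixes f :: "int ^ 'n \<Rightarrow> complex"
  assumes "c > 0" "residue_system c R" "periodic c f" "\<And>v w. vcong c v w \<Longrightarrow> P v = P w"
  shows "(\<Sum>v\<in>{v \<in> R. P v}. f v) = (\<Sum>v\<in>{v \<in> rbox c. P v}. f v)"
proof -
  have "(\<Sum>v\<in>{v \<in> R. P v}. f v) = (\<Sum>v\<in>R. if P v then f v else 0)"
    using residue_system_finite[OF assms(1,2)] by (rule sum.inter_filter)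
  also have "\<dots> = (\<Sum>v\<in>rbox c. if P v then f v else 0)"
  proof (rule sum_residue_system[OF assms(1,2)])
    show "periodic c (\<lambda>v. if P v then f v else 0)"
      using assms(3,4) unfolding periodic_def by metis
  qed
  also have "\<dots> = (\<Sum>v\<in>{v \<in> rbox c. P v}. f v)"
    by (rule sum.inter_filter[symmetric]) simp
  finally show ?thesis .
qed

lemma powr_half_nat:
  assumes "x > 0" shows "x powr (real n / 2) = sqrt x ^ n"
proof -
  have "sqrt x ^ n = (x powr (1 / 2)) powr real n"
    using assms by (simp add: powr_half_sqrt powr_realpow)
  then show ?thesis by (simp add: powr_powr)
qed

text \<open>For t = \<open>quad B m\<close> one has w^T G w = 2 t / N. The two exponents add up to a
  t (b a N + 1) / (c N); the bracket is c r, and \<open>r\<close> is inverse to \<open>c\<close>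
  modulo \<open>N\<close>, hence congruent to \<open>c'\<close>.\<close>

lemma ec_shift_phase:
  assumes "c > 0" "N > 0" "coprime c N"
    and cc: "[c * c' = 1] (mod N)" and b: "[b * a * N = - 1] (mod c)"
  shows "ec c (b * a\<^sup>2 * t) * cis (2 * pi * (of_int (a * t) / of_int (c * N))) =
    cis (2 * pi * (of_int (a * c' * t) / of_int N))"
proof -
  obtain r where r: "b * a * N + 1 = c * r"
    using b by (auto simp: cong_iff_dvd_diff elim!: dvdE)
  have "[c * r = 1] (mod N)" unfolding r[symmetric] by (simp add: cong_iff_dvd_diff)
  then have "[c * r = c * c'] (mod N)" using cc cong_trans cong_sym by blast
  then have "[r = c'] (mod N)" using assms(3) by (simp add: cong_mult_lcancel)
  then obtain s where s: "r = c' + N * s" by (rule int_congE)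
  have e: "b * a\<^sup>2 * t * N + a * t = c * (a * t * (c' + N * s))"
  proof -
    have "b * a\<^sup>2 * t * N + a * t = a * t * (b * a * N + 1)" by (simp add: power2_eq_square algebra_simps)
    then show ?thesis unfolding r s by (simp add: mult_ac)
  qed
  have "real_of_int (b * a\<^sup>2 * t) / of_int c + of_int (a * t) / of_int (c * N) =
      of_int (b * a\<^sup>2 * t * N + a * t) / of_int (c * N)"
    using assms by (simp add: field_simps)
  also have "\<dots> = of_int (a * c' * t) / of_int N + of_int (a * t * s)"
    unfolding e using assms by (simp add: field_simps)
  finally have "2 * pi * (real_of_int (b * a\<^sup>2 * t) / of_int c) + 2 * pi * (of_int (a * t) / of_int (c * N)) =
      2 * pi * (of_int (a * c' * t) / of_int N) + 2 * pi * of_int (a * t * s)"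
    by (simp only: ring_distribs[symmetric])
  then show ?thesis
    by (simp add: ec_def cis_mult) (simp add: cis_mult[symmetric])
qed

text \<open>This mean is \<open>C\<close>. If \<open>c\<close> divides \<open>q\<close>, a linear
  character remains, trivial exactly if \<open>c\<close> divides \<open>L\<close>. Otherwise g = c /
  u divides all entries of \<open>h\<close>, hence both \<open>q\<close> and \<open>L\<close>, and
  the summand has period \<open>u\<close>.\<close>

lemma linear_quadratic_mean:
  fixes B :: "int ^ 'n ^ 'n" and h m :: "int ^ 'n"
  assumes B: "even_sym B" and c: "c > 0" and b: "[b * a * N = - 1] (mod c)"
    and u: "u = c div gcd c (GCD i. h $ i)"
  defines "q \<equiv> quad B h" and "L \<equiv> dot m (B *v h)"
  shows "(\<Sum>t\<in>{0..<c}. ec c (b * q * t\<^sup>2 + b * a * L * t)) / of_int c =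
    (if c dvd q then if c dvd L then 1 else 0
     else (\<Sum>v\<in>{0..u - 1}. ec c (b * q * v\<^sup>2 - b * a * L * v)) / of_int u)"
proof (cases "c dvd q")
  case True
  have "(b * q * t\<^sup>2 + b * a * L * t) - (b * a * L) * t = q * (b * t\<^sup>2)" for t
    by (simp add: algebra_simps)
  then have "[b * q * t\<^sup>2 + b * a * L * t = (b * a * L) * t] (mod c)" for t
    unfolding cong_iff_dvd_diff using True by (metis dvd_mult2)
  then have "(\<Sum>t\<in>{0..<c}. ec c (b * q * t\<^sup>2 + b * a * L * t)) = (\<Sum>t\<in>{0..<c}. ec c ((b * a * L) * t))"
    by (intro sum.cong refl ec_cong)
  also have "\<dots> = (if c dvd b * a * L then of_int c else 0)"
    using c by (rule sum_ec)
  \<comment> \<open>Multiplication by \<open>N\<close> turns b a into -1 modulo \<open>c\<close>, so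
    b a is a unit.\<close>
  also have "c dvd b * a * L \<longleftrightarrow> c dvd L"
  proof
    assume "c dvd b * a * L"
    then have "c dvd b * a * L * N" by simp
    then have "c dvd (b * a * N) * L" by (simp add: mult_ac)
    moreover have "[(b * a * N) * L = (- 1) * L] (mod c)" using b by (rule cong_mult) simp
    ultimately show "c dvd L" using cong_dvd_iff by fastforce
  qed simp
  finally show ?thesis using True c by simp
next
  case False
  define g where "g = gcd c (GCD i. h $ i)"
  define F where "F t = ec c (b * q * t\<^sup>2 + b * a * L * t)" for t
  have g: "g > 0" "g dvd c" using c by (simp_all add: g_def)
  then have cu: "c = u * g" using u by (simp add: g_def)
  then have u0: "u > 0" using c g by (simp add: zero_less_mult_iff)
  have "g dvd h $ i" for i
    unfolding g_def by (meson Gcd_dvd dvd_trans gcd_dvd2 rangeI)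
  then have "vcong g h 0" by (simp add: vcong_def cong_0_iff)
  then obtain h' where h': "h = 0 + g *s h'" by (rule vcongE)
  have q: "q = g * (g * quad B h')" and L: "L = g * dot m (B *v h')"
    by (simp_all add: q_def L_def h' quad_scale[OF B] matrix_vector_scale dot_scale_right power2_eq_square)
  have per: "F x = F y" if xy: "[x = y] (mod u)" for x y
    unfolding F_def
  proof (rule ec_cong)
    obtain k where k: "x = y + u * k" using xy by (rule int_congE)
    have "(b * q * x\<^sup>2 + b * a * L * x) - (b * q * y\<^sup>2 + b * a * L * y) =
        (u * g) * (b * (g * quad B h') * k * (2 * y + u * k) + b * a * dot m (B *v h') * k)"
      unfolding q L k by (simp add: power2_eq_square algebra_simps)
    then show "[b * q * x\<^sup>2 + b * a * L * x = b * q * y\<^sup>2 + b * a * L * y] (mod c)"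
      unfolding cu cong_iff_dvd_diff by simp
  qed
  have "(\<Sum>t\<in>{0..<c}. F t) = of_int g * (\<Sum>t\<in>{0..<u}. F t)"
    unfolding cu using u0 g(1) per by (rule sum_int_periodic)
  \<comment> \<open>The linear term in \<open>C\<close> has the sign opposite to the one produced by
    completing the square.\<close>
  also have "(\<Sum>t\<in>{0..<u}. F t) = (\<Sum>t\<in>{0..<u}. F (- t))"
  proof (rule sum_int_reindex[symmetric, OF u0])
    show "[x = y] (mod u)" if "[- x = - y] (mod u)" for x y
      using cong_mult[OF cong_refl[of "-1"] that] by simp
  qed (rule per)
  also have "\<dots> = (\<Sum>v\<in>{0..u - 1}. ec c (b * q * v\<^sup>2 - b * a * L * v))"
    unfolding F_def by (intro sum.cong) auto
  finally have "(\<Sum>t\<in>{0..<c}. F t) = of_int g * (\<Sum>v\<in>{0..u - 1}. ec c (b * q * v\<^sup>2 - b * a * L * v))" .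
  then show ?thesis
    using False g(1) by (simp add: F_def cu)
qed

theorem theorem6p2:
  fixes G Gperp :: "real ^ 'n ^ 'n"
    and D N a c c0 c' aperp u :: int
    and k :: nat
    and w :: "real ^ 'n"
    and h :: "int ^ 'n"
    and R :: "(int ^ 'n) set"
    and C :: complex
  assumes "transpose G = G" and "even_integral G" and "invertible G"
    and "real_of_int D = det G"
    and "N = int (level G)"
    and "Gperp = real_of_int N *\<^sub>R matrix_inv G"
    and "c \<ge> 1" and "a \<noteq> 0" and "coprime c a" and "coprime c N"
    and "w \<in> range (\<lambda>m :: int ^ 'n. matrix_inv G *v real_vec m)"
    and "u = c div gcd c (GCD i. h $ i)"
    and "c = 2 ^ k * c0" and "odd c0"
    and "[c * c' = 1] (mod (a * N))"
    and "[aperp * a * N = - 1] (mod c)"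
    and "residue_system c R"
    and "C =
      (if [real_vec h \<bullet> (Gperp *v real_vec h) = 0] (rmod (2 * real_of_int c)) then
         (if [real_of_int N * (w \<bullet> real_vec h) = 0] (rmod (real_of_int c)) then 1 else 0)
       else
         (\<Sum>v\<in>{0..u - 1}.
            e2pi (complex_of_real
              (real_of_int aperp * (real_vec h \<bullet> (Gperp *v real_vec h)) / (2 * real_of_int c) *
               ((real_of_int v)\<^sup>2 -
                2 * real_of_int a * real_of_int N * (w \<bullet> real_vec h) /
                  (real_vec h \<bullet> (Gperp *v real_vec h)) * real_of_int v))))
         / of_int u)"
  shows
    "(\<Sum>v \<in> {v \<in> R. [(\<Sum>i\<in>UNIV. v $ i * h $ i) = 0] (mod c)}.
        e2pi (complex_of_real
          (real_of_int a / real_of_int c *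
           (1 / 2 * ((real_vec v + w) \<bullet> (G *v (real_vec v + w)))))))
     = complex_of_real (real_of_int c powr (real CARD('n) / 2)) *
       of_int (kronecker \<bar>a\<bar> c) ^ CARD('n) *
       of_int (kronecker D c) *
       e2pi (complex_of_real (real CARD('n) * real_of_int (sgn a * (1 - c0)) / 8)) *
       e2pi (complex_of_real (real_of_int a * real_of_int c' / 2 * (w \<bullet> (G *v w)))) *
       C"
proof -
  have c: "c > 0" using assms(7) by simp
  obtain A where A: "G = rmat A" "even_sym A"
    using even_integral_symmetric[OF assms(2,1)] .
  have D: "D = det A" using assms(4) by (simp add: A(1) det_rmat)
  have D0: "det A \<noteq> 0" using assms(3) by (simp add: A(1) invertible_det_nz det_rmat)
  have N0: "N > 0" and Gperp_even: "even_integral Gperp"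
    using level_even_integral[OF D0] by (simp_all add: A(1) assms(5,6))
  have "transpose Gperp = Gperp"
    using transpose_eqD[OF transpose_matrix_inv[OF assms(3,1)]]
    by (simp add: assms(6) transpose_def vec_eq_iff)
  then obtain B where B: "Gperp = rmat B" "even_sym B"
    using even_integral_symmetric[OF Gperp_even] by blast
  have symB: "transpose B = B" and symA: "transpose A = A"
    using A B by (simp_all add: even_sym_def)
  have AB: "A ** B = mat N"
  proof -
    have "rmat (A ** B) = real_of_int N *\<^sub>R mat 1"
      unfolding rmat_mult A(1)[symmetric] B(1)[symmetric] assms(6)
      by (simp add: matrix_scalar_ac matrix_inv_right[OF assms(3)] flip: scalar_matrix_assoc)
    also have "\<dots> = rmat (mat N)" by (simp add: rmat_def mat_def vec_eq_iff)
    finally show ?thesis by (simp add: rmat_eq_iff)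
  qed
  \<comment> \<open>det A times det B is N^n, so coprimality of \<open>c\<close> with
    \<open>N\<close> passes to \<open>D\<close>.\<close>
  have copD: "coprime (det A) c"
  proof -
    have "det A * det B = N ^ CARD('n)"
      using det_mul[of A B] AB by (simp add: det_diagonal mat_def)
    moreover have "coprime (N ^ CARD('n)) c" using assms(10) by (simp add: coprime_commute)
    ultimately show ?thesis by (metis coprime_mult_left_iff)
  qed
  \<comment> \<open>This \<open>m\<close> is \<open>G w\<close>; its integrality makes the linear
    term of the summand integral.\<close>
  obtain m where w: "w = matrix_inv G *v real_vec m" using assms(11) by blast
  have Gw: "G *v w = real_vec m"
    by (simp add: w matrix_vector_mul_assoc matrix_inv_right[OF assms(3)])
  have Nw: "real_of_int N *\<^sub>R w = real_vec (B *v m)"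
    unfolding w rmat_vec[symmetric] B(1)[symmetric] assms(6) by (simp add: scaleR_matrix_vector_assoc)
  have Nwx: "real_of_int N * (w \<bullet> real_vec x) = real_of_int (dot m (B *v x))" for x
    using real_vec_inner[of "B *v m" x] dot_symmetric_matrix[OF symB, of m x]
    by (simp add: Nw[symmetric] dot_commute)
  define t q L where "t = quad B m" and "q = quad B h" and "L = dot m (B *v h)"
  have NL: "real_of_int N * (w \<bullet> real_vec h) = real_of_int L" by (simp add: Nwx L_def)
  have "real_of_int N * (w \<bullet> (G *v w)) = real_of_int (2 * t)"
    by (simp only: Gw Nwx t_def two_quad[OF B(2)])
  then have wGw: "w \<bullet> (G *v w) = 2 * real_of_int t / real_of_int N"
    using N0 by (simp add: field_simps)
  have hGh: "real_vec h \<bullet> (Gperp *v real_vec h) = real_of_int (2 * q)"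
    by (simp only: B(1) rmat_vec real_vec_inner q_def two_quad[OF B(2)])
  have aperp: "[aperp * a * N = - 1] (mod c)" by (rule assms(16))
  \<comment> \<open>The constant part a t / (c N) of the exponent; the denominator keeps it outside
    \<open>ec c\<close> until \<open>ec_shift_phase\<close> combines the two.\<close>
  define z where "z = cis (2 * pi * (of_int (a * t) / of_int (c * N)))"
  have summand: "e2pi (complex_of_real (real_of_int a / real_of_int c *
      (1 / 2 * ((real_vec v + w) \<bullet> (G *v (real_vec v + w)))))) =
      ec c (a * quad A v + dot v (a *s m)) * z" for v
  proof -
    have "w \<bullet> (G *v real_vec v) = real_of_int (dot v m)"
      using inner_rmat[OF symA, of w "real_vec v"] Gw
      by (simp add: A(1)[symmetric] real_vec_inner dot_commute)
    moreover have "real_vec v \<bullet> (G *v real_vec v) = real_of_int (2 * quad A v)"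
      by (simp only: A(1) rmat_vec real_vec_inner two_quad[OF A(2)])
    ultimately have expand: "(real_vec v + w) \<bullet> (G *v (real_vec v + w)) =
        real_of_int (2 * quad A v) + 2 * real_of_int (dot v m) + 2 * real_of_int t / real_of_int N"
      by (simp add: matrix_vector_right_distrib inner_add_left inner_add_right wGw)
        (simp add: Gw real_vec_inner)
    have "real_of_int a / real_of_int c * (1 / 2 * ((real_vec v + w) \<bullet> (G *v (real_vec v + w)))) =
        real_of_int (a * quad A v + dot v (a *s m)) / real_of_int c + of_int (a * t) / of_int (c * N)"
      unfolding expand using c N0 by (simp add: dot_scale_right field_simps)
    then show ?thesis
      by (simp only: e2pi_of_real z_def ec_def ring_distribs(1) cis_mult times_divide_eq_right)
  qed
  have "(\<Sum>v \<in> {v \<in> R. [(\<Sum>i\<in>UNIV. v $ i * h $ i) = 0] (mod c)}.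
        e2pi (complex_of_real
          (real_of_int a / real_of_int c *
           (1 / 2 * ((real_vec v + w) \<bullet> (G *v (real_vec v + w))))))) =
      (\<Sum>v\<in>{v \<in> R. c dvd dot v h}. ec c (a * quad A v + dot v (a *s m))) * z"
    unfolding summand cong_0_iff dot_def[symmetric] by (simp add: sum_distrib_right)
  also have "(\<Sum>v\<in>{v \<in> R. c dvd dot v h}. ec c (a * quad A v + dot v (a *s m))) =
      (\<Sum>v\<in>{v \<in> rbox c. c dvd dot v h}. ec c (a * quad A v + dot v (a *s m)))"
  proof (rule sum_residue_system_filter[OF c assms(17)])
    show "periodic c (\<lambda>v. ec c (a * quad A v + dot v (a *s m)))"
      by (auto simp: periodic_def intro!: ec_cong cong_add cong_mult quad_cong[OF A(2)] dot_cong)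
        (simp add: vcong_def)
    show "(c dvd dot v h) = (c dvd dot v' h)" if "vcong c v v'" for v v'
      using that by (intro cong_dvd_iff dot_cong) (simp_all add: vcong_def)
  qed
  also have "\<dots> = gsum A a c * ec c (aperp * a\<^sup>2 * t) *
      ((\<Sum>s\<in>{0..<c}. ec c (aperp * q * s\<^sup>2 + aperp * a * L * s)) / of_int c)"
    unfolding t_def q_def L_def by (rule sum_quadratic_hyperplane[OF A(2) B(2) AB c aperp])
  also have "(\<Sum>s\<in>{0..<c}. ec c (aperp * q * s\<^sup>2 + aperp * a * L * s)) / of_int c = C"
  proof -
    \<comment> \<open>The value is 2 q, so the condition modulo 2 c is divisibility of
      \<open>q\<close> by \<open>c\<close>.\<close>
    have 1: "[real_vec h \<bullet> (Gperp *v real_vec h) = 0] (rmod (2 * real_of_int c)) \<longleftrightarrow> c dvd q"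
      using rcong_0_iff_dvd[of "2 * c" "2 * q"] c by (simp add: hGh)
    have 2: "[real_of_int N * (w \<bullet> real_vec h) = 0] (rmod (real_of_int c)) \<longleftrightarrow> c dvd L"
      unfolding NL using c by (rule rcong_0_iff_dvd)
    have 3: "e2pi (complex_of_real
              (real_of_int aperp * (real_vec h \<bullet> (Gperp *v real_vec h)) / (2 * real_of_int c) *
               ((real_of_int v)\<^sup>2 -
                2 * real_of_int a * real_of_int N * (w \<bullet> real_vec h) /
                  (real_vec h \<bullet> (Gperp *v real_vec h)) * real_of_int v))) =
        ec c (aperp * q * v\<^sup>2 - aperp * a * L * v)" if "\<not> c dvd q" for v
    proof -
      have "q \<noteq> 0" using that by auto
      then have "real_of_int aperp * (real_vec h \<bullet> (Gperp *v real_vec h)) / (2 * real_of_int c) *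
               ((real_of_int v)\<^sup>2 -
                2 * real_of_int a * real_of_int N * (w \<bullet> real_vec h) /
                  (real_vec h \<bullet> (Gperp *v real_vec h)) * real_of_int v) =
          real_of_int (aperp * q * v\<^sup>2 - aperp * a * L * v) / real_of_int c"
        unfolding hGh using c by (simp add: field_simps NL[symmetric])
      then show ?thesis
        by (simp only: e2pi_of_real ec_def times_divide_eq_right)
    qed
    show ?thesis
      unfolding assms(18) 1 2 linear_quadratic_mean[OF B(2) c aperp assms(12), of m, folded q_def L_def]
      using 3 by simp
  qed
  finally have lhs: "(\<Sum>v \<in> {v \<in> R. [(\<Sum>i\<in>UNIV. v $ i * h $ i) = 0] (mod c)}.
        e2pi (complex_of_real
          (real_of_int a / real_of_int c *
           (1 / 2 * ((real_vec v + w) \<bullet> (G *v (real_vec v + w))))))) =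
      gsum A a c * (ec c (aperp * a\<^sup>2 * t) * z) * C"
    by (simp only: mult_ac)
  have "[c * c' = 1] (mod N)"
    using assms(15) by (rule cong_dvd_modulus) simp
  then have phase: "ec c (aperp * a\<^sup>2 * t) * z = cis (2 * pi * (of_int (a * c' * t) / of_int N))"
    unfolding z_def by (intro ec_shift_phase c N0 assms(10) aperp)
  have ww: "e2pi (complex_of_real (real_of_int a * real_of_int c' / 2 * (w \<bullet> (G *v w)))) =
      cis (2 * pi * (of_int (a * c' * t) / of_int N))"
    unfolding e2pi_of_real wGw by (simp add: mult.assoc)
  have "coprime a c" using assms(9) by (simp add: coprime_commute)
  note gs = gsum_eval[OF A(2) assms(13,14) c assms(8) this copD]
  have sgn: "e2pi (complex_of_real (real CARD('n) * real_of_int (sgn a * (1 - c0)) / 8)) =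
      cis (2 * pi * (of_int (sgn a) * (1 - of_int c0) / 8)) ^ CARD('n)"
    unfolding e2pi_of_real Complex.DeMoivre by (rule arg_cong[of _ _ cis]) (simp add: field_simps)
  have pw: "complex_of_real (real_of_int c powr (real CARD('n) / 2)) = of_real (sqrt (of_int c)) ^ CARD('n)"
    using powr_half_nat[of "real_of_int c" "CARD('n)"] c by simp
  show ?thesis
    unfolding lhs phase ww gs sgn pw D by (simp only: mult_ac)
qed

end
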